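(* Let $\nu\in(0,1]$, $n\geq 1$ an integer, $T>0$ and $v\in\mathcal{D}([0,T];H^{n})$. Then there is a unique pathwise solution $w\in\mathcal{D}([0,T];H^{n})$ of the equation \[ \partial_t w=\nu\partial_{xx}w-\tfrac{1}{2}\partial_{x}(w+v)^{2},\qquad w(0)=0, \] and there exists a constant $C_n=C_n(T,\nu,\|v\|_{\mathcal{D}_T^n})>0$ such that \[ \|w\|_{\mathcal{D}_T^n}^{2}+\int_{0}^{T}\|w(t)\|_{n+1}^{2}\,dt\leq C_n . \]
   Context: $\mathbb{S}^1=\mathbb{R}/\mathbb{Z}$. $H=\{\phi\in L^2(\mathbb{S}^1):\int_{\mathbb{S}^1}\phi\,dx=0\}$ with $L^2$ scalar product and norm $\|\cdot\|$. For an integer $m\geq0$, $H^m=\{u\in H:\partial_x^mu\in L^2\}$ with homogeneous norm $\|u\|_m=\|\partial_x^mu\|$. $\mathcal{D}([0,T];H^n)$ denotes the Banach space of càdlàg (right-continuous with left limits) functions $[0,T]\to H^n$, with the uniform norm $\|u\|_{\mathcal{D}_T^n}=\sup_{t\in[0,T]}\|u(t)\|_n$. A solution of the equation is understood in the integral (distributional in $x$) sense: $w(t)=\int_0^t\big(\nu\partial_{xx}w-\frac12\partial_x(w+v)^2\big)ds$ for all $t\in[0,T]$; here $v$ is a fixed (pathwise given) function. *)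

theory Defs
  imports "HOL-Analysis.Analysis"
begin

text \<open>Functions on S^1 = R/Z are represented by 1-periodic functions real => real;
  equality in L^2 is equality almost everywhere on [0,1].\<close>

definition periodic1 :: "(real \<Rightarrow> real) \<Rightarrow> bool" where
  "periodic1 u \<longleftrightarrow> (\<forall>x. u (x + 1) = u x)"

definition in_L2 :: "(real \<Rightarrow> real) \<Rightarrow> bool" where
  "in_L2 u \<longleftrightarrow> periodic1 u \<and> u \<in> borel_measurable (lebesgue_on {0..1})
      \<and> integrable (lebesgue_on {0..1}) (\<lambda>x. (u x)\<^sup>2)"

definition l2_inner :: "(real \<Rightarrow> real) \<Rightarrow> (real \<Rightarrow> real) \<Rightarrow> real" where
  "l2_inner u v = (LINT x|lebesgue_on {0..1}. u x * v x)"

definition l2_norm :: "(real \<Rightarrow> real) \<Rightarrow> real" where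
  "l2_norm u = sqrt (LINT x|lebesgue_on {0..1}. (u x)\<^sup>2)"

definition test_fun :: "(real \<Rightarrow> real) \<Rightarrow> bool" where
  "test_fun \<phi> \<longleftrightarrow> periodic1 \<phi> \<and> (\<forall>k x. ((deriv ^^ k) \<phi>) differentiable (at x))"

definition weak_deriv :: "nat \<Rightarrow> (real \<Rightarrow> real) \<Rightarrow> (real \<Rightarrow> real) \<Rightarrow> bool" where
  "weak_deriv m u g \<longleftrightarrow> (\<forall>\<phi>. test_fun \<phi> \<longrightarrow>
       l2_inner u ((deriv ^^ m) \<phi>) = (-1) ^ m * l2_inner g \<phi>)"

definition Hs :: "nat \<Rightarrow> (real \<Rightarrow> real) set" where
  "Hs m = {u. in_L2 u \<and> (LINT x|lebesgue_on {0..1}. u x) = 0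
              \<and> (\<exists>g. in_L2 g \<and> weak_deriv m u g)}"

definition Dx :: "nat \<Rightarrow> (real \<Rightarrow> real) \<Rightarrow> (real \<Rightarrow> real)" where
  "Dx m u = (SOME g. in_L2 g \<and> weak_deriv m u g)"

definition Hnorm :: "nat \<Rightarrow> (real \<Rightarrow> real) \<Rightarrow> real" where
  "Hnorm m u = l2_norm (Dx m u)"

definition cadlag :: "nat \<Rightarrow> real \<Rightarrow> (real \<Rightarrow> real \<Rightarrow> real) \<Rightarrow> bool" where
  "cadlag n T u \<longleftrightarrow>
     (\<forall>t\<in>{0..T}. u t \<in> Hs n)
   \<and> (\<forall>t\<in>{0..<T}. ((\<lambda>s. Hnorm n (u s - u t)) \<longlongrightarrow> 0) (at_right t))
   \<and> (\<forall>t\<in>{0<..T}. \<exists>l\<in>Hs n. ((\<lambda>s. Hnorm n (u s - l)) \<longlongrightarrow> 0) (at_left t))"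

definition Dnorm :: "nat \<Rightarrow> real \<Rightarrow> (real \<Rightarrow> real \<Rightarrow> real) \<Rightarrow> real" where
  "Dnorm n T u = (SUP t\<in>{0..T}. Hnorm n (u t))"

text \<open>w solves w(t) = int_0^t (nu w_xx - 1/2 d_x (w+v)^2) ds, in the distributional
  sense in x (tested against smooth periodic functions), for all t in [0,T].\<close>
definition solves :: "real \<Rightarrow> real \<Rightarrow> (real \<Rightarrow> real \<Rightarrow> real) \<Rightarrow> (real \<Rightarrow> real \<Rightarrow> real) \<Rightarrow> bool" where
  "solves \<nu> T v w \<longleftrightarrow> (\<forall>t\<in>{0..T}. \<forall>\<phi>. test_fun \<phi> \<longrightarrow>
     (let F = (\<lambda>s. \<nu> * l2_inner (w s) (deriv (deriv \<phi>))
                  + 1/2 * l2_inner (\<lambda>x. (w s x + v s x)\<^sup>2) (deriv \<phi>))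
      in integrable (lebesgue_on {0..t}) F
         \<and> l2_inner (w t) \<phi> = (LINT s|lebesgue_on {0..t}. F s)))"

end

theory Submission
  imports Defs
begin

text \<open>
  In terms of Fourier coefficients the equation is a countable system of scalar equations, coupled
  through a convolution. The dissipation absorbs the derivative in the flux: if \<open>q\<close> is the square
  of \<open>w + v\<close>, then \<open>\<bar>w\<^sub>k(t)\<bar>\<^sup>2 + \<nu> \<integral> (2 \<pi> k)\<^sup>2 \<bar>w\<^sub>k\<bar>\<^sup>2 \<le> (4 \<nu>)\<^sup>-\<^sup>1 \<integral> \<bar>q\<^sub>k\<bar>\<^sup>2\<close>. Squaring is locally Lipschitz on
  \<open>H\<^sup>n\<close>, because \<open>H\<^sup>1\<close> has summable coefficients and \<open>\<ell>\<^sup>1 * \<ell>\<^sup>2 \<subseteq> \<ell>\<^sup>2\<close>. Uniqueness follows by Gronwall's inequality,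
  and, once the square is truncated outside a ball of \<open>H\<^sup>n\<close>, global existence by contraction.

  The truncation multiplies the flux by a factor in \<open>[0, 1]\<close> that depends on time only, so it does not
  affect the a priori estimates: the integral of \<open>w\<^sup>2 \<partial>\<^sub>x w\<close> vanishes, which bounds \<open>w\<close> in \<open>L\<^sup>2(0, T; H\<^sup>1)\<close>, and then
  \<open>\<parallel>u\<^sup>2\<parallel>\<^sub>n \<le> C \<parallel>u\<parallel>\<^sub>1 \<parallel>u\<parallel>\<^sub>n\<close> and Gronwall's inequality bound \<open>w\<close> in \<open>H\<^sup>n\<close>. A ball larger than this bound
  makes the truncation inactive.
\<close>

section \<open>Square-summable sequences indexed by the integers\<close>

text \<open>The equation holds only in integrated form and \<open>v\<close> may jump, so no path is
  differentiated in time: energy identities, Duhamel's formula and the powers in Gronwall's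
  inequality all come from a product rule for indefinite integrals. Moreover
  \<open>\<nu> w_xx\<close> leaves the space of \<open>w\<close>. Estimates are therefore proved for
  finitely many modes and then summed, with bounds uniform in time.

  The dissipation in L^2 is split: one half absorbs the flux, the other yields the time integral of
  the squared H^1 norm. This integral suffices for H^n because the product estimate puts one of the
  two factors in H^1 only, so that the Gronwall coefficient need only be integrable in time.

  Two kinds of bounds must be kept apart. A qualitative bound \<open>B\<close> on the path in H^n
  justifies integrability and limits, but the constants \<open>apL2\<close> to \<open>apInt\<close>
  contain only \<open>n\<close>, \<open>\<nu>\<close>, \<open>T\<close> and the bound
  \<open>M\<close> of \<open>v\<close>. Hence the truncation radius can be fixed before the solution
  exists.\<close>

definition sqs :: "(int \<Rightarrow> complex) \<Rightarrow> bool" where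
  "sqs a \<longleftrightarrow> (\<lambda>k. (cmod (a k))\<^sup>2) summable_on UNIV"

definition nsq :: "(int \<Rightarrow> complex) \<Rightarrow> real" where
  "nsq a = (\<Sum>\<^sub>\<infinity>k. (cmod (a k))\<^sup>2)"

lemma nsq_nonneg [simp]: "0 \<le> nsq a"
  unfolding nsq_def by (intro infsum_nonneg) auto

lemma sqs_sum_le: "sqs a \<Longrightarrow> finite F \<Longrightarrow> (\<Sum>k\<in>F. (cmod (a k))\<^sup>2) \<le> nsq a"
  unfolding nsq_def sqs_def by (rule finite_sum_le_infsum) auto

lemma sqsI:
  assumes "\<And>F. finite F \<Longrightarrow> (\<Sum>k\<in>F. (cmod (a k))\<^sup>2) \<le> B"
  shows "sqs a" "nsq a \<le> B"
proof -
  show "sqs a"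
    unfolding sqs_def by (rule nonneg_bdd_above_summable_on) (auto intro!: bdd_aboveI2 assms)
  then show "nsq a \<le> B"
    unfolding nsq_def sqs_def by (rule infsum_le_finite_sums) (auto intro: assms)
qed

lemma sqs_comparison:
  assumes "sqs b" "\<And>k. cmod (a k) \<le> cmod (b k)"
  shows "sqs a" "nsq a \<le> nsq b"
proof -
  have "(\<Sum>k\<in>F. (cmod (a k))\<^sup>2) \<le> nsq b" if "finite F" for F
    using sqs_sum_le[OF assms(1) that] assms(2)
    by (meson order_trans sum_mono power_mono norm_ge_zero)
  then show "sqs a" "nsq a \<le> nsq b" using sqsI[of a "nsq b"] by auto
qed

lemma sqs_cmult:
  assumes "sqs a"
  shows "sqs (\<lambda>k. c * a k)" "nsq (\<lambda>k. c * a k) = (cmod c)\<^sup>2 * nsq a"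
  using assms unfolding sqs_def nsq_def
  by (simp_all add: norm_mult power_mult_distrib summable_on_cmult_right infsum_cmult_right')

lemma cmod_add_sq_le: "(cmod (x + y))\<^sup>2 \<le> 2 * (cmod x)\<^sup>2 + 2 * (cmod y)\<^sup>2"
proof -
  have "(cmod (x + y))\<^sup>2 \<le> (cmod x + cmod y)\<^sup>2"
    by (intro power_mono norm_triangle_ineq) auto
  also have "\<dots> \<le> 2 * (cmod x)\<^sup>2 + 2 * (cmod y)\<^sup>2"
    using sum_squares_bound[of "cmod x" "cmod y"] by (simp add: power2_sum)
  finally show ?thesis .
qed

lemma sqs_add:
  assumes "sqs a" "sqs b"
  shows "sqs (\<lambda>k. a k + b k)" "nsq (\<lambda>k. a k + b k) \<le> 2 * nsq a + 2 * nsq b"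
proof -
  have "(\<Sum>k\<in>F. (cmod (a k + b k))\<^sup>2) \<le> 2 * nsq a + 2 * nsq b" if "finite F" for F
  proof -
    have "(\<Sum>k\<in>F. (cmod (a k + b k))\<^sup>2) \<le> (\<Sum>k\<in>F. 2 * (cmod (a k))\<^sup>2 + 2 * (cmod (b k))\<^sup>2)"
      by (intro sum_mono cmod_add_sq_le)
    also have "\<dots> \<le> 2 * nsq a + 2 * nsq b"
      using sqs_sum_le[OF assms(1) that] sqs_sum_le[OF assms(2) that]
      by (simp add: sum.distrib flip: sum_distrib_left)
    finally show ?thesis .
  qed
  then show "sqs (\<lambda>k. a k + b k)" "nsq (\<lambda>k. a k + b k) \<le> 2 * nsq a + 2 * nsq b"
    using sqsI[of "\<lambda>k. a k + b k" "2 * nsq a + 2 * nsq b"] by auto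
qed

lemma sqs_uminus: "sqs a \<Longrightarrow> sqs (\<lambda>k. - a k)"
  by (simp add: sqs_def)

lemma sqs_diff:
  assumes "sqs a" "sqs b"
  shows "sqs (\<lambda>k. a k - b k)"
  using sqs_add(1)[OF assms(1) sqs_uminus[OF assms(2)]] by simp

lemma sqs_cauchy_schwarz:
  assumes "sqs a" "sqs b"
  shows "(\<lambda>k. cmod (a k) * cmod (b k)) summable_on UNIV"
    "(\<Sum>\<^sub>\<infinity>k. cmod (a k) * cmod (b k)) \<le> sqrt (nsq a) * sqrt (nsq b)"
proof -
  have *: "(\<Sum>k\<in>F. cmod (a k) * cmod (b k)) \<le> sqrt (nsq a) * sqrt (nsq b)" if "finite F" for F
  proof -
    have "(\<Sum>k\<in>F. cmod (a k) * cmod (b k)) \<le> L2_set (\<lambda>k. cmod (a k)) F * L2_set (\<lambda>k. cmod (b k)) F"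
      using L2_set_mult_ineq[of "\<lambda>k. cmod (a k)" "\<lambda>k. cmod (b k)" F] by simp
    also have "\<dots> \<le> sqrt (nsq a) * sqrt (nsq b)"
      unfolding L2_set_def using assms that
      by (intro mult_mono real_sqrt_le_mono sqs_sum_le) (auto simp: sum_nonneg)
    finally show ?thesis .
  qed
  show 1: "(\<lambda>k. cmod (a k) * cmod (b k)) summable_on UNIV"
    by (rule nonneg_bdd_above_summable_on) (auto intro!: bdd_aboveI2 *)
  show "(\<Sum>\<^sub>\<infinity>k. cmod (a k) * cmod (b k)) \<le> sqrt (nsq a) * sqrt (nsq b)"
    by (rule infsum_le_finite_sums[OF 1]) (auto intro: *)
qed

lemma sqs_mult_abs_summable:
  assumes "sqs a" "sqs b"
  shows "(\<lambda>k. norm (a k * b k)) summable_on UNIV" "(\<lambda>k. a k * b k) summable_on UNIV"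
    "cmod (\<Sum>\<^sub>\<infinity>k. a k * b k) \<le> sqrt (nsq a) * sqrt (nsq b)"
proof -
  show 1: "(\<lambda>k. norm (a k * b k)) summable_on UNIV"
    using sqs_cauchy_schwarz[OF assms] by (simp add: norm_mult)
  then show "(\<lambda>k. a k * b k) summable_on UNIV" by (rule abs_summable_summable)
  show "cmod (\<Sum>\<^sub>\<infinity>k. a k * b k) \<le> sqrt (nsq a) * sqrt (nsq b)"
    using norm_infsum_bound[OF 1] sqs_cauchy_schwarz(2)[OF assms] by (simp add: norm_mult)
qed

lemma sqs_reindex:
  assumes "sqs a" "bij g"
  shows "sqs (\<lambda>k. a (g k))" "nsq (\<lambda>k. a (g k)) = nsq a"
  using assms summable_on_reindex_bij_betw[of g UNIV UNIV "\<lambda>k. (cmod (a k))\<^sup>2"]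
    infsum_reindex_bij_betw[of g UNIV UNIV "\<lambda>k. (cmod (a k))\<^sup>2"]
  unfolding sqs_def nsq_def by auto

lemma sqs_cnj: "sqs a \<Longrightarrow> sqs (\<lambda>k. cnj (a k))" "nsq (\<lambda>k. cnj (a k)) = nsq a"
  by (simp_all add: sqs_def nsq_def)

section \<open>Symmetric partial sums\<close>

definition isym :: "nat \<Rightarrow> int set" where
  "isym N = {- int N..int N}"

lemma finite_isym [simp]: "finite (isym N)" by (simp add: isym_def)

lemma isym_mono: "M \<le> N \<Longrightarrow> isym M \<subseteq> isym N" by (auto simp: isym_def)

text \<open>Symmetric intervals are cofinal among the finite sets of integers. Unordered sums thus
  become limits of sequences, the form that measurability and dominated convergence require.\<close>

lemma filterlim_isym: "filterlim isym (finite_subsets_at_top UNIV) sequentially"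
proof (rule filterlim_finite_subsets_at_top[THEN iffD2], intro allI impI)
  fix X :: "int set" assume X: "finite X \<and> X \<subseteq> UNIV"
  obtain N :: nat where N: "\<forall>k\<in>X. \<bar>k\<bar> \<le> int N"
  proof -
    have "\<exists>N. \<forall>k\<in>X. \<bar>k\<bar> \<le> int N"
    proof (intro exI ballI)
      fix k assume "k \<in> X"
      then have "nat \<bar>k\<bar> \<le> Max ((\<lambda>k. nat \<bar>k\<bar>) ` X)" using X by (intro Max_ge) auto
      then show "\<bar>k\<bar> \<le> int (Max ((\<lambda>k. nat \<bar>k\<bar>) ` X))" by linarith
    qed
    then show ?thesis using that by blast
  qed
  have "X \<subseteq> isym M" if "N \<le> M" for M
  proof
    fix k assume "k \<in> X"
    then have "\<bar>k\<bar> \<le> int N" using N by auto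
    then show "k \<in> isym M" using that by (auto simp: isym_def)
  qed
  then show "\<forall>\<^sub>F M in sequentially. finite (isym M) \<and> X \<subseteq> isym M \<and> isym M \<subseteq> UNIV"
    by (intro eventually_sequentiallyI[of N]) auto
qed

lemma has_sum_isym_tendsto:
  assumes "(f has_sum s) (UNIV :: int set)"
  shows "(\<lambda>N. \<Sum>k\<in>isym N. f k) \<longlonglongrightarrow> s"
  using filterlim_compose[OF assms[unfolded has_sum_def] filterlim_isym] by simp

lemma nsq_isym_tendsto:
  assumes "sqs a"
  shows "(\<lambda>N. \<Sum>k\<in>isym N. (cmod (a k))\<^sup>2) \<longlonglongrightarrow> nsq a"
  using assms unfolding sqs_def nsq_def by (intro has_sum_isym_tendsto has_sum_infsum)

lemma finite_subset_isym:
  assumes "finite (F :: int set)" shows "\<exists>N. F \<subseteq> isym N"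
  using filterlim_isym[unfolded filterlim_finite_subsets_at_top] assms
  unfolding eventually_sequentially by (meson order_refl subset_UNIV)

lemma sqsI_isym:
  assumes "\<And>N. (\<Sum>k\<in>isym N. (cmod (a k))\<^sup>2) \<le> B"
  shows "sqs a" "nsq a \<le> B"
proof -
  have "(\<Sum>k\<in>F. (cmod (a k))\<^sup>2) \<le> B" if F: "finite F" for F
  proof -
    obtain N where "F \<subseteq> isym N" using finite_subset_isym[OF F] by auto
    then have "(\<Sum>k\<in>F. (cmod (a k))\<^sup>2) \<le> (\<Sum>k\<in>isym N. (cmod (a k))\<^sup>2)"
      by (intro sum_mono2) auto
    then show ?thesis using assms[of N] by simp
  qed
  then show "sqs a" "nsq a \<le> B" using sqsI[of a B] by auto
qed

text \<open>Vanishing at 0 and conjugate symmetry encode real-valued functions of mean zero.\<close>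

typedef hseq = "{a :: int \<Rightarrow> complex. a 0 = 0 \<and> (\<forall>k. a (- k) = cnj (a k)) \<and> sqs a}"
  morphisms cf Hseq
  by (rule exI[of _ "\<lambda>k. 0"]) (simp add: sqs_def)

lemma cf_0 [simp]: "cf x 0 = 0"
  and cf_minus [simp]: "cf x (- k) = cnj (cf x k)"
  and sqs_cf [simp]: "sqs (cf x)"
  using cf[of x] by auto

lemma cf_Hseq: "a 0 = 0 \<Longrightarrow> (\<And>k. a (- k) = cnj (a k)) \<Longrightarrow> sqs a \<Longrightarrow> cf (Hseq a) = a"
  by (rule Hseq_inverse) auto

lemma hseq_eqI: "(\<And>k. cf x k = cf y k) \<Longrightarrow> x = y"
  by (metis cf_inject ext)

section \<open>The Hilbert space \<open>hseq\<close>\<close>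

instantiation hseq :: real_inner
begin

definition "zero_hseq = Hseq (\<lambda>k. 0)"
definition "plus_hseq x y = Hseq (\<lambda>k. cf x k + cf y k)"
definition "uminus_hseq x = Hseq (\<lambda>k. - cf x k)"
definition minus_hseq :: "hseq \<Rightarrow> hseq \<Rightarrow> hseq" where "minus_hseq x y = Hseq (\<lambda>k. cf x k - cf y k)"
definition "scaleR_hseq c x = Hseq (\<lambda>k. c *\<^sub>R cf x k)"
definition "inner_hseq x y = (\<Sum>\<^sub>\<infinity>k. cf x k \<bullet> cf y k)"
definition "norm_hseq x = sqrt (nsq (cf x))"
definition "sgn_hseq (x :: hseq) = scaleR (inverse (norm x)) x"
definition dist_hseq :: "hseq \<Rightarrow> hseq \<Rightarrow> real" where "dist_hseq x y = norm (x - y)"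
definition "(uniformity :: (hseq \<times> hseq) filter) = (INF e\<in>{0<..}. principal {(x, y). dist x y < e})"
definition "open (U :: hseq set) \<longleftrightarrow> (\<forall>x\<in>U. \<forall>\<^sub>F (x', y) in uniformity. x' = x \<longrightarrow> y \<in> U)"

lemma cf_zero: "cf 0 k = 0"
  by (simp add: zero_hseq_def cf_Hseq sqs_def)

lemma cf_plus: "cf (x + y) k = cf x k + cf y k"
  by (simp add: plus_hseq_def cf_Hseq sqs_add)

lemma cf_uminus: "cf (- x) k = - cf x k"
  by (simp add: uminus_hseq_def cf_Hseq sqs_uminus)

lemma cf_diff: "cf (x - y) k = cf x k - cf y k"
  by (simp add: minus_hseq_def cf_Hseq sqs_diff)

lemma cf_scaleR: "cf (c *\<^sub>R x) k = c *\<^sub>R cf x k"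
proof -
  have "sqs (\<lambda>k. c *\<^sub>R cf x k)"
    using sqs_cmult(1)[of "cf x" "of_real c"] by (simp add: scaleR_conv_of_real)
  then show ?thesis by (simp add: scaleR_hseq_def cf_Hseq)
qed

lemma inner_cf_summable: "(\<lambda>k. cf x k \<bullet> cf y k) summable_on UNIV"
proof (rule abs_summable_summable, rule Infinite_Sum.abs_summable_on_comparison_test)
  show "(\<lambda>k. norm (cf x k * cf y k)) summable_on UNIV"
    by (intro sqs_mult_abs_summable) auto
qed (simp add: norm_mult Cauchy_Schwarz_ineq2)

instance
proof
  fix x y z :: hseq and a b :: real
  show "x + y + z = x + (y + z)" "x + y = y + x" "0 + x = x" "- x + x = 0" "x - y = x + - y"
    "a *\<^sub>R (x + y) = a *\<^sub>R x + a *\<^sub>R y" "(a + b) *\<^sub>R x = a *\<^sub>R x + b *\<^sub>R x"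
    "a *\<^sub>R b *\<^sub>R x = (a * b) *\<^sub>R x" "1 *\<^sub>R x = x"
    by (rule hseq_eqI; simp add: cf_zero cf_plus cf_uminus cf_diff cf_scaleR algebra_simps)+
  show "dist x y = norm (x - y)" by (rule dist_hseq_def)
  show "sgn x = scaleR (inverse (norm x)) x" by (rule sgn_hseq_def)
  show "uniformity = (INF e\<in>{0<..}. principal {(x, y :: hseq). dist x y < e})"
    by (rule uniformity_hseq_def)
  show "open U = (\<forall>x\<in>U. \<forall>\<^sub>F (x', y) in uniformity. x' = x \<longrightarrow> y \<in> U)" for U :: "hseq set"
    by (rule open_hseq_def)
  show "x \<bullet> y = y \<bullet> x" by (simp add: inner_hseq_def inner_commute)
  show "(x + y) \<bullet> z = x \<bullet> z + y \<bullet> z"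
    by (simp add: inner_hseq_def cf_plus inner_add_left infsum_add inner_cf_summable)
  show "(a *\<^sub>R x) \<bullet> y = a * (x \<bullet> y)"
    by (simp add: inner_hseq_def cf_scaleR infsum_cmult_right')
  have xx: "x \<bullet> x = nsq (cf x)"
    by (simp add: inner_hseq_def nsq_def power2_norm_eq_inner)
  show "0 \<le> x \<bullet> x" by (simp add: xx)
  show "norm x = sqrt (x \<bullet> x)" by (simp add: xx norm_hseq_def)
  show "x \<bullet> x = 0 \<longleftrightarrow> x = 0"
  proof
    assume "x \<bullet> x = 0"
    then have "nsq (cf x) = 0" by (simp add: xx)
    then have "(cmod (cf x k))\<^sup>2 = 0" for k
      using nonneg_infsum_le_0D[of "\<lambda>k. (cmod (cf x k))\<^sup>2" UNIV k] sqs_cf[of x]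
      by (auto simp: nsq_def sqs_def)
    then show "x = 0" by (intro hseq_eqI) (simp add: cf_zero)
  next
    assume "x = 0"
    then show "x \<bullet> x = 0" by (simp add: inner_hseq_def cf_zero)
  qed
qed

end

lemma norm_hseq_sq: "(norm x)\<^sup>2 = nsq (cf x)" for x :: hseq
  by (simp add: norm_hseq_def)

lemma norm_cf_le: "cmod (cf x k) \<le> norm x"
proof -
  have "(cmod (cf x k))\<^sup>2 \<le> (norm x)\<^sup>2"
    using sqs_sum_le[of "cf x" "{k}"] by (simp add: norm_hseq_sq)
  then show ?thesis by (simp add: power2_le_iff_abs_le)
qed

lemma norm_hseq_le_iff: "0 \<le> B \<Longrightarrow> norm x \<le> B \<longleftrightarrow> nsq (cf x) \<le> B\<^sup>2" for x :: hseq
  by (metis norm_hseq_sq norm_ge_zero power2_le_iff_abs_le abs_of_nonneg)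

lemma bounded_linear_cf: "bounded_linear (\<lambda>x. cf x k)"
  by (rule bounded_linear_intro[where K = 1]) (auto simp: cf_plus cf_scaleR norm_cf_le)

text \<open>The limit is taken coefficientwise. On a finite set of indices the Cauchy bound survives
  this limit, and since the set is arbitrary it bounds \<open>nsq\<close>. Completeness is what the
  contraction principle needs later.\<close>

instance hseq :: complete_space
proof
  fix X :: "nat \<Rightarrow> hseq" assume X: "Cauchy X"
  have "Cauchy (\<lambda>n. cf (X n) k)" for k
    by (rule bounded_linear.Cauchy[OF bounded_linear_cf X])
  then have "\<exists>a. \<forall>k. (\<lambda>n. cf (X n) k) \<longlonglongrightarrow> a k"
    by (meson Cauchy_convergent convergent_def)
  then obtain a where a: "\<And>k. (\<lambda>n. cf (X n) k) \<longlonglongrightarrow> a k" by blast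
  have key: "\<exists>N. \<forall>m\<ge>N. sqs (\<lambda>k. cf (X m) k - a k) \<and> nsq (\<lambda>k. cf (X m) k - a k) \<le> e\<^sup>2" if "e > 0" for e
  proof -
    obtain N where N: "\<And>m n. m \<ge> N \<Longrightarrow> n \<ge> N \<Longrightarrow> norm (X m - X n) < e"
      using X \<open>e > 0\<close> unfolding Cauchy_def dist_norm by blast
    have "(\<Sum>k\<in>F. (cmod (cf (X m) k - a k))\<^sup>2) \<le> e\<^sup>2" if "finite F" "m \<ge> N" for F m
    proof (rule tendsto_upperbound)
      show "(\<lambda>n. \<Sum>k\<in>F. (cmod (cf (X m) k - cf (X n) k))\<^sup>2) \<longlonglongrightarrow> (\<Sum>k\<in>F. (cmod (cf (X m) k - a k))\<^sup>2)"
        by (intro tendsto_intros a)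
      have "(\<Sum>k\<in>F. (cmod (cf (X m) k - cf (X n) k))\<^sup>2) \<le> e\<^sup>2" if "n \<ge> N" for n
      proof -
        have "(\<Sum>k\<in>F. (cmod (cf (X m) k - cf (X n) k))\<^sup>2) \<le> nsq (cf (X m - X n))"
          using sqs_sum_le[of "cf (X m - X n)" F] \<open>finite F\<close> by (simp add: cf_diff)
        also have "\<dots> \<le> e\<^sup>2"
          using N[OF \<open>m \<ge> N\<close> that] norm_ge_zero[of "X m - X n"]
          by (metis norm_hseq_sq less_imp_le power_mono)
        finally show ?thesis .
      qed
      then show "\<forall>\<^sub>F n in sequentially. (\<Sum>k\<in>F. (cmod (cf (X m) k - cf (X n) k))\<^sup>2) \<le> e\<^sup>2"
        by (auto simp: eventually_sequentially)
    qed simp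
    then show ?thesis
      by (intro exI[of _ N]) (auto intro: sqsI[where B = "e\<^sup>2"])
  qed
  obtain M where M: "sqs (\<lambda>k. cf (X M) k - a k)" using key[of 1] by auto
  have sa: "sqs a" using sqs_diff[OF sqs_cf[of "X M"] M] by simp
  have "a 0 = 0" using LIMSEQ_unique[OF a[of 0]] by simp
  moreover have "a (- k) = cnj (a k)" for k
    using LIMSEQ_unique[OF a[of "- k"]] tendsto_cnj[OF a[of k]] by simp
  ultimately have cfa: "cf (Hseq a) = a" using sa by (intro cf_Hseq) auto
  have "X \<longlonglongrightarrow> Hseq a"
  proof (rule LIMSEQ_I)
    fix r :: real assume "0 < r"
    then obtain N where N: "\<forall>m\<ge>N. nsq (\<lambda>k. cf (X m) k - a k) \<le> (r/2)\<^sup>2" using key[of "r/2"] by auto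
    have "norm (X m - Hseq a) < r" if "m \<ge> N" for m
    proof -
      have "norm (X m - Hseq a) \<le> r/2"
        using N that \<open>0 < r\<close> by (subst norm_hseq_le_iff) (auto simp: cf_diff cfa cong: nsq_def)
      then show ?thesis using \<open>0 < r\<close> by simp
    qed
    then show "\<exists>no. \<forall>n\<ge>no. norm (X n - Hseq a) < r" by blast
  qed
  then show "convergent X" by (auto simp: convergent_def)
qed

section \<open>Integrals over time intervals\<close>

lemma finite_measure_lebesgue_on_Icc: "finite_measure (lebesgue_on {a..b :: real})"
  by (intro finite_measure_lebesgue_on) auto

lemma borel_imp_lebesgue_on:
  "f \<in> borel_measurable borel \<Longrightarrow> f \<in> borel_measurable (lebesgue_on S)"
  for f :: "real \<Rightarrow> 'a::topological_space"
  by (intro measurable_restrict_space1 measurable_completion) simp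

lemma integrable_bounded_Icc:
  fixes f :: "real \<Rightarrow> 'a::{banach, second_countable_topology}"
  assumes "f \<in> borel_measurable (lebesgue_on {a..b})" "\<And>x. x \<in> {a..b} \<Longrightarrow> norm (f x) \<le> B"
  shows "integrable (lebesgue_on {a..b}) f"
  using assms by (intro finite_measure.integrable_const_bound[OF finite_measure_lebesgue_on_Icc, where B = B]) auto

lemma LINT_const_Icc: "a \<le> b \<Longrightarrow> (LINT x|lebesgue_on {a..b}. c) = (b - a) *\<^sub>R c"
  for c :: "'a::{banach, second_countable_topology}"
  by (simp add: measure_restrict_space)

lemma integrable_lebesgue_on_mono:
  fixes f :: "real \<Rightarrow> 'a::{banach, second_countable_topology}"
  assumes "integrable (lebesgue_on {a..b}) f" "c \<le> b"
  shows "integrable (lebesgue_on {a..c}) f"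
  proof -
  have "set_integrable lebesgue {a..b} f"
    using assms(1) by (simp add: set_integrable_def integrable_restrict_space)
  then have "set_integrable lebesgue {a..c} f"
    by (rule set_integrable_subset) (use assms(2) in auto)
  then show ?thesis by (simp add: set_integrable_def integrable_restrict_space)
qed

lemma LINT_lebesgue_on_if:
  fixes g :: "real \<Rightarrow> 'a::{banach, second_countable_topology}"
  assumes "s \<le> t"
  shows "(LINT r|lebesgue_on {a..t}. (if r \<le> s then g r else 0)) = (LINT r|lebesgue_on {a..s}. g r)"
proof -
  have "(LINT r|lebesgue_on {a..t}. (if r \<le> s then g r else 0))
      = (LINT r|lebesgue. indicator {a..t} r *\<^sub>R (if r \<le> s then g r else 0))"
    by (rule integral_restrict_space) auto
  also have "\<dots> = (LINT r|lebesgue. indicator {a..s} r *\<^sub>R g r)"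
    using assms by (intro Bochner_Integration.integral_cong) (auto simp: indicator_def)
  also have "\<dots> = (LINT r|lebesgue_on {a..s}. g r)"
    by (rule integral_restrict_space[symmetric]) auto
  finally show ?thesis .
qed

lemma AE_lebesgue_on_neq: "AE x in lebesgue_on S. x \<noteq> (r :: real)" if "S \<in> sets lebesgue"
proof -
  have "AE x in lebesgue. x \<noteq> r"
    by (intro AE_completion) (rule AE_lborel_singleton)
  then show ?thesis using that by (subst AE_restrict_space_iff) (auto elim: eventually_mono)
qed

abbreviation Leb :: "real \<Rightarrow> real measure" where "Leb t \<equiv> lebesgue_on {0..t}"

text \<open>Fubini on the square \<open>[0, t]\<^sup>2\<close>, split along the diagonal.\<close>

lemma integral_mult_indefinite:
  fixes f g :: "real \<Rightarrow> 'a::{real_normed_field, banach, second_countable_topology}"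
  assumes f: "integrable (Leb t) f" and g: "integrable (Leb t) g"
  shows "integrable (Leb t) (\<lambda>s. f s * (LINT r|Leb s. g r))"
    "(LINT s|Leb t. f s) * (LINT s|Leb t. g s)
      = (LINT s|Leb t. f s * (LINT r|Leb s. g r)
           + (LINT r|Leb s. f r) * g s)"
proof -
  define M where "M = Leb t"
  interpret M: finite_measure M unfolding M_def by (rule finite_measure_lebesgue_on_Icc)
  interpret P: pair_sigma_finite M M ..
  have spM: "space M = {0..t}" by (simp add: M_def)
  have [measurable]: "f \<in> borel_measurable M" "g \<in> borel_measurable M"
    using f g by (auto simp: M_def)
  have [measurable]: "(\<lambda>x. x) \<in> M \<rightarrow>\<^sub>M borel"
    unfolding M_def by (rule borel_imp_lebesgue_on) simp
  have ifg: "integrable (M \<Otimes>\<^sub>M M) (\<lambda>(s, r). f s * g r)"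
    if [measurable]: "integrable M f" "integrable M g" for f g :: "real \<Rightarrow> 'a"
  proof (rule P.Fubini_integrable)
    show "(\<lambda>(s, r). f s * g r) \<in> borel_measurable (M \<Otimes>\<^sub>M M)" by measurable
    show "integrable M (\<lambda>x. LINT y|M. norm (case (x, y) of (s, r) \<Rightarrow> f s * g r))"
      using that by (simp add: norm_mult)
    show "AE x in M. integrable M (\<lambda>y. case (x, y) of (s, r) \<Rightarrow> f s * g r)"
      using that by simp
  qed
  have iLE: "integrable (M \<Otimes>\<^sub>M M) (\<lambda>(s, r). if r \<le> s then f s * g r else 0)"
    if "integrable M f" "integrable M g" for f g :: "real \<Rightarrow> 'a"
  proof (rule Bochner_Integration.integrable_bound[OF ifg[OF that]])
    have [measurable]: "f \<in> borel_measurable M" "g \<in> borel_measurable M" using that by auto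
    show "(\<lambda>(s, r). if r \<le> s then f s * g r else 0) \<in> borel_measurable (M \<Otimes>\<^sub>M M)"
      unfolding case_prod_beta by measurable
  qed auto
  have iGT: "integrable (M \<Otimes>\<^sub>M M) (\<lambda>(s, r). if s < r then f s * g r else 0)"
  proof (rule Bochner_Integration.integrable_bound[OF ifg[of f g]])
    show "(\<lambda>(s, r). if s < r then f s * g r else 0) \<in> borel_measurable (M \<Otimes>\<^sub>M M)"
      unfolding case_prod_beta by measurable
  qed (use f g in \<open>auto simp: M_def\<close>)
  have fM: "integrable M f" "integrable M g" using f g by (auto simp: M_def)
  have inner: "(LINT r|M. (if r \<le> s then f s * g r else 0)) = f s * (LINT r|Leb s. g r)"
    if "s \<in> {0..t}" for f g :: "real \<Rightarrow> 'a" and s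
  proof -
    have "(LINT r|M. (if r \<le> s then f s * g r else 0)) = (LINT r|M. f s * (if r \<le> s then g r else 0))"
      by (intro Bochner_Integration.integral_cong) auto
    also have "\<dots> = f s * (LINT r|M. (if r \<le> s then g r else 0))" by simp
    finally show ?thesis using LINT_lebesgue_on_if[of s t 0 g] that by (simp add: M_def)
  qed
  have intLE: "integrable M (\<lambda>s. f s * (LINT r|Leb s. g r))"
    if "integrable M f" "integrable M g" for f g :: "real \<Rightarrow> 'a"
  proof -
    have "integrable M (\<lambda>s. LINT r|M. (if r \<le> s then f s * g r else 0))"
      using P.integrable_fst'[OF iLE[OF that]] by simp
    then show ?thesis
      using Bochner_Integration.integrable_cong[of M M "\<lambda>s. LINT r|M. (if r \<le> s then f s * g r else 0)"
          "\<lambda>s. f s * (LINT r|Leb s. g r)"] inner spM by auto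
  qed
  then show "integrable (Leb t) (\<lambda>s. f s * (LINT r|Leb s. g r))"
    using fM by (simp add: M_def)
  have A: "(LINT z|(M \<Otimes>\<^sub>M M). (case z of (s, r) \<Rightarrow> if r \<le> s then f s * g r else 0))
      = (LINT s|M. f s * (LINT r|Leb s. g r))"
    by (subst P.integral_fst'[OF iLE[OF fM], symmetric], intro Bochner_Integration.integral_cong)
      (auto simp: spM inner)
  have B: "(LINT z|(M \<Otimes>\<^sub>M M). (case z of (s, r) \<Rightarrow> if s < r then f s * g r else 0))
      = (LINT r|M. (LINT s|Leb r. f s) * g r)"
  proof -
    have "(LINT z|(M \<Otimes>\<^sub>M M). (case z of (s, r) \<Rightarrow> if s < r then f s * g r else 0))
      = (LINT r|M. LINT s|M. (if s < r then f s * g r else 0))"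
      by (rule P.integral_snd[OF iGT, symmetric])
    also have "\<dots> = (LINT r|M. g r * (LINT s|Leb r. f s))"
    proof (intro Bochner_Integration.integral_cong refl)
      fix r assume "r \<in> space M"
      then have r: "r \<in> {0..t}" by (simp add: spM)
      have [measurable]: "(\<lambda>x. x) \<in> M \<rightarrow>\<^sub>M borel" by fact
      \<comment> \<open>The strict and the weak inequality differ only at \<open>s = r\<close>, a
        null set, so the earlier evaluation of the inner integral applies with \<open>f\<close> and
        \<open>g\<close> exchanged.\<close>
      have "(LINT s|M. (if s < r then f s * g r else 0)) = (LINT s|M. (if s \<le> r then g r * f s else 0))"
      proof (rule integral_cong_AE)
        have "AE s in M. s \<noteq> r" unfolding M_def by (rule AE_lebesgue_on_neq) simp
        then show "AE s in M. (if s < r then f s * g r else 0) = (if s \<le> r then g r * f s else 0)"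
          by eventually_elim auto
      qed measurable
      then show "(LINT s|M. (if s < r then f s * g r else 0)) = g r * (LINT s|Leb r. f s)"
        using inner[OF r] by simp
    qed
    finally show ?thesis by (simp add: mult.commute)
  qed
  have "(LINT s|M. f s) * (LINT s|M. g s) = (LINT s|M. LINT r|M. f s * g r)"
    by simp
  also have "\<dots> = (LINT z|(M \<Otimes>\<^sub>M M). (case z of (s, r) \<Rightarrow> f s * g r))"
    by (rule P.integral_fst[OF ifg[OF fM]])
  also have "\<dots> = (LINT z|(M \<Otimes>\<^sub>M M). (case z of (s, r) \<Rightarrow> if r \<le> s then f s * g r else 0)
       + (case z of (s, r) \<Rightarrow> if s < r then f s * g r else 0))"
    by (intro Bochner_Integration.integral_cong) auto
  also have "\<dots> = (LINT s|M. f s * (LINT r|Leb s. g r))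
      + (LINT r|M. (LINT s|Leb r. f s) * g r)"
    using A B iLE[OF fM] iGT by (subst Bochner_Integration.integral_add) auto
  also have "\<dots> = (LINT s|M. f s * (LINT r|Leb s. g r)
           + (LINT r|Leb s. f r) * g s)"
    using intLE[OF fM] intLE[OF fM(2,1)] by (subst Bochner_Integration.integral_add) (auto simp: mult.commute)
  finally show "(LINT s|Leb t. f s) * (LINT s|Leb t. g s)
      = (LINT s|Leb t. f s * (LINT r|Leb s. g r)
           + (LINT r|Leb s. f r) * g s)"
    by (simp add: M_def)
qed

text \<open>This is what integrating the derivative of \<open>K ^ Suc j\<close> would give. As
  \<open>K\<close> is only an indefinite integral, induction on \<open>j\<close> applies the
  integral product rule to \<open>K\<close> and \<open>K ^ Suc j / Suc j\<close> instead.\<close>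

lemma power_indefinite_integral:
  fixes \<kappa> :: "real \<Rightarrow> real"
  defines "K \<equiv> \<lambda>t. LINT s|Leb t. \<kappa> s"
  assumes "integrable (Leb T) \<kappa>" "t \<le> T"
  shows "integrable (Leb t) (\<lambda>s. \<kappa> s * K s ^ j)
     \<and> K t ^ Suc j = real (Suc j) * (LINT s|Leb t. \<kappa> s * K s ^ j)"
  using assms(3)
proof (induction j arbitrary: t)
  case 0
  then show ?case using integrable_lebesgue_on_mono[OF assms(2)] by (simp add: K_def)
next
  case (Suc j)
  have k: "integrable (Leb t) \<kappa>"
    using integrable_lebesgue_on_mono[OF assms(2) Suc.prems] .
  have IH: "integrable (Leb t) (\<lambda>s. \<kappa> s * K s ^ j)"
    "K t ^ Suc j = real (Suc j) * (LINT s|Leb t. \<kappa> s * K s ^ j)"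
    using Suc.IH[OF Suc.prems] by auto
  have IHs: "(LINT r|Leb s. \<kappa> r * K r ^ j) = K s ^ Suc j / real (Suc j)" if "s \<in> {0..t}" for s
    using Suc.IH[of s] that Suc.prems by (simp add: field_simps del: power_Suc of_nat_Suc)
  have i: "integrable (Leb t) (\<lambda>s. \<kappa> s * K s ^ Suc j)"
  proof -
    have "integrable (Leb t) (\<lambda>s. \<kappa> s * (K s ^ Suc j / real (Suc j)))"
      using integral_mult_indefinite(1)[OF k IH(1)] IHs
      by (subst Bochner_Integration.integrable_cong[OF refl, where g = "\<lambda>s. \<kappa> s * (LINT r|Leb s. \<kappa> r * K r ^ j)"]) auto
    from integrable_mult_right[OF this, of "real (Suc j)"] show ?thesis
      by (simp add: field_simps del: power_Suc of_nat_Suc)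
  qed
  have "K t ^ Suc (Suc j) = real (Suc j) * (K t * (LINT s|Leb t. \<kappa> s * K s ^ j))"
    using IH(2) by (simp only: power_Suc[of "K t" "Suc j"] mult.left_commute)
  also have "K t * (LINT s|Leb t. \<kappa> s * K s ^ j)
     = (LINT s|Leb t. \<kappa> s * (LINT r|Leb s. \<kappa> r * K r ^ j) + K s * (\<kappa> s * K s ^ j))"
    unfolding K_def by (rule integral_mult_indefinite(2)[OF k IH(1)[unfolded K_def]])
  also have "\<dots> = (LINT s|Leb t. (real (Suc (Suc j)) / real (Suc j)) * (\<kappa> s * K s ^ Suc j))"
    using IHs by (intro Bochner_Integration.integral_cong) (auto simp: field_simps)
  also have "real (Suc j) * \<dots> = real (Suc (Suc j)) * (LINT s|Leb t. \<kappa> s * K s ^ Suc j)"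
    by (simp del: of_nat_Suc power_Suc)
  finally show ?case using i by blast
qed

text \<open>Since \<open>\<kappa>\<close> is merely integrable, the exponential is reached through its power series, by iterating
  the inequality.\<close>

lemma gronwall:
  fixes \<kappa> \<phi> :: "real \<Rightarrow> real"
  assumes \<kappa>: "integrable (Leb T) \<kappa>" "\<And>t. t \<in> {0..T} \<Longrightarrow> 0 \<le> \<kappa> t"
    and \<phi>: "\<phi> \<in> borel_measurable (Leb T)" "\<And>t. t \<in> {0..T} \<Longrightarrow> \<bar>\<phi> t\<bar> \<le> B"
    and le: "\<And>t. t \<in> {0..T} \<Longrightarrow> \<phi> t \<le> A + (LINT s|Leb t. \<kappa> s * \<phi> s)"
    and t: "t \<in> {0..T}"
  shows "\<phi> t \<le> A * exp (LINT s|Leb t. \<kappa> s)"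
proof -
  define K where "K = (\<lambda>t. LINT s|Leb t. \<kappa> s)"
  have ik\<phi>: "integrable (Leb t) (\<lambda>s. \<kappa> s * \<phi> s)" if "t \<in> {0..T}" for t
  proof -
    have "integrable (Leb T) (\<lambda>s. \<kappa> s * \<phi> s)"
    proof (rule Bochner_Integration.integrable_bound)
      show "integrable (Leb T) (\<lambda>s. B * \<kappa> s)" using \<kappa>(1) by simp
      show "AE s in Leb T. norm (\<kappa> s * \<phi> s) \<le> norm (B * \<kappa> s)"
      proof (rule AE_I2)
        fix s assume "s \<in> space (Leb T)"
        then have "s \<in> {0..T}" by simp
        from \<phi>(2)[OF this] \<kappa>(2)[OF this] show "norm (\<kappa> s * \<phi> s) \<le> norm (B * \<kappa> s)"
          using mult_right_mono[of "\<bar>\<phi> s\<bar>" B "\<kappa> s"] by (simp add: abs_mult mult.commute)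
      qed
    qed (use \<kappa> \<phi> in measurable)
    then show ?thesis using that integrable_lebesgue_on_mono by force
  qed
  have pw: "integrable (Leb t) (\<lambda>s. \<kappa> s * K s ^ j)"
     "(LINT s|Leb t. \<kappa> s * K s ^ j) = K t ^ Suc j / real (Suc j)" if "t \<in> {0..T}" for t j
    using power_indefinite_integral[OF \<kappa>(1), of t j] that
    by (auto simp: K_def field_simps simp del: power_Suc of_nat_Suc)
  \<comment> \<open>After \<open>j\<close> iterations the right-hand side is a Taylor polynomial of
    \<open>exp\<close> plus a remainder. The crude bound \<open>B\<close> survives only in the
    remainder and disappears as \<open>j\<close> grows.\<close>
  have main: "\<phi> t \<le> A * (\<Sum>i<j. K t ^ i / fact i) + B * K t ^ j / fact j" if "t \<in> {0..T}" for j t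
    using that
  proof (induction j arbitrary: t)
    case 0
    then show ?case using \<phi>(2)[of t] by auto
  next
    case (Suc j)
    let ?r = "\<lambda>s. A * (\<Sum>i<j. K s ^ i / fact i) + B * K s ^ j / fact j"
    have req: "\<kappa> s * ?r s = A * (\<Sum>i<j. (\<kappa> s * K s ^ i) / fact i) + B / fact j * (\<kappa> s * K s ^ j)" for s
      by (simp add: sum_distrib_left sum_distrib_right algebra_simps)
    have ir: "integrable (Leb t) (\<lambda>s. \<kappa> s * ?r s)"
      unfolding req using pw[OF Suc.prems] by (intro Bochner_Integration.integrable_add integrable_mult_right Bochner_Integration.integrable_sum) auto
    have "\<phi> t \<le> A + (LINT s|Leb t. \<kappa> s * \<phi> s)" by (rule le[OF Suc.prems])
    also have "(LINT s|Leb t. \<kappa> s * \<phi> s) \<le> (LINT s|Leb t. \<kappa> s * ?r s)"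
      using Suc.IH Suc.prems \<kappa>(2) by (intro integral_mono ik\<phi> ir mult_left_mono) auto
    also have "(LINT s|Leb t. \<kappa> s * ?r s)
        = A * (\<Sum>i<j. (LINT s|Leb t. \<kappa> s * K s ^ i) / fact i)
          + B / fact j * (LINT s|Leb t. \<kappa> s * K s ^ j)"
      unfolding req using pw(1)[OF Suc.prems]
      by (subst Bochner_Integration.integral_add) (auto intro!: Bochner_Integration.integrable_sum simp: Bochner_Integration.integral_sum)
    also have "\<dots> = A * (\<Sum>i<j. K t ^ Suc i / fact (Suc i)) + B * K t ^ Suc j / fact (Suc j)"
      by (simp add: pw(2)[OF Suc.prems] field_simps del: power_Suc of_nat_Suc)
    also have "A + \<dots> = A * (\<Sum>i<Suc j. K t ^ i / fact i) + B * K t ^ Suc j / fact (Suc j)"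
      by (subst sum.lessThan_Suc_shift) (simp add: algebra_simps)
    finally show ?case by simp
  qed
  have lim: "(\<lambda>j. A * (\<Sum>i<j. K t ^ i / fact i) + B * K t ^ j / fact j) \<longlonglongrightarrow> A * exp (K t) + 0"
  proof (intro tendsto_intros)
    have s: "(\<lambda>i. K t ^ i / fact i) sums exp (K t)"
      using exp_converges[of "K t"] by (simp add: field_simps scaleR_conv_of_real)
    then show "(\<lambda>j. \<Sum>i<j. K t ^ i / fact i) \<longlonglongrightarrow> exp (K t)" by (simp add: sums_def)
    have "(\<lambda>j. B * (K t ^ j / fact j)) \<longlonglongrightarrow> B * 0"
      by (intro tendsto_intros summable_LIMSEQ_zero sums_summable[OF s])
    then show "(\<lambda>j. B * K t ^ j / fact j) \<longlonglongrightarrow> 0" by simp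
  qed
  show ?thesis
    using LIMSEQ_le_const[OF lim] main[OF t] by (auto simp: K_def)
qed

text \<open>\<open>f\<close> is the pointwise limit of step functions on a grid of mesh
  \<open>1 / Suc n\<close>, each sampled at the right end of its cell. The \<open>+ 1\<close> puts
  the sample strictly to the right of \<open>t\<close>, where the one-sided limit applies.\<close>

lemma borel_measurable_right_continuous:
  fixes f :: "real \<Rightarrow> 'a::real_normed_vector"
  assumes "\<And>t. (f \<longlongrightarrow> f t) (at_right t)"
  shows "f \<in> borel_measurable borel"
proof (rule borel_measurable_LIMSEQ_metric)
  fix n :: nat
  show "(\<lambda>t. f ((of_int \<lfloor>real (Suc n) * t\<rfloor> + 1) / real (Suc n))) \<in> borel_measurable borel"
    by measurable
next
  fix t :: real
  define x where "x = (\<lambda>n. (of_int \<lfloor>real (Suc n) * t\<rfloor> + 1) / real (Suc n))"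
  have gt: "t < x n" for n
    using floor_correct[of "real (Suc n) * t"] by (simp add: x_def field_simps del: of_nat_Suc)
  have le: "x n \<le> t + 1 / real (Suc n)" for n
    using floor_correct[of "real (Suc n) * t"] by (simp add: x_def field_simps del: of_nat_Suc)
  have "(\<lambda>n. t + 1 / real (Suc n)) \<longlonglongrightarrow> t + 0"
    by (intro tendsto_add tendsto_const LIMSEQ_inverse_real_of_nat[unfolded inverse_eq_divide])
  then have "(\<lambda>n. t + 1 / real (Suc n)) \<longlonglongrightarrow> t" by simp
  then have "x \<longlonglongrightarrow> t"
    by (rule real_tendsto_sandwich[where f = "\<lambda>n. t", rotated 3])
      (use gt le in \<open>simp_all add: less_imp_le del: of_nat_Suc\<close>)
  moreover have "\<forall>\<^sub>F n in sequentially. x n \<in> {t<..} \<and> x n \<noteq> t"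
    using gt by (intro always_eventually allI) (simp add: less_imp_neq[symmetric] less_imp_neq[THEN not_sym])
  ultimately have "filterlim x (at_right t) sequentially"
    unfolding filterlim_at by blast
  then have "(\<lambda>n. f (x n)) \<longlonglongrightarrow> f t"
    by (rule filterlim_compose[OF assms])
  then show "(\<lambda>n. f ((of_int \<lfloor>real (Suc n) * t\<rfloor> + 1) / real (Suc n))) \<longlonglongrightarrow> f t"
    by (simp add: x_def)
qed

text \<open>The product rule applied to \<open>f\<close> and its conjugate, since the squared
  modulus is \<open>W\<close> times \<open>cnj W\<close>. It is the energy identity for a path known
  only as an indefinite integral.\<close>

lemma norm_sq_indefinite_integral:
  fixes f W :: "real \<Rightarrow> complex"
  assumes f: "integrable (Leb T) f"
    and W: "\<And>t. t \<in> {0..T} \<Longrightarrow> W t = (LINT s|Leb t. f s)"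
    and t: "t \<in> {0..T}"
  shows "integrable (Leb t) (\<lambda>s. 2 * Re (cnj (W s) * f s))"
    "(cmod (W t))\<^sup>2 = (LINT s|Leb t. 2 * Re (cnj (W s) * f s))"
proof -
  have ft: "integrable (Leb t) f" "integrable (Leb t) (\<lambda>s. cnj (f s))"
    using integrable_lebesgue_on_mono[OF f] t by auto
  have c: "(LINT r|Leb s. cnj (f r)) = cnj (W s)" if "s \<in> {0..t}" for s
    using W[of s] t that by simp
  have i1: "integrable (Leb t) (\<lambda>s. f s * cnj (W s))"
    using integral_mult_indefinite(1)[OF ft] c
    by (subst Bochner_Integration.integrable_cong[OF refl, where g = "\<lambda>s. f s * (LINT r|Leb s. cnj (f r))"]) auto
  show i2: "integrable (Leb t) (\<lambda>s. 2 * Re (cnj (W s) * f s))"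
    using integrable_mult_right[OF integrable_Re[OF i1], of 2] by (simp add: mult.commute)
  have "complex_of_real ((cmod (W t))\<^sup>2) = W t * cnj (W t)"
    by (rule complex_norm_square)
  also have "\<dots> = (LINT s|Leb t. f s) * (LINT s|Leb t. cnj (f s))"
    using W[OF t] by simp
  also have "\<dots> = (LINT s|Leb t. f s * (LINT r|Leb s. cnj (f r))
           + (LINT r|Leb s. f r) * cnj (f s))"
    by (rule integral_mult_indefinite(2)[OF ft])
  also have "\<dots> = (LINT s|Leb t. complex_of_real (2 * Re (cnj (W s) * f s)))"
  proof (intro Bochner_Integration.integral_cong refl)
    fix s assume "s \<in> space (Leb t)"
    then have s: "s \<in> {0..t}" by simp
    have "f s * cnj (W s) + W s * cnj (f s) = complex_of_real (2 * Re (cnj (W s) * f s))"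
      by (simp add: complex_eq_iff algebra_simps)
    then show "f s * (LINT r|Leb s. cnj (f r)) + (LINT r|Leb s. f r) * cnj (f s)
        = complex_of_real (2 * Re (cnj (W s) * f s))"
      using c[OF s] W[of s] s t by simp
  qed
  also have "\<dots> = complex_of_real (LINT s|Leb t. 2 * Re (cnj (W s) * f s))"
    by (rule integral_complex_of_real)
  finally show "(cmod (W t))\<^sup>2 = (LINT s|Leb t. 2 * Re (cnj (W s) * f s))"
    using of_real_eq_iff by blast
qed

text \<open>Passes from variation of constants to the integrated form of
  \<open>W' = - c * W + g\<close>. Existence starts from the explicit formula, whereas the notion of
  solution is the integrated equation.\<close>

lemma duhamel_mode:
  fixes g W :: "real \<Rightarrow> complex" and c :: real
  assumes g: "integrable (Leb T) g"
    and W: "\<And>t. t \<in> {0..T} \<Longrightarrow> W t = exp (- c * t) * (LINT s|Leb t. exp (c * s) * g s)"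
    and t: "t \<in> {0..T}"
  shows "integrable (Leb t) (\<lambda>s. - c * W s + g s)"
    "W t = (LINT s|Leb t. - c * W s + g s)"
proof -
  define G where "G = (\<lambda>t. LINT s|Leb t. exp (c * s) * g s)"
  have gt: "integrable (Leb t) g"
    using integrable_lebesgue_on_mono[OF g] t by auto
  have [measurable]: "(\<lambda>s. s) \<in> borel_measurable (Leb t)" by (rule borel_imp_lebesgue_on) simp
  have gm [measurable]: "g \<in> borel_measurable (Leb t)" using gt by auto
  have ieg: "integrable (Leb t) (\<lambda>s. exp (c * s) * g s)"
  proof (rule Bochner_Integration.integrable_bound)
    show "integrable (Leb t) (\<lambda>s. exp (\<bar>c\<bar> * t) *\<^sub>R g s)" using gt by simp
    show "AE s in Leb t. norm (complex_of_real (exp (c * s)) * g s) \<le> norm (exp (\<bar>c\<bar> * t) *\<^sub>R g s)"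
    proof (rule AE_I2)
      fix s assume "s \<in> space (Leb t)"
      then have "c * s \<le> \<bar>c\<bar> * t" by (auto intro: mult_mono)
      then show "norm (complex_of_real (exp (c * s)) * g s) \<le> norm (exp (\<bar>c\<bar> * t) *\<^sub>R g s)"
        by (auto simp: norm_mult intro!: mult_right_mono)
    qed
  qed measurable
  have ie: "integrable (Leb t) (\<lambda>s. complex_of_real (- c * exp (- c * s)))"
    by (intro integrable_of_real continuous_imp_integrable_real continuous_intros)
  have e: "(LINT r|Leb s. complex_of_real (- c * exp (- c * r))) = exp (- c * s) - 1" if "0 \<le> s" for s
  proof -
    define h where "h = (\<lambda>r. - c * exp (- c * r))"
    have "(h has_integral (exp (- c * s) - exp (- c * 0))) {0..s}"
      unfolding h_def by (rule fundamental_theorem_of_calculus[OF that])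
        (auto intro!: derivative_eq_intros simp flip: has_real_derivative_iff_has_vector_derivative)
    moreover have "integrable (Leb s) h"
      unfolding h_def by (intro continuous_imp_integrable_real continuous_intros)
    ultimately have "(LINT r|Leb s. h r) = exp (- c * s) - 1"
      using lebesgue_integral_eq_integral[of "{0..s}" h] by (simp add: integral_unique)
    then have "(LINT r|Leb s. complex_of_real (h r)) = exp (- c * s) - 1"
      by simp
    then show ?thesis by (simp add: h_def)
  qed
  have Gt: "W s = exp (- c * s) * G s" if "s \<in> {0..t}" for s
    using W[of s] that t by (simp add: G_def)
  have i1: "integrable (Leb t) (\<lambda>s. complex_of_real (- c * exp (- c * s)) * G s)"
    using integral_mult_indefinite(1)[OF ie ieg] by (simp add: G_def)
  have i2: "integrable (Leb t) (\<lambda>s. - c * W s)"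
    using i1 Gt by (subst Bochner_Integration.integrable_cong[OF refl,
        where g = "\<lambda>s. complex_of_real (- c * exp (- c * s)) * G s"]) auto
  then show i3: "integrable (Leb t) (\<lambda>s. - c * W s + g s)"
    using gt by (rule Bochner_Integration.integrable_add)
  \<comment> \<open>The product rule concerns indefinite integrals, which vanish at 0, hence
    \<open>exp (- c * t) - 1\<close> in place of the exponential. The extra \<open>G t\<close>
    reappears on the right and cancels.\<close>
  have "(exp (- c * t) - 1) * G t
      = (LINT r|Leb t. complex_of_real (- c * exp (- c * r))) * (LINT s|Leb t. exp (c * s) * g s)"
    using e[of t] t by (simp add: G_def)
  also have "\<dots> = (LINT s|Leb t. complex_of_real (- c * exp (- c * s)) * (LINT r|Leb s. exp (c * r) * g r)
           + (LINT r|Leb s. complex_of_real (- c * exp (- c * r))) * (exp (c * s) * g s))"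
    by (rule integral_mult_indefinite(2)[OF ie ieg])
  also have "\<dots> = (LINT s|Leb t. (- c * W s + g s) - exp (c * s) * g s)"
  proof (intro Bochner_Integration.integral_cong refl)
    fix s assume "s \<in> space (Leb t)"
    then have s: "s \<in> {0..t}" by simp
    have "complex_of_real (exp (- c * s)) * of_real (exp (c * s)) = 1"
      by (simp flip: of_real_mult exp_add)
    then have *: "complex_of_real (exp (- c * s)) * (of_real (exp (c * s)) * g s) = g s"
      by (metis mult.assoc mult_1)
    show "complex_of_real (- c * exp (- c * s)) * (LINT r|Leb s. exp (c * r) * g r)
           + (LINT r|Leb s. complex_of_real (- c * exp (- c * r))) * (exp (c * s) * g s)
         = (- c * W s + g s) - exp (c * s) * g s"
    proof -
      have "0 \<le> s" using s by simp
      show ?thesis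
        unfolding e[OF \<open>0 \<le> s\<close>] Gt[OF s] using * by (simp add: G_def algebra_simps)
    qed
  qed
  also have "\<dots> = (LINT s|Leb t. - c * W s + g s) - G t"
    using i3 ieg by (subst Bochner_Integration.integral_diff) (auto simp: G_def)
  finally have "complex_of_real (exp (- c * t)) * G t = (LINT s|Leb t. - c * W s + g s)"
    by (simp add: algebra_simps)
  then show "W t = (LINT s|Leb t. - c * W s + g s)"
    using Gt[of t] t by simp
qed

section \<open>Fourier series and the Riesz-Fischer theorem\<close>

abbreviation M01 :: "real measure" where "M01 \<equiv> lebesgue_on {0..1}"

definition ek :: "int \<Rightarrow> real \<Rightarrow> complex" where
  "ek k x = cis (2 * pi * of_int k * x)"

definition fc :: "(real \<Rightarrow> complex) \<Rightarrow> int \<Rightarrow> complex" where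
  "fc f k = (LINT x|M01. f x * ek (- k) x)"

abbreviation rc :: "(real \<Rightarrow> real) \<Rightarrow> int \<Rightarrow> complex" where
  "rc u \<equiv> fc (\<lambda>x. complex_of_real (u x))"

definition L2c :: "(real \<Rightarrow> complex) \<Rightarrow> bool" where
  "L2c f \<longleftrightarrow> f \<in> borel_measurable M01 \<and> integrable M01 (\<lambda>x. (cmod (f x))\<^sup>2)"

lemma ek_0 [simp]: "ek 0 x = 1" by (simp add: ek_def)

lemma ek_mult: "ek j x * ek k x = ek (j + k) x"
  by (simp add: ek_def cis_mult algebra_simps)

lemma cnj_ek: "cnj (ek k x) = ek (- k) x"
  by (simp add: ek_def cis_cnj)

lemma norm_ek [simp]: "cmod (ek k x) = 1"
  by (simp add: ek_def)

lemma ek_periodic: "ek k (x + 1) = ek k x"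
proof -
  have "ek k (x + 1) = ek k x * cis (2 * pi * of_int k)"
    by (simp add: ek_def cis_mult algebra_simps)
  also have "cis (2 * pi * of_int k) = 1" by (rule cis_multiple_2pi) simp
  finally show ?thesis by simp
qed

lemma ek_has_vector_derivative:
  "(ek k has_vector_derivative (2 * pi * of_int k * \<i>) * ek k x) (at x within S)"
proof -
  define c where "c = complex_of_real (2 * pi * of_int k) * \<i>"
  have e: "ek k = (\<lambda>x. exp (c * of_real x))"
    by (auto simp: ek_def cis_conv_exp c_def fun_eq_iff algebra_simps)
  have "((\<lambda>z. exp (c * z)) has_field_derivative c * exp (c * of_real x)) (at (of_real x))"
    by (auto intro!: derivative_eq_intros)
  from has_vector_derivative_real_field[OF this, of S] show ?thesis
    by (simp add: e c_def)
qed

lemma continuous_ek [continuous_intros]: "continuous_on S (ek k)"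
  unfolding continuous_on_eq_continuous_within
  by (blast intro: has_vector_derivative_continuous[OF ek_has_vector_derivative])

lemma borel_measurable_cnj [measurable (raw)]:
  "g \<in> borel_measurable M \<Longrightarrow> (\<lambda>x. cnj (g x)) \<in> borel_measurable M"
  by (rule measurable_compose[OF _ borel_measurable_continuous_onI]) (auto intro!: continuous_intros)

lemma continuous_imp_measurable_lebesgue_on:
  fixes f :: "real \<Rightarrow> 'a::euclidean_space"
  shows "continuous_on S f \<Longrightarrow> S \<in> sets lebesgue \<Longrightarrow> f \<in> borel_measurable (lebesgue_on S)"
  by (rule continuous_imp_measurable_on_sets_lebesgue)

lemma ek_measurable [measurable]: "ek k \<in> borel_measurable M01"
  by (intro continuous_imp_measurable_lebesgue_on continuous_intros) auto

lemma integrable_continuous_Icc: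
  fixes f :: "real \<Rightarrow> 'a::euclidean_space"
  assumes "continuous_on {a..b} f"
  shows "integrable (lebesgue_on {a..b}) f"
proof -
  obtain B where "\<And>x. x \<in> {a..b} \<Longrightarrow> norm (f x) \<le> B"
    using compact_continuous_image[OF assms] compact_imp_bounded by (force simp: bounded_iff)
  then show ?thesis
    using assms by (intro integrable_bounded_Icc continuous_imp_measurable_lebesgue_on) auto
qed

lemma LINT_vector_derivative:
  fixes f :: "real \<Rightarrow> 'a::euclidean_space"
  assumes "a \<le> b" "\<And>x. x \<in> {a..b} \<Longrightarrow> (f has_vector_derivative f' x) (at x within {a..b})"
    and "continuous_on {a..b} f'"
  shows "(LINT x|lebesgue_on {a..b}. f' x) = f b - f a"
proof -
  have "(f' has_integral (f b - f a)) {a..b}"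
    by (rule fundamental_theorem_of_calculus) (use assms in auto)
  then show ?thesis
    using lebesgue_integral_eq_integral[OF integrable_continuous_Icc[OF assms(3)]]
    by (simp add: integral_unique)
qed

lemma LINT_ek: "(LINT x|M01. ek k x) = (if k = 0 then 1 else 0)"
proof (cases "k = 0")
  case True
  then show ?thesis by (simp add: measure_restrict_space)
next
  case False
  have "(LINT x|M01. (2 * pi * of_int k * \<i>) * ek k x) = ek k 1 - ek k 0"
    by (intro LINT_vector_derivative ek_has_vector_derivative continuous_intros) simp
  also have "\<dots> = 0" using ek_periodic[of k 0] by simp
  finally show ?thesis using False by simp
qed

lemma integrable_mult_ek: "integrable M01 f \<Longrightarrow> integrable M01 (\<lambda>x. f x * ek k x)"
proof (rule Bochner_Integration.integrable_bound)
  assume f: "integrable M01 f"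
  then have [measurable]: "f \<in> borel_measurable M01" by simp
  show "(\<lambda>x. f x * ek k x) \<in> borel_measurable M01" by measurable
qed (auto simp: norm_mult)

lemma L2c_integrable: assumes "L2c f" shows "integrable M01 f"
proof (rule Bochner_Integration.integrable_bound)
  show "integrable M01 (\<lambda>x. 1 + (cmod (f x))\<^sup>2)" using assms by (simp add: L2c_def)
  show "AE x in M01. cmod (f x) \<le> norm (1 + (cmod (f x))\<^sup>2)"
  proof (rule AE_I2)
    fix x
    have "2 * cmod (f x) \<le> 1 + (cmod (f x))\<^sup>2"
      using sum_squares_bound[of 1 "cmod (f x)"] by simp
    moreover have "0 \<le> cmod (f x)" by simp
    ultimately have "cmod (f x) \<le> 1 + (cmod (f x))\<^sup>2" by linarith
    then show "cmod (f x) \<le> norm (1 + (cmod (f x))\<^sup>2)" by simp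
  qed
qed (use assms in \<open>auto simp: L2c_def\<close>)

lemma L2c_add: assumes "L2c f" "L2c g" shows "L2c (\<lambda>x. f x + g x)"
  unfolding L2c_def
proof
  have [measurable]: "f \<in> borel_measurable M01" "g \<in> borel_measurable M01"
    using assms by (auto simp: L2c_def)
  show "(\<lambda>x. f x + g x) \<in> borel_measurable M01" by measurable
  show "integrable M01 (\<lambda>x. (cmod (f x + g x))\<^sup>2)"
  proof (rule Bochner_Integration.integrable_bound)
    show "integrable M01 (\<lambda>x. 2 * (cmod (f x))\<^sup>2 + 2 * (cmod (g x))\<^sup>2)"
      using assms by (simp add: L2c_def)
  qed (auto simp: cmod_add_sq_le)
qed

lemma L2c_bounded:
  assumes "f \<in> borel_measurable M01" "\<And>x. x \<in> {0..1} \<Longrightarrow> cmod (f x) \<le> B"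
  shows "L2c f"
proof -
  have [measurable]: "f \<in> borel_measurable M01" by fact
  have "integrable M01 (\<lambda>x. (cmod (f x))\<^sup>2)"
    by (rule integrable_bounded_Icc[where B = "B\<^sup>2"]) (auto intro!: power_mono assms)
  then show ?thesis using assms by (simp add: L2c_def)
qed

lemma L2c_mult_bounded:
  assumes "L2c f" "g \<in> borel_measurable M01" "\<And>x. x \<in> {0..1} \<Longrightarrow> cmod (g x) \<le> B"
  shows "L2c (\<lambda>x. f x * g x)"
proof -
  have [measurable]: "f \<in> borel_measurable M01" "g \<in> borel_measurable M01"
    using assms by (auto simp: L2c_def)
  have "integrable M01 (\<lambda>x. (cmod (f x * g x))\<^sup>2)"
  proof (rule Bochner_Integration.integrable_bound)
    show "integrable M01 (\<lambda>x. B\<^sup>2 * (cmod (f x))\<^sup>2)" using assms by (simp add: L2c_def)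
    show "AE x in M01. norm ((cmod (f x * g x))\<^sup>2) \<le> norm (B\<^sup>2 * (cmod (f x))\<^sup>2)"
    proof (rule AE_I2)
      fix x assume "x \<in> space M01"
      then have "(cmod (g x))\<^sup>2 \<le> B\<^sup>2" using assms(3)[of x] by (intro power_mono) auto
      then show "norm ((cmod (f x * g x))\<^sup>2) \<le> norm (B\<^sup>2 * (cmod (f x))\<^sup>2)"
        using mult_right_mono[of "(cmod (g x))\<^sup>2" "B\<^sup>2" "(cmod (f x))\<^sup>2"]
        by (simp add: norm_mult power_mult_distrib mult.commute)
    qed
  qed measurable
  then show ?thesis by (simp add: L2c_def)
qed

lemma L2c_cmult: "L2c f \<Longrightarrow> L2c (\<lambda>x. c * f x)"
  using L2c_mult_bounded[of f "\<lambda>x. c" "cmod c"] by (simp add: mult.commute)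

lemma L2c_mult_integrable:
  assumes "L2c f" "L2c g" shows "integrable M01 (\<lambda>x. f x * cnj (g x))"
proof (rule Bochner_Integration.integrable_bound)
  have [measurable]: "f \<in> borel_measurable M01" "g \<in> borel_measurable M01"
    using assms by (auto simp: L2c_def)
  show "(\<lambda>x. f x * cnj (g x)) \<in> borel_measurable M01" by measurable
  show "integrable M01 (\<lambda>x. (cmod (f x))\<^sup>2 + (cmod (g x))\<^sup>2)" using assms by (simp add: L2c_def)
  show "AE x in M01. norm (f x * cnj (g x)) \<le> norm ((cmod (f x))\<^sup>2 + (cmod (g x))\<^sup>2)"
  proof (rule AE_I2)
    fix x
    have "0 \<le> cmod (f x) * cmod (g x)" by simp
    then have "cmod (f x) * cmod (g x) \<le> (cmod (f x))\<^sup>2 + (cmod (g x))\<^sup>2"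
      using sum_squares_bound[of "cmod (f x)" "cmod (g x)"] by linarith
    then show "norm (f x * cnj (g x)) \<le> norm ((cmod (f x))\<^sup>2 + (cmod (g x))\<^sup>2)"
      by (simp add: norm_mult)
  qed
qed

section \<open>Trigonometric polynomials and Bessel's inequality\<close>

definition tp :: "(int \<Rightarrow> complex) \<Rightarrow> int set \<Rightarrow> real \<Rightarrow> complex" where
  "tp c K x = (\<Sum>k\<in>K. c k * ek k x)"

lemma tp_measurable [measurable]: "tp c K \<in> borel_measurable M01"
  unfolding tp_def by measurable

lemma norm_tp_le: "cmod (tp c K x) \<le> (\<Sum>k\<in>K. cmod (c k))"
  unfolding tp_def by (rule sum_norm_le) (simp add: norm_mult)

lemma L2c_tp: "L2c (tp c K)"
  by (rule L2c_bounded[OF tp_measurable norm_tp_le])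

lemma LINT_mult_cnj_tp:
  assumes "integrable M01 f" "finite K"
  shows "(LINT x|M01. f x * cnj (tp c K x)) = (\<Sum>k\<in>K. cnj (c k) * fc f k)"
proof -
  have "(LINT x|M01. f x * cnj (tp c K x)) = (LINT x|M01. (\<Sum>k\<in>K. cnj (c k) * (f x * ek (- k) x)))"
    by (simp add: tp_def sum_distrib_left cnj_ek algebra_simps)
  also have "\<dots> = (\<Sum>k\<in>K. cnj (c k) * fc f k)"
    using integrable_mult_ek[OF assms(1)] by (subst Bochner_Integration.integral_sum) (auto simp: fc_def)
  finally show ?thesis .
qed

lemma fc_tp:
  assumes "finite K" shows "fc (tp c K) k = (if k \<in> K then c k else 0)"
proof -
  have "fc (tp c K) k = (LINT x|M01. (\<Sum>j\<in>K. c j * ek (j - k) x))"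
    by (simp add: fc_def tp_def sum_distrib_right mult.assoc ek_mult)
  also have "\<dots> = (\<Sum>j\<in>K. c j * (LINT x|M01. ek (j - k) x))"
    using integrable_mult_ek[of "\<lambda>x. 1"] by (subst Bochner_Integration.integral_sum) auto
  also have "\<dots> = (\<Sum>j\<in>K. if j = k then c j else 0)"
    by (intro sum.cong) (auto simp: LINT_ek)
  finally show ?thesis using assms by simp
qed

text \<open>The square is expanded for arbitrary \<open>c\<close> because two specialisations are
  used: \<open>c = fc f\<close> leads to Bessel's inequality, \<open>f = 0\<close> gives the norm of
  a trigonometric polynomial.\<close>

lemma LINT_norm_diff_tp:
  assumes f: "L2c f" and K: "finite K"
  shows "integrable M01 (\<lambda>x. (cmod (f x - tp c K x))\<^sup>2)"
    "(LINT x|M01. (cmod (f x - tp c K x))\<^sup>2)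
      = (LINT x|M01. (cmod (f x))\<^sup>2) - 2 * Re (\<Sum>k\<in>K. cnj (c k) * fc f k) + (\<Sum>k\<in>K. (cmod (c k))\<^sup>2)"
proof -
  have eq: "(cmod (f x - tp c K x))\<^sup>2
      = (cmod (f x))\<^sup>2 - 2 * Re (f x * cnj (tp c K x)) + Re (tp c K x * cnj (tp c K x))" for x
    unfolding cmod_power2 by (simp add: power2_eq_square algebra_simps)
  have i1: "integrable M01 (\<lambda>x. f x * cnj (tp c K x))" by (rule L2c_mult_integrable[OF f L2c_tp])
  have i2: "integrable M01 (\<lambda>x. tp c K x * cnj (tp c K x))" by (rule L2c_mult_integrable[OF L2c_tp L2c_tp])
  have i0: "integrable M01 (\<lambda>x. (cmod (f x))\<^sup>2)" using f by (simp add: L2c_def)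
  show "integrable M01 (\<lambda>x. (cmod (f x - tp c K x))\<^sup>2)"
    unfolding eq by (intro Bochner_Integration.integrable_add Bochner_Integration.integrable_diff i0
        integrable_mult_right integrable_Re i1 i2)
  have "(LINT x|M01. (cmod (f x - tp c K x))\<^sup>2)
      = (LINT x|M01. (cmod (f x))\<^sup>2) - 2 * (LINT x|M01. Re (f x * cnj (tp c K x))) + (LINT x|M01. Re (tp c K x * cnj (tp c K x)))"
    unfolding eq using i0 integrable_Re[OF i1] integrable_Re[OF i2]
    by (simp only: Bochner_Integration.integral_add Bochner_Integration.integral_diff
        Bochner_Integration.integrable_diff integrable_mult_right integral_mult_right_zero)
  also have "(LINT x|M01. Re (f x * cnj (tp c K x))) = Re (\<Sum>k\<in>K. cnj (c k) * fc f k)"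
    by (simp only: integral_Re[OF i1] LINT_mult_cnj_tp[OF L2c_integrable[OF f] K])
  also have "(LINT x|M01. Re (tp c K x * cnj (tp c K x))) = Re (\<Sum>k\<in>K. cnj (c k) * fc (tp c K) k)"
    by (simp only: integral_Re[OF i2] LINT_mult_cnj_tp[OF L2c_integrable[OF L2c_tp] K])
  also have "\<dots> = (\<Sum>k\<in>K. (cmod (c k))\<^sup>2)"
    unfolding Re_sum
  proof (intro sum.cong refl)
    fix k assume "k \<in> K"
    then show "Re (cnj (c k) * fc (tp c K) k) = (cmod (c k))\<^sup>2"
      by (simp add: fc_tp K cmod_power2) (simp add: power2_eq_square)
  qed
  finally show "(LINT x|M01. (cmod (f x - tp c K x))\<^sup>2)
      = (LINT x|M01. (cmod (f x))\<^sup>2) - 2 * Re (\<Sum>k\<in>K. cnj (c k) * fc f k) + (\<Sum>k\<in>K. (cmod (c k))\<^sup>2)" .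
qed

lemma Re_cnj_mult_self: "Re (cnj z * z) = (cmod z)\<^sup>2"
  by (simp add: cmod_power2) (simp add: power2_eq_square)

lemma LINT_norm_diff_fourier:
  assumes f: "L2c f" and K: "finite K"
  shows "(LINT x|M01. (cmod (f x - tp (fc f) K x))\<^sup>2)
      = (LINT x|M01. (cmod (f x))\<^sup>2) - (\<Sum>k\<in>K. (cmod (fc f k))\<^sup>2)"
  by (simp only: LINT_norm_diff_tp[OF assms] Re_sum Re_cnj_mult_self)

lemma bessel:
  assumes f: "L2c f"
  shows "sqs (fc f)" "nsq (fc f) \<le> (LINT x|M01. (cmod (f x))\<^sup>2)"
proof -
  have "(\<Sum>k\<in>K. (cmod (fc f k))\<^sup>2) \<le> (LINT x|M01. (cmod (f x))\<^sup>2)" if "finite K" for K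
    using LINT_norm_diff_fourier[OF f that]
      Bochner_Integration.integral_nonneg[of M01 "\<lambda>x. (cmod (f x - tp (fc f) K x))\<^sup>2"] by simp
  then show "sqs (fc f)" "nsq (fc f) \<le> (LINT x|M01. (cmod (f x))\<^sup>2)"
    using sqsI by blast+
qed

text \<open>The variance of \<open>cmod (f x)\<close> is nonnegative, \<open>M01\<close> being a
  probability measure.\<close>

lemma LINT_norm_sq_le:
  assumes f: "L2c f" shows "(LINT x|M01. cmod (f x))\<^sup>2 \<le> (LINT x|M01. (cmod (f x))\<^sup>2)"
proof -
  define m where "m = (LINT x|M01. cmod (f x))"
  have i: "integrable M01 (\<lambda>x. cmod (f x))" "integrable M01 (\<lambda>x. (cmod (f x))\<^sup>2)"
    using L2c_integrable[OF f] f by (auto simp: L2c_def)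
  have eq: "(cmod (f x) - m)\<^sup>2 = (cmod (f x))\<^sup>2 - (2 * m) * cmod (f x) + m\<^sup>2" for x
    by (simp add: power2_diff algebra_simps)
  have "0 \<le> (LINT x|M01. (cmod (f x) - m)\<^sup>2)" by simp
  also have "\<dots> = (LINT x|M01. (cmod (f x))\<^sup>2) - (2 * m) * m + m\<^sup>2"
    unfolding eq using i by (simp add: m_def measure_restrict_space)
  finally show ?thesis by (simp add: m_def power2_eq_square)
qed

lemma tp_diff:
  assumes "K \<subseteq> L" "finite L" shows "tp c L x - tp c K x = tp c (L - K) x"
  using assms by (simp add: tp_def sum_diff)

lemma LINT_norm_tp: "finite K \<Longrightarrow> (LINT x|M01. (cmod (tp c K x))\<^sup>2) = (\<Sum>k\<in>K. (cmod (c k))\<^sup>2)"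
proof -
  assume K: "finite K"
  have "L2c (\<lambda>x. 0)" by (rule L2c_bounded[where B = 0]) auto
  from LINT_norm_diff_tp(2)[OF this K, of c] show ?thesis by (simp add: fc_def)
qed

lemma fc_add: "integrable M01 f \<Longrightarrow> integrable M01 g \<Longrightarrow> fc (\<lambda>x. f x + g x) k = fc f k + fc g k"
  using integrable_mult_ek[of f "- k"] integrable_mult_ek[of g "- k"]
  by (simp add: fc_def distrib_right)

lemma fc_diff: "integrable M01 f \<Longrightarrow> integrable M01 g \<Longrightarrow> fc (\<lambda>x. f x - g x) k = fc f k - fc g k"
  using integrable_mult_ek[of f "- k"] integrable_mult_ek[of g "- k"]
  by (simp add: fc_def left_diff_distrib)

lemma fc_cmult: "fc (\<lambda>x. c * f x) k = c * fc f k"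
  by (simp add: fc_def mult.assoc)

lemma fc_cnj: "fc (\<lambda>x. cnj (f x)) k = cnj (fc f (- k))"
proof -
  have "(\<lambda>x. cnj (f x) * ek (- k) x) = (\<lambda>x. cnj (f x * ek k x))" by (simp add: cnj_ek)
  then show ?thesis by (simp only: fc_def Bochner_Integration.integral_cnj minus_minus)
qed

lemma fc_ek: "fc (\<lambda>x. f x * ek j x) k = fc f (k - j)"
  by (simp add: fc_def mult.assoc ek_mult)

text \<open>The limit is taken along a subsequence of partial sums whose increments decay geometrically
  in \<open>L\<^sup>2\<close>; it is periodic at every point because the partial sums are.\<close>

lemma riesz_fischer:
  assumes c: "sqs c"
  obtains g where "L2c g" "\<And>x. g (x + 1) = g x" "\<And>k. fc g k = c k"
    "(LINT x|M01. (cmod (g x))\<^sup>2) = nsq c"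
proof -
  define P where "P = (\<lambda>N. \<Sum>k\<in>isym N. (cmod (c k))\<^sup>2)"
  have P: "P \<longlonglongrightarrow> nsq c" unfolding P_def by (rule nsq_isym_tendsto[OF c])
  have Ple: "P N \<le> nsq c" for N unfolding P_def by (rule sqs_sum_le[OF c]) simp
  have "\<forall>j. \<exists>N. \<forall>M\<ge>N. nsq c - P M \<le> (1/4)^j"
  proof
    fix j :: nat
    have "\<forall>\<^sub>F M in sequentially. nsq c - (1/4)^j < P M"
      by (rule order_tendstoD[OF P]) simp
    then show "\<exists>N. \<forall>M\<ge>N. nsq c - P M \<le> (1/4)^j"
      by (force simp: eventually_sequentially)
  qed
  then obtain q where q: "\<And>j M. q j \<le> M \<Longrightarrow> nsq c - P M \<le> (1/4)^j" by metis
  \<comment> \<open>The sum of the thresholds up to \<open>j\<close> makes \<open>r\<close>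
    monotone, the summand \<open>j\<close> makes it tend to infinity.\<close>
  define r where "r = (\<lambda>j. j + (\<Sum>i\<le>j. q i))"
  have r1: "nsq c - P (r j) \<le> (1/4)^j" for j
  proof (rule q)
    have "q j \<le> (\<Sum>i\<le>j. q i)" by (rule member_le_sum) auto
    then show "q j \<le> r j" by (simp add: r_def)
  qed
  have rmono: "r i \<le> r j" if "i \<le> j" for i j
    unfolding r_def using that by (intro add_mono sum_mono2) auto
  have rge: "j \<le> r j" for j by (simp add: r_def)
  define p where "p = (\<lambda>j. tp c (isym (r j)))"
  have pm [measurable]: "p j \<in> borel_measurable M01" for j unfolding p_def by measurable
  have dn: "(LINT x|M01. (cmod (p j x - p i x))\<^sup>2) \<le> (1/4)^i"
    "integrable M01 (\<lambda>x. (cmod (p j x - p i x))\<^sup>2)" if "i \<le> j" for i j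
  proof -
    let ?K = "isym (r j) - isym (r i)"
    have sub: "isym (r i) \<subseteq> isym (r j)" by (intro isym_mono rmono that)
    have d: "p j x - p i x = tp c ?K x" for x
      unfolding p_def by (rule tp_diff[OF sub]) simp
    have "(LINT x|M01. (cmod (p j x - p i x))\<^sup>2) = (\<Sum>k\<in>?K. (cmod (c k))\<^sup>2)"
      unfolding d by (rule LINT_norm_tp) simp
    also have "\<dots> = P (r j) - P (r i)"
      unfolding P_def using sub by (simp add: sum_diff)
    also have "\<dots> \<le> (1/4)^i" using r1[of i] Ple[of "r j"] by simp
    finally show "(LINT x|M01. (cmod (p j x - p i x))\<^sup>2) \<le> (1/4)^i" .
    show "integrable M01 (\<lambda>x. (cmod (p j x - p i x))\<^sup>2)"
      unfolding d using L2c_tp by (auto simp: L2c_def)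
  qed
  define d where "d = (\<lambda>j x. p (Suc j) x - p j x)"
  have dL: "L2c (d j)" for j
    using dn(2)[of j "Suc j"] unfolding d_def L2c_def by auto
  have d1: "(LINT x|M01. cmod (d j x)) \<le> (1/2)^j" for j
  proof -
    have "(LINT x|M01. cmod (d j x))\<^sup>2 \<le> (1/4)^j"
      using LINT_norm_sq_le[OF dL[of j]] dn(1)[of j "Suc j"] by (simp add: d_def)
    also have "(1/4::real)^j = ((1/2)^j)\<^sup>2" by (simp add: power2_eq_square flip: power_mult_distrib)
    finally show ?thesis by (rule power2_le_imp_le) simp
  qed
  have dm [measurable]: "d j \<in> borel_measurable M01" for j unfolding d_def by measurable
  \<comment> \<open>The L^1 norms of the increments are summable, so their pointwise sum is finite
    almost everywhere and the telescoping series converges absolutely there.\<close>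
  have "AE x in M01. (\<Sum>j. ennreal (cmod (d j x))) \<noteq> top"
  proof (rule nn_integral_PInf_AE[unfolded infinity_ennreal_def])
    show "(\<lambda>x. \<Sum>j. ennreal (cmod (d j x))) \<in> borel_measurable M01" by measurable
    have "(\<integral>\<^sup>+x. (\<Sum>j. ennreal (cmod (d j x))) \<partial>M01) = (\<Sum>j. \<integral>\<^sup>+x. ennreal (cmod (d j x)) \<partial>M01)"
      by (rule nn_integral_suminf) measurable
    also have "\<dots> = (\<Sum>j. ennreal (LINT x|M01. cmod (d j x)))"
      using L2c_integrable[OF dL] by (subst nn_integral_eq_integral) auto
    also have "\<dots> \<le> (\<Sum>j. ennreal ((1/2)^j))"
      by (intro suminf_le ennreal_leI d1) auto
    also have "\<dots> = ennreal (\<Sum>j. (1/2)^j)"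
      by (rule suminf_ennreal2) (auto intro: summable_geometric)
    also have "\<dots> < top" by simp
    finally show "(\<integral>\<^sup>+x. (\<Sum>j. ennreal (cmod (d j x))) \<partial>M01) \<noteq> top" by simp
  qed
  then have conv: "AE x in M01. convergent (\<lambda>j. p j x)"
  proof eventually_elim
    case (elim x)
    then have "summable (\<lambda>j. cmod (d j x))" by (intro summable_suminf_not_top) auto
    then have "summable (\<lambda>j. d j x)" by (rule summable_norm_cancel)
    then have "(\<lambda>n. \<Sum>j<n. d j x) \<longlonglongrightarrow> (\<Sum>j. d j x)" by (rule summable_LIMSEQ)
    moreover have "(\<Sum>j<n. d j x) = p n x - p 0 x" for n
      unfolding d_def by (rule sum_lessThan_telescope)
    ultimately have "(\<lambda>n. p n x - p 0 x) \<longlonglongrightarrow> (\<Sum>j. d j x)" by simp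
    from tendsto_add[OF this tendsto_const[of "p 0 x"]] show ?case
      by (auto simp: convergent_def)
  qed
  define g where "g = (\<lambda>x. lim (\<lambda>j. p j x))"
  have gm [measurable]: "g \<in> borel_measurable M01" unfolding g_def by measurable
  have glim: "AE x in M01. (\<lambda>j. p j x) \<longlonglongrightarrow> g x"
    using conv by eventually_elim (simp add: g_def convergent_LIMSEQ_iff)
  \<comment> \<open>Fatou's lemma lets \<open>j\<close> tend to infinity in the bound for
    \<open>p j - p i\<close>.\<close>
  have fat: "(\<integral>\<^sup>+x. ennreal ((cmod (g x - p i x))\<^sup>2) \<partial>M01) \<le> ennreal ((1/4)^i)" for i
  proof -
    have "(\<integral>\<^sup>+x. ennreal ((cmod (g x - p i x))\<^sup>2) \<partial>M01)
        = (\<integral>\<^sup>+x. liminf (\<lambda>j. ennreal ((cmod (p j x - p i x))\<^sup>2)) \<partial>M01)"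
    proof (rule nn_integral_cong_AE)
      show "AE x in M01. ennreal ((cmod (g x - p i x))\<^sup>2) = liminf (\<lambda>j. ennreal ((cmod (p j x - p i x))\<^sup>2))"
        using glim
      proof eventually_elim
        case (elim x)
        have "(\<lambda>j. ennreal ((cmod (p j x - p i x))\<^sup>2)) \<longlonglongrightarrow> ennreal ((cmod (g x - p i x))\<^sup>2)"
          by (intro tendsto_ennrealI tendsto_intros elim)
        then show ?case by (intro lim_imp_Liminf[symmetric]) auto
      qed
    qed
    also have "\<dots> \<le> liminf (\<lambda>j. \<integral>\<^sup>+x. ennreal ((cmod (p j x - p i x))\<^sup>2) \<partial>M01)"
      by (rule nn_integral_liminf) measurable
    also have "\<dots> \<le> ennreal ((1/4)^i)"
    proof (rule Liminf_le)
      show "\<forall>\<^sub>F j in sequentially. (\<integral>\<^sup>+x. ennreal ((cmod (p j x - p i x))\<^sup>2) \<partial>M01) \<le> ennreal ((1/4)^i)"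
      proof (rule eventually_sequentiallyI[of i])
        fix j assume "i \<le> j"
        then show "(\<integral>\<^sup>+x. ennreal ((cmod (p j x - p i x))\<^sup>2) \<partial>M01) \<le> ennreal ((1/4)^i)"
          using dn[of i j] by (subst nn_integral_eq_integral) (auto intro: ennreal_leI)
      qed
    qed simp
    finally show ?thesis .
  qed
  have gpi: "integrable M01 (\<lambda>x. (cmod (g x - p i x))\<^sup>2)" for i
  proof (rule integrableI_bounded)
    have "(\<integral>\<^sup>+x. ennreal (norm ((cmod (g x - p i x))\<^sup>2)) \<partial>M01) \<le> ennreal ((1/4)^i)"
      using fat[of i] by simp
    also have "\<dots> < \<infinity>" by simp
    finally show "(\<integral>\<^sup>+x. ennreal (norm ((cmod (g x - p i x))\<^sup>2)) \<partial>M01) < \<infinity>" .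
  qed measurable
  have gp: "(LINT x|M01. (cmod (g x - p i x))\<^sup>2) \<le> (1/4)^i" for i
    using fat[of i] gpi[of i] by (subst (asm) nn_integral_eq_integral) auto
  have gpL: "L2c (\<lambda>x. g x - p i x)" for i
    using gpi[of i] by (auto simp: L2c_def)
  have gL: "L2c g"
    using L2c_add[OF gpL[of 0], of "p 0"] L2c_tp by (simp add: p_def)
  have fcg: "fc g k = c k" for k
  proof -
    \<comment> \<open>Bessel's inequality bounds one coefficient of \<open>g - p i\<close> by the
      L^2 norm; once \<open>i\<close> reaches the modulus of \<open>k\<close>, the
      \<open>k\<close>-th coefficient of \<open>p i\<close> is exactly \<open>c k\<close>.\<close>
    have ev: "cmod (fc g k - c k) \<le> (1/2)^i" if "nat \<bar>k\<bar> \<le> i" for i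
    proof -
      have "\<bar>k\<bar> \<le> int (r i)" using that rge[of i] by linarith
      then have "k \<in> isym (r i)" by (auto simp: isym_def)
      then have "fc (\<lambda>x. g x - p i x) k = fc g k - c k"
        using L2c_integrable[OF gL] L2c_integrable[OF L2c_tp] by (simp add: fc_diff p_def fc_tp)
      then have "(cmod (fc g k - c k))\<^sup>2 \<le> nsq (fc (\<lambda>x. g x - p i x))"
        using sqs_sum_le[OF bessel(1)[OF gpL[of i]], of "{k}"] by simp
      also have "\<dots> \<le> (1/4)^i" using bessel(2)[OF gpL[of i]] gp[of i] by simp
      also have "(1/4::real)^i = ((1/2)^i)\<^sup>2" by (simp add: power2_eq_square flip: power_mult_distrib)
      finally show ?thesis by (rule power2_le_imp_le) simp
    qed
    have "(\<lambda>i. (1/2::real)^i) \<longlonglongrightarrow> 0" by (rule LIMSEQ_power_zero) simp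
    then have "cmod (fc g k - c k) \<le> 0"
      by (rule LIMSEQ_le_const) (use ev in blast)
    then show ?thesis by simp
  qed
  have "(LINT x|M01. (cmod (g x))\<^sup>2) = nsq c"
  proof -
    have e: "(LINT x|M01. (cmod (g x - p i x))\<^sup>2) = (LINT x|M01. (cmod (g x))\<^sup>2) - P (r i)" for i
    proof -
      have "fc g = c" using fcg by blast
      then show ?thesis
        using LINT_norm_diff_fourier[OF gL, of "isym (r i)"] by (simp add: p_def P_def)
    qed
    have "(\<lambda>i. (LINT x|M01. (cmod (g x))\<^sup>2) - P (r i)) \<longlonglongrightarrow> 0"
    proof (rule real_tendsto_sandwich)
      show "\<forall>\<^sub>F i in sequentially. 0 \<le> (LINT x|M01. (cmod (g x))\<^sup>2) - P (r i)"
        unfolding e[symmetric] by simp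
      show "\<forall>\<^sub>F i in sequentially. (LINT x|M01. (cmod (g x))\<^sup>2) - P (r i) \<le> (1/4)^i"
        unfolding e[symmetric] using gp by simp
      show "(\<lambda>i. (1/4::real)^i) \<longlonglongrightarrow> 0" by (rule LIMSEQ_power_zero) simp
    qed simp
    moreover have "filterlim r at_top sequentially"
      by (rule filterlim_at_top_mono[OF filterlim_ident]) (auto simp: rge)
    then have "(\<lambda>i. (LINT x|M01. (cmod (g x))\<^sup>2) - P (r i)) \<longlonglongrightarrow> (LINT x|M01. (cmod (g x))\<^sup>2) - nsq c"
      by (intro tendsto_diff tendsto_const filterlim_compose[OF P])
    ultimately have "(LINT x|M01. (cmod (g x))\<^sup>2) - nsq c = 0" by (rule LIMSEQ_unique[rotated])
    then show ?thesis by simp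
  qed
  moreover have "g (x + 1) = g x" for x
    by (simp add: g_def p_def tp_def ek_periodic)
  ultimately show ?thesis using that[of g] gL fcg by blast
qed

section \<open>Completeness of the trigonometric system\<close>

text \<open>Multiplication by \<open>ek 1\<close> or \<open>ek (- 1)\<close> shifts Fourier
  coefficients and so keeps them all zero; on the circle a real-linear function is a combination of
  these two. \<open>f\<close> is generalised in the induction because a product of polynomials is
  multiplied in one factor at a time.\<close>

lemma integral_mult_circle_polynomial:
  fixes p :: "complex \<Rightarrow> real"
  assumes "real_polynomial_function p"
  shows "integrable M01 f \<Longrightarrow> (\<And>k. fc f k = 0) \<Longrightarrow>
    integrable M01 (\<lambda>x. f x * of_real (p (cis (2 * pi * x))))
    \<and> (\<forall>k. fc (\<lambda>x. f x * of_real (p (cis (2 * pi * x)))) k = 0)"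
  using assms
proof (induction p arbitrary: f rule: real_polynomial_function.induct)
  case (linear p)
  define c where "c = (complex_of_real (p 1) - \<i> * of_real (p \<i>)) / 2"
  have p: "complex_of_real (p (cis (2 * pi * x))) = c * ek 1 x + cnj c * ek (- 1) x" for x
  proof -
    have "cis (2 * pi * x) = cos (2 * pi * x) *\<^sub>R 1 + sin (2 * pi * x) *\<^sub>R \<i>"
      by (simp add: complex_eq_iff)
    then have "p (cis (2 * pi * x)) = cos (2 * pi * x) * p 1 + sin (2 * pi * x) * p \<i>"
      by (simp only: linear_add[OF bounded_linear.linear[OF linear(1)]]
          linear_scale[OF bounded_linear.linear[OF linear(1)]] real_scaleR_def)
    then show ?thesis by (simp add: c_def ek_def complex_eq_iff field_simps)
  qed
  have eq: "f x * of_real (p (cis (2 * pi * x))) = c * (f x * ek 1 x) + cnj c * (f x * ek (- 1) x)" for x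
    unfolding p by (simp add: algebra_simps)
  have i: "integrable M01 (\<lambda>x. c * (f x * ek 1 x))" "integrable M01 (\<lambda>x. cnj c * (f x * ek (- 1) x))"
    using integrable_mult_ek[OF linear(2)] by auto
  show ?case
    unfolding eq using i linear by (auto simp: fc_add fc_cmult fc_ek)
next
  case (const c)
  then show ?case using fc_cmult[of "complex_of_real c" f] by (simp add: mult.commute)
next
  case (add p q)
  then show ?case by (simp add: distrib_left fc_add)
next
  case (mult p q)
  from mult.IH(1)[OF mult.prems]
  have "integrable M01 (\<lambda>x. f x * of_real (p (cis (2 * pi * x))))"
    "\<And>k. fc (\<lambda>x. f x * of_real (p (cis (2 * pi * x)))) k = 0" by auto
  from mult.IH(2)[OF this] show ?case by (simp add: mult.assoc)
qed

lemma integral_mult_continuous_loop: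
  fixes h :: "real \<Rightarrow> real"
  assumes f: "integrable M01 f" "\<And>k. fc f k = 0"
    and h: "continuous_on {0..1} h" "h 0 = h 1"
  shows "(LINT x|M01. f x * of_real (h x)) = 0"
proof -
  \<comment> \<open>The trivial homotopy from \<open>h\<close> to itself, transferred to the circle,
    gives continuity of \<open>h\<close> composed with the angle, although the angle itself jumps at
    1.\<close>
  have "homotopic_loops UNIV h h"
    using h by (simp add: homotopic_loops_refl path_def pathfinish_def pathstart_def)
  then have "continuous_on (sphere 0 1) (h \<circ> (\<lambda>z. Arg2pi z / (2 * pi)))"
    by (blast dest: homotopic_loops_imp_homotopic_circlemaps homotopic_with_imp_continuous)
  define H where "H = h \<circ> (\<lambda>z. Arg2pi z / (2 * pi))"
  have Hc: "continuous_on (sphere 0 1) H" unfolding H_def by fact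
  have Hh: "H (cis (2 * pi * x)) = h x" if "x \<in> {0..1}" for x
  proof (cases "x = 1")
    case True
    then show ?thesis using h(2) Arg2pi_of_real[of 1] by (simp add: H_def)
  next
    case False
    then have "Arg2pi (cis (2 * pi * x)) = 2 * pi * x"
      using that Arg2pi_exp[of "\<i> * of_real (2 * pi * x)"] by (simp add: cis_conv_exp)
    then show ?thesis by (simp add: H_def)
  qed
  have hm: "h \<in> borel_measurable M01"
    by (rule continuous_imp_measurable_lebesgue_on) (use h in auto)
  have fm [measurable]: "f \<in> borel_measurable M01" using f by auto
  have ifh: "integrable M01 (\<lambda>x. f x * of_real (h x))"
  proof -
    obtain B where B: "\<And>x. x \<in> {0..1} \<Longrightarrow> \<bar>h x\<bar> \<le> B"
      using compact_continuous_image[OF h(1)] compact_imp_bounded by (force simp: bounded_iff)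
    have [measurable]: "h \<in> borel_measurable M01" by fact
    show ?thesis
    proof (rule Bochner_Integration.integrable_bound)
      show "integrable M01 (\<lambda>x. of_real B * f x)" using f by simp
      show "AE x in M01. norm (f x * of_real (h x)) \<le> norm (of_real B * f x)"
      proof (rule AE_I2)
        fix x assume "x \<in> space M01"
        then have "\<bar>h x\<bar> \<le> \<bar>B\<bar>" using B[of x] by auto
        then show "norm (f x * of_real (h x)) \<le> norm (of_real B * f x)"
          using mult_right_mono[of "\<bar>h x\<bar>" "\<bar>B\<bar>" "cmod (f x)"] by (simp add: norm_mult mult.commute)
      qed
    qed measurable
  qed
  have *: "cmod (LINT x|M01. f x * of_real (h x)) \<le> e * (LINT x|M01. cmod (f x))" if e: "e > 0" for e
  proof -
    obtain p where p: "real_polynomial_function p" "\<And>z. z \<in> sphere 0 1 \<Longrightarrow> \<bar>H z - p z\<bar> < e"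
      using Stone_Weierstrass_real_polynomial_function[OF compact_sphere Hc e] by blast
    from integral_mult_circle_polynomial[OF p(1) f]
    have ip: "integrable M01 (\<lambda>x. f x * of_real (p (cis (2 * pi * x))))"
      and "fc (\<lambda>x. f x * of_real (p (cis (2 * pi * x)))) 0 = 0" by auto
    then have z: "(LINT x|M01. f x * of_real (p (cis (2 * pi * x)))) = 0" by (simp add: fc_def)
    have "(LINT x|M01. f x * of_real (h x)) = (LINT x|M01. f x * of_real (h x) - f x * of_real (p (cis (2 * pi * x))))"
      using z ip ifh by simp
    also have "cmod \<dots> \<le> (LINT x|M01. cmod (f x * of_real (h x) - f x * of_real (p (cis (2 * pi * x)))))"
      by (rule integral_norm_bound)
    also have "\<dots> \<le> (LINT x|M01. e * cmod (f x))"
    proof (rule integral_mono)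
      fix x assume "x \<in> space M01"
      then have "\<bar>h x - p (cis (2 * pi * x))\<bar> \<le> e"
        using p(2)[of "cis (2 * pi * x)"] Hh[of x] by auto
      then have "cmod (of_real (h x - p (cis (2 * pi * x)))) * cmod (f x) \<le> e * cmod (f x)"
        by (intro mult_right_mono) (simp_all only: norm_of_real norm_ge_zero)
      then show "cmod (f x * of_real (h x) - f x * of_real (p (cis (2 * pi * x)))) \<le> e * cmod (f x)"
        by (simp add: norm_mult mult.commute flip: right_diff_distrib of_real_diff)
    qed (use ifh ip f in auto)
    finally show ?thesis by simp
  qed
  define I where "I = (LINT x|M01. cmod (f x))"
  have "0 \<le> I" by (simp add: I_def)
  have "cmod (LINT x|M01. f x * of_real (h x)) \<le> 0 + d" if "d > 0" for d
  proof -
    have "d / (I + 1) > 0" using that \<open>0 \<le> I\<close> by simp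
    from *[OF this] have "cmod (LINT x|M01. f x * of_real (h x)) \<le> d / (I + 1) * I" by (simp add: I_def)
    also have "\<dots> \<le> d" using that \<open>0 \<le> I\<close> by (simp add: field_simps)
    finally show ?thesis by simp
  qed
  then have "cmod (LINT x|M01. f x * of_real (h x)) \<le> 0" by (rule field_le_epsilon)
  then show ?thesis by simp
qed

text \<open>A measurable function is an almost everywhere limit of continuous ones. Testing \<open>f\<close> against
  such approximations of \<open>f / (1 + \<bar>f\<bar>)\<close>, clipped to \<open>[-1, 1]\<close> and cut off near the end points,
  gives that the integral of \<open>f\<^sup>2 / (1 + \<bar>f\<bar>)\<close> vanishes.\<close>

lemma fourier_uniqueness_real:
  fixes f :: "real \<Rightarrow> real"
  assumes f: "integrable M01 f" and 0: "\<And>k. rc f k = 0"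
  shows "AE x in M01. f x = 0"
proof -
  have fm [measurable]: "f \<in> borel_measurable M01" using f by auto
  define \<phi> where "\<phi> = (\<lambda>x. f x / (1 + \<bar>f x\<bar>))"
  have \<phi>m [measurable]: "\<phi> \<in> borel_measurable M01" unfolding \<phi>_def by measurable
  have "(\<lambda>x. if x \<in> {0..1} then \<phi> x else 0) \<in> borel_measurable lebesgue"
    using \<phi>m by (subst borel_measurable_if) auto
  then have "(\<lambda>x. if x \<in> {0..1} then \<phi> x else 0) measurable_on UNIV"
    by (intro lebesgue_measurable_imp_measurable_on_real) auto
  then obtain N g where N: "negligible N" and g: "\<And>n. continuous_on UNIV (g n)"
    and lim: "\<And>x. x \<notin> N \<Longrightarrow> (\<lambda>n. g n x) \<longlonglongrightarrow> (if x \<in> {0..1} then \<phi> x else 0)"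
    unfolding measurable_on_def by (auto cong: if_cong)
  \<comment> \<open>Clipping makes the modulus of \<open>f\<close> a dominating function and does
    not change the limit, since \<open>\<phi>\<close> takes values in \<open>[-1, 1]\<close>. The
    cut-off factor vanishes at both end points, so \<open>h n\<close> is a loop, and tends to 1 in
    between.\<close>
  define h where "h = (\<lambda>n x. max (- 1) (min 1 (g n x)) * min 1 (real n * (x * (1 - x))))"
  have hc: "continuous_on {0..1} (h n)" for n
    unfolding h_def by (intro continuous_intros continuous_on_subset[OF g]) auto
  have hm [measurable]: "h n \<in> borel_measurable M01" for n
    by (rule continuous_imp_measurable_lebesgue_on[OF hc]) auto
  have h1: "\<bar>h n x\<bar> \<le> 1" if "x \<in> {0..1}" for n x
  proof -
    have "0 \<le> x * (1 - x)" using that by simp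
    then have "0 \<le> real n * (x * (1 - x))" by (rule mult_nonneg_nonneg[OF of_nat_0_le_iff])
    then have "\<bar>min 1 (real n * (x * (1 - x)))\<bar> \<le> 1" by (auto simp: abs_if min_def)
    moreover have "\<bar>max (- 1) (min 1 (g n x))\<bar> \<le> 1" by (simp add: abs_if)
    ultimately show ?thesis unfolding h_def abs_mult by (intro mult_le_one) auto
  qed
  have hlim: "(\<lambda>n. h n x) \<longlonglongrightarrow> \<phi> x" if "x \<notin> N" "0 < x" "x < 1" for x
  proof -
    have "(\<lambda>n. max (- 1) (min 1 (g n x))) \<longlonglongrightarrow> max (- 1) (min 1 (\<phi> x))"
      using lim[OF that(1)] that by (intro tendsto_intros) auto
    moreover have "max (- 1) (min 1 (\<phi> x)) = \<phi> x"
    proof -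
      have "\<bar>\<phi> x\<bar> \<le> 1" by (simp add: \<phi>_def field_simps)
      then show ?thesis by auto
    qed
    moreover have "(\<lambda>n. min 1 (real n * (x * (1 - x)))) \<longlonglongrightarrow> 1"
    proof (rule tendsto_eventually)
      have "0 < x * (1 - x)" using that by simp
      then obtain m where "1 < real m * (x * (1 - x))" using ex_less_of_nat_mult by blast
      then have "1 \<le> real n * (x * (1 - x))" if "m \<le> n" for n
        using that \<open>0 < x * (1 - x)\<close> mult_right_mono[of "real m" "real n" "x * (1 - x)"] by simp
      then show "\<forall>\<^sub>F n in sequentially. min 1 (real n * (x * (1 - x))) = 1"
        by (intro eventually_sequentiallyI[of m]) (simp add: min_def)
    qed
    ultimately show ?thesis unfolding h_def using tendsto_mult by fastforce
  qed
  have "AE x in M01. x \<notin> N \<and> x \<noteq> 0 \<and> x \<noteq> 1"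
  proof (intro AE_conjI AE_lebesgue_on_neq)
    have "AE x in lebesgue. x \<notin> N"
      using N by (simp add: negligible_iff_null_sets AE_not_in)
    then show "AE x in M01. x \<notin> N"
      by (subst AE_restrict_space_iff) (auto elim: eventually_mono)
  qed auto
  then have ae: "AE x in M01. (\<lambda>n. f x * h n x) \<longlonglongrightarrow> f x * \<phi> x"
    using AE_space
  proof eventually_elim
    case (elim x)
    then show ?case by (intro tendsto_intros hlim) auto
  qed
  have i0: "(LINT x|M01. f x * h n x) = 0" for n
  proof -
    have "h n 0 = h n 1" by (simp add: h_def)
    then have "(LINT x|M01. complex_of_real (f x) * of_real (h n x)) = 0"
      using f 0 by (intro integral_mult_continuous_loop hc) auto
    then have "complex_of_real (LINT x|M01. f x * h n x) = 0"
      by (simp flip: integral_complex_of_real)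
    then show ?thesis by simp
  qed
  have "(\<lambda>n. LINT x|M01. f x * h n x) \<longlonglongrightarrow> (LINT x|M01. f x * \<phi> x)"
  proof (rule integral_dominated_convergence[OF _ _ _ ae])
    show "integrable M01 (\<lambda>x. \<bar>f x\<bar>)" using f by simp
    show "AE x in M01. norm (f x * h n x) \<le> \<bar>f x\<bar>" for n
    proof (rule AE_I2)
      fix x assume "x \<in> space M01"
      then show "norm (f x * h n x) \<le> \<bar>f x\<bar>"
        using h1[of x n] by (simp add: abs_mult mult_left_le)
    qed
  qed measurable
  then have z: "(LINT x|M01. f x * \<phi> x) = 0" using i0 by (simp add: LIMSEQ_const_iff)
  have nn: "0 \<le> f x * \<phi> x" for x by (simp add: \<phi>_def zero_le_divide_iff)
  have "integrable M01 (\<lambda>x. f x * \<phi> x)"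
  proof (rule Bochner_Integration.integrable_bound[OF f])
    show "AE x in M01. norm (f x * \<phi> x) \<le> norm (f x)"
    proof (rule AE_I2)
      fix x
      have "\<bar>\<phi> x\<bar> \<le> 1" by (simp add: \<phi>_def field_simps)
      then show "norm (f x * \<phi> x) \<le> norm (f x)" by (simp add: abs_mult mult_left_le)
    qed
  qed measurable
  then have "AE x in M01. f x * \<phi> x = 0"
    using z nn by (subst (asm) integral_nonneg_eq_0_iff_AE) auto
  then show ?thesis
  proof eventually_elim
    case (elim x)
    have "1 + \<bar>f x\<bar> \<noteq> 0" using abs_ge_zero[of "f x"] by linarith
    then show ?case using elim by (auto simp: \<phi>_def)
  qed
qed

lemma fourier_uniqueness:
  assumes f: "integrable M01 f" and 0: "\<And>k. fc f k = 0"
  shows "AE x in M01. f x = 0"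
proof -
  have fcn: "integrable M01 (\<lambda>x. cnj (f x))" using f by simp
  have "rc (\<lambda>x. Re (f x)) k = 0" for k
  proof -
    have "(\<lambda>x. complex_of_real (Re (f x))) = (\<lambda>x. (1/2) * (f x + cnj (f x)))"
      by (simp add: fun_eq_iff complex_eq_iff)
    then show ?thesis using f fcn 0 by (simp only: fc_cmult fc_add fc_cnj) simp
  qed
  moreover have "rc (\<lambda>x. Im (f x)) k = 0" for k
  proof -
    have "(\<lambda>x. complex_of_real (Im (f x))) = (\<lambda>x. (1/(2*\<i>)) * (f x - cnj (f x)))"
      by (simp add: fun_eq_iff complex_eq_iff)
    then show ?thesis using f fcn 0 by (simp only: fc_cmult fc_diff fc_cnj) simp
  qed
  ultimately have "AE x in M01. Re (f x) = 0" "AE x in M01. Im (f x) = 0"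
    using f by (auto intro!: fourier_uniqueness_real integrable_Re integrable_Im)
  then show ?thesis by eventually_elim (simp add: complex_eq_iff)
qed

text \<open>The Riesz-Fischer function with the same coefficients has the right norm by
  construction, and by uniqueness of Fourier coefficients it agrees with \<open>f\<close> almost
  everywhere.\<close>

lemma parseval:
  assumes f: "L2c f" shows "(LINT x|M01. (cmod (f x))\<^sup>2) = nsq (fc f)"
proof -
  obtain g where g: "L2c g" "\<And>k. fc g k = fc f k" "(LINT x|M01. (cmod (g x))\<^sup>2) = nsq (fc f)"
    using riesz_fischer[OF bessel(1)[OF f]] by metis
  have i: "integrable M01 f" "integrable M01 g" using f g by (auto intro: L2c_integrable)
  have [measurable]: "f \<in> borel_measurable M01" "g \<in> borel_measurable M01" using i by auto
  have "AE x in M01. f x - g x = 0"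
    by (rule fourier_uniqueness) (use i g in \<open>auto simp: fc_diff\<close>)
  then have "(LINT x|M01. (cmod (f x))\<^sup>2) = (LINT x|M01. (cmod (g x))\<^sup>2)"
    by (intro integral_cong_AE) (measurable, auto elim!: eventually_mono)
  then show ?thesis using g by simp
qed

lemma parseval_has_sum:
  assumes "L2c f" shows "((\<lambda>k. (cmod (fc f k))\<^sup>2) has_sum (LINT x|M01. (cmod (f x))\<^sup>2)) UNIV"
  unfolding parseval[OF assms] using bessel(1)[OF assms] by (simp add: sqs_def nsq_def)

lemma complex_polarization:
  "4 * (x * cnj y) = of_real ((cmod (x + y))\<^sup>2) - of_real ((cmod (x - y))\<^sup>2)
     + \<i> * of_real ((cmod (x + \<i> * y))\<^sup>2) - \<i> * of_real ((cmod (x - \<i> * y))\<^sup>2)"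
  unfolding cmod_power2 by (simp add: complex_eq_iff power2_eq_square algebra_simps)

lemma has_sum_diff:
  fixes f g :: "'a \<Rightarrow> 'b::real_normed_vector"
  assumes "(f has_sum a) A" "(g has_sum b) A"
  shows "((\<lambda>x. f x - g x) has_sum (a - b)) A"
  using has_sum_add[OF assms(1), of "\<lambda>x. - g x" "- b"] assms(2) by (simp add: has_sum_uminus)

text \<open>Polarization: Parseval's identity is applied to \<open>f x + c * g x\<close> for the
  four values 1, -1, \<open>\<i>\<close> and \<open>- \<i>\<close> of \<open>c\<close>.\<close>

lemma parseval_inner:
  assumes f: "L2c f" and g: "L2c g"
  shows "((\<lambda>k. fc f k * cnj (fc g k)) has_sum (LINT x|M01. f x * cnj (g x))) UNIV"
proof -
  have ig: "L2c (\<lambda>x. c * g x)" for c by (rule L2c_cmult[OF g])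
  have L: "L2c (\<lambda>x. f x + c * g x)" for c by (rule L2c_add[OF f ig])
  have fcL: "fc (\<lambda>x. f x + c * g x) k = fc f k + c * fc g k" for c k
    using L2c_integrable[OF f] L2c_integrable[OF ig] by (simp add: fc_add fc_cmult)
  define I where "I = (\<lambda>c. LINT x|M01. (cmod (f x + c * g x))\<^sup>2)"
  have hs: "((\<lambda>k. complex_of_real ((cmod (fc f k + c * fc g k))\<^sup>2)) has_sum of_real (I c)) UNIV" for c
    using parseval_has_sum[OF L[of c]] unfolding fcL I_def by (intro has_sum_of_real)
  have "((\<lambda>k. 4 * (fc f k * cnj (fc g k))) has_sum (of_real (I 1) - of_real (I (- 1)) + \<i> * of_real (I \<i>) - \<i> * of_real (I (- \<i>)))) UNIV"
    unfolding complex_polarization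
    using has_sum_diff[OF has_sum_add[OF has_sum_diff[OF hs[of 1] hs[of "- 1"]] has_sum_cmult_right[OF hs[of \<i>], of \<i>]]
        has_sum_cmult_right[OF hs[of "- \<i>"], of \<i>]] by simp
  also have "of_real (I 1) - of_real (I (- 1)) + \<i> * of_real (I \<i>) - \<i> * of_real (I (- \<i>))
      = (LINT x|M01. 4 * (f x * cnj (g x)))"
  proof -
    have i: "integrable M01 (\<lambda>x. complex_of_real ((cmod (f x + c * g x))\<^sup>2))" for c
      using L[of c] unfolding L2c_def by (intro integrable_of_real) auto
    have "complex_of_real (I c) = (LINT x|M01. complex_of_real ((cmod (f x + c * g x))\<^sup>2))" for c
      unfolding I_def by (rule integral_complex_of_real[symmetric])
    then show ?thesis
      unfolding complex_polarization using i[of 1] i[of "- 1"] i[of \<i>] i[of "- \<i>"] by simp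
  qed
  finally have "((\<lambda>k. 4 * (fc f k * cnj (fc g k))) has_sum 4 * (LINT x|M01. f x * cnj (g x))) UNIV" by simp
  from has_sum_cmult_right[OF this, of "1/4"] show ?thesis by simp
qed

text \<open>Approximating \<open>f\<close> in \<open>L\<^sup>2\<close> by its partial sums, which are bounded by the \<open>\<ell>\<^sup>1\<close> norm \<open>A\<close>,
  shows that the excess of \<open>\<bar>f\<bar>\<close> over \<open>A\<close> has zero \<open>L\<^sup>2\<close> norm.\<close>

lemma AE_norm_le_of_summable:
  assumes f: "L2c f" and s: "(\<lambda>k. cmod (fc f k)) summable_on UNIV"
  shows "AE x in M01. cmod (f x) \<le> (\<Sum>\<^sub>\<infinity>k. cmod (fc f k))"
proof -
  define A where "A = (\<Sum>\<^sub>\<infinity>k. cmod (fc f k))"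
  have [measurable]: "f \<in> borel_measurable M01" using f by (simp add: L2c_def)
  have bound: "(max 0 (cmod (f x) - A))\<^sup>2 \<le> (cmod (f x - tp (fc f) (isym N) x))\<^sup>2" for N x
  proof (rule power_mono)
    have "cmod (tp (fc f) (isym N) x) \<le> A"
      unfolding A_def by (rule order_trans[OF norm_tp_le finite_sum_le_infsum[OF s]]) auto
    then show "max 0 (cmod (f x) - A) \<le> cmod (f x - tp (fc f) (isym N) x)"
      using norm_triangle_ineq2[of "f x" "tp (fc f) (isym N) x"] by simp
  qed simp
  have i: "integrable M01 (\<lambda>x. (max 0 (cmod (f x) - A))\<^sup>2)"
    by (rule Bochner_Integration.integrable_bound[OF LINT_norm_diff_tp(1)[OF f finite_isym[of 0], of "fc f"]])
      (use bound[of _ 0] in \<open>auto simp: power_abs[symmetric]\<close>)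
  have "(LINT x|M01. (max 0 (cmod (f x) - A))\<^sup>2) \<le> nsq (fc f) - (\<Sum>k\<in>isym N. (cmod (fc f k))\<^sup>2)" for N
  proof -
    have "(LINT x|M01. (max 0 (cmod (f x) - A))\<^sup>2) \<le> (LINT x|M01. (cmod (f x - tp (fc f) (isym N) x))\<^sup>2)"
      by (intro integral_mono i LINT_norm_diff_tp(1)[OF f] bound) simp
    then show ?thesis by (simp add: LINT_norm_diff_fourier[OF f] parseval[OF f])
  qed
  moreover have "(\<lambda>N. nsq (fc f) - (\<Sum>k\<in>isym N. (cmod (fc f k))\<^sup>2)) \<longlonglongrightarrow> nsq (fc f) - nsq (fc f)"
    by (intro tendsto_intros nsq_isym_tendsto bessel f)
  ultimately have "(LINT x|M01. (max 0 (cmod (f x) - A))\<^sup>2) \<le> nsq (fc f) - nsq (fc f)"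
    by (intro LIMSEQ_le_const) auto
  moreover have "0 \<le> (LINT x|M01. (max 0 (cmod (f x) - A))\<^sup>2)" by simp
  ultimately have "(LINT x|M01. (max 0 (cmod (f x) - A))\<^sup>2) = 0" by linarith
  then have "AE x in M01. (max 0 (cmod (f x) - A))\<^sup>2 = 0"
    using i by (subst (asm) integral_nonneg_eq_0_iff_AE) auto
  then show ?thesis unfolding A_def[symmetric] by eventually_elim (auto simp: max_def split: if_splits)
qed

section \<open>Sobolev spaces and the equation in Fourier coefficients\<close>

text \<open>The Fourier symbol of the derivative; \<open>lam\<close> is its modulus.\<close>

definition dk :: "int \<Rightarrow> complex" where "dk k = 2 * pi * of_int k * \<i>"

definition lam :: "int \<Rightarrow> real" where "lam k = 2 * pi * \<bar>of_int k\<bar>"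

definition conv :: "(int \<Rightarrow> complex) \<Rightarrow> (int \<Rightarrow> complex) \<Rightarrow> int \<Rightarrow> complex" where
  "conv a b k = (\<Sum>\<^sub>\<infinity>j. a j * b (k - j))"

lemma norm_dk [simp]: "cmod (dk k) = lam k"
  by (simp add: dk_def lam_def norm_mult)

lemma dk_minus: "dk (- k) = - dk k" by (simp add: dk_def)

lemma cnj_dk [simp]: "cnj (dk k) = - dk k" by (simp add: dk_def)

lemma dk_square: "(dk k)\<^sup>2 = - of_real ((lam k)\<^sup>2)"
  by (simp add: dk_def lam_def power_mult_distrib)

lemma dk_0 [simp]: "dk 0 = 0" by (simp add: dk_def)

lemma lam_0 [simp]: "lam 0 = 0" by (simp add: lam_def)

lemma lam_minus [simp]: "lam (- k) = lam k" by (simp add: lam_def)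

lemma lam_nonneg [simp]: "0 \<le> lam k" by (simp add: lam_def)

lemma lam_ge_1: assumes "k \<noteq> 0" shows "1 \<le> lam k"
proof -
  have "1 \<le> \<bar>real_of_int k\<bar>" using assms by linarith
  then have "2 * pi * 1 \<le> lam k" unfolding lam_def by (intro mult_left_mono) auto
  then show ?thesis using pi_gt3 by linarith
qed

section \<open>Fourier coefficients of real periodic functions\<close>

lemma in_L2_iff: "in_L2 u \<longleftrightarrow> periodic1 u \<and> L2c (\<lambda>x. complex_of_real (u x))"
proof -
  have "u \<in> borel_measurable M01 \<longleftrightarrow> (\<lambda>x. complex_of_real (u x)) \<in> borel_measurable M01"
  proof
    assume "(\<lambda>x. complex_of_real (u x)) \<in> borel_measurable M01"
    then have "(\<lambda>x. Re (complex_of_real (u x))) \<in> borel_measurable M01" by measurable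
    then show "u \<in> borel_measurable M01" by simp
  qed measurable
  then show ?thesis by (simp add: in_L2_def L2c_def)
qed

lemma in_L2_L2c: "in_L2 u \<Longrightarrow> L2c (\<lambda>x. complex_of_real (u x))"
  by (simp add: in_L2_iff)

lemma in_L2_integrable: "in_L2 u \<Longrightarrow> integrable M01 u"
  using L2c_integrable[OF in_L2_L2c] integrable_Re by fastforce

lemma in_L2_add: "in_L2 u \<Longrightarrow> in_L2 v \<Longrightarrow> in_L2 (\<lambda>x. u x + v x)"
  using L2c_add[of "\<lambda>x. complex_of_real (u x)" "\<lambda>x. complex_of_real (v x)"]
  by (auto simp: in_L2_iff periodic1_def)

lemma in_L2_diff: "in_L2 u \<Longrightarrow> in_L2 v \<Longrightarrow> in_L2 (\<lambda>x. u x - v x)"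
  using L2c_add[of "\<lambda>x. complex_of_real (u x)" "\<lambda>x. (- 1) * complex_of_real (v x)"]
    L2c_cmult[of "\<lambda>x. complex_of_real (v x)" "- 1"]
  by (auto simp: in_L2_iff periodic1_def)

lemma sqs_rc: "in_L2 u \<Longrightarrow> sqs (rc u)"
  by (rule bessel(1)[OF in_L2_L2c])

lemma l2_norm_eq: "in_L2 u \<Longrightarrow> l2_norm u = sqrt (nsq (rc u))"
  using parseval[OF in_L2_L2c, of u] by (simp add: l2_norm_def)

lemma rc_minus: "rc u (- k) = cnj (rc u k)"
  using fc_cnj[of "\<lambda>x. complex_of_real (u x)" "- k"] by simp

lemma rc_add: "in_L2 u \<Longrightarrow> in_L2 v \<Longrightarrow> rc (\<lambda>x. u x + v x) k = rc u k + rc v k"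
  using fc_add[OF L2c_integrable[OF in_L2_L2c] L2c_integrable[OF in_L2_L2c], of u v k] by simp

lemma rc_diff: "in_L2 u \<Longrightarrow> in_L2 v \<Longrightarrow> rc (\<lambda>x. u x - v x) k = rc u k - rc v k"
  using fc_diff[OF L2c_integrable[OF in_L2_L2c] L2c_integrable[OF in_L2_L2c], of u v k] by simp

lemma l2_inner_has_sum:
  assumes "in_L2 u" "in_L2 v"
  shows "((\<lambda>k. Re (rc u k * cnj (rc v k))) has_sum l2_inner u v) UNIV"
proof -
  have "(LINT x|M01. complex_of_real (u x) * cnj (complex_of_real (v x))) = complex_of_real (l2_inner u v)"
    unfolding l2_inner_def by (subst integral_complex_of_real[symmetric]) simp
  then have "((\<lambda>k. rc u k * cnj (rc v k)) has_sum complex_of_real (l2_inner u v)) UNIV"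
    using parseval_inner[OF in_L2_L2c[OF assms(1)] in_L2_L2c[OF assms(2)]] by simp
  from has_sum_Re[OF this] show ?thesis by simp
qed

text \<open>A shift by 1 leaves the set of candidate derivatives at a point unchanged, hence also
  the value that \<open>deriv\<close> selects from it.\<close>

lemma periodic1_deriv:
  assumes "periodic1 \<phi>" shows "periodic1 (deriv \<phi>)"
proof -
  have "(\<lambda>y. \<phi> (y + 1)) = \<phi>" using assms by (auto simp: periodic1_def)
  then have "(\<phi> has_field_derivative d) (at (x + 1)) \<longleftrightarrow> (\<phi> has_field_derivative d) (at x)" for d x
    using DERIV_shift[of \<phi> d x 1] by simp
  then show ?thesis by (simp add: periodic1_def deriv_def)
qed

lemma test_fun_deriv: assumes "test_fun \<phi>" shows "test_fun (deriv \<phi>)"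
proof -
  have "((deriv ^^ k) (deriv \<phi>)) differentiable (at x)" for k x
    using assms[unfolded test_fun_def, THEN conjunct2, rule_format, of "Suc k" x] by (simp add: funpow_swap1)
  then show ?thesis using assms by (auto simp: test_fun_def periodic1_deriv)
qed

lemma test_fun_funpow: "test_fun \<phi> \<Longrightarrow> test_fun ((deriv ^^ m) \<phi>)"
  by (induction m) (auto simp: test_fun_deriv)

lemma test_fun_DERIV: assumes "test_fun \<phi>" shows "(\<phi> has_field_derivative deriv \<phi> x) (at x)"
  using assms[unfolded test_fun_def, THEN conjunct2, rule_format, of 0 x]
  by (simp add: DERIV_deriv_iff_real_differentiable)

lemma test_fun_continuous: "test_fun \<phi> \<Longrightarrow> continuous_on S \<phi>"
  by (meson DERIV_isCont continuous_at_imp_continuous_on test_fun_DERIV)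

lemma test_fun_in_L2: assumes "test_fun \<phi>" shows "in_L2 \<phi>"
proof -
  have "continuous_on {0..1} (\<lambda>x. complex_of_real (\<phi> x))"
    using test_fun_continuous[OF assms] by (intro continuous_intros)
  moreover from compact_imp_bounded[OF compact_continuous_image[OF this compact_Icc]]
  obtain B where "\<forall>y\<in>(\<lambda>x. complex_of_real (\<phi> x)) ` {0..1}. norm y \<le> B"
    unfolding bounded_iff by blast
  then have "\<And>x. x \<in> {0..1} \<Longrightarrow> norm (complex_of_real (\<phi> x)) \<le> B" by blast
  ultimately have "L2c (\<lambda>x. complex_of_real (\<phi> x))"
    by (intro L2c_bounded continuous_imp_measurable_lebesgue_on) auto
  then show ?thesis using assms by (simp add: in_L2_iff test_fun_def)
qed

text \<open>Integration by parts over one period; the boundary terms cancel.\<close>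

lemma rc_deriv:
  assumes \<phi>: "test_fun \<phi>" shows "rc (deriv \<phi>) k = dk k * rc \<phi> k"
proof -
  have c: "continuous_on S (\<lambda>x. complex_of_real (\<phi> x))" "continuous_on S (\<lambda>x. complex_of_real (deriv \<phi> x))" for S
    using test_fun_continuous[OF \<phi>] test_fun_continuous[OF test_fun_deriv[OF \<phi>]]
    by (auto intro!: continuous_intros)
  define h' where "h' = (\<lambda>x. complex_of_real (\<phi> x) * ((2 * pi * of_int (- k) * \<i>) * ek (- k) x)
      + complex_of_real (deriv \<phi> x) * ek (- k) x)"
  have "((\<lambda>x. complex_of_real (\<phi> x)) has_vector_derivative complex_of_real (deriv \<phi> x)) (at x within {0..1})" for x
    using test_fun_DERIV[OF \<phi>, of x]
    by (intro has_vector_derivative_of_real) (simp add: has_real_derivative_iff_has_vector_derivative has_vector_derivative_at_within)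
  from has_vector_derivative_mult[OF this ek_has_vector_derivative]
  have "((\<lambda>x. complex_of_real (\<phi> x) * ek (- k) x) has_vector_derivative h' x) (at x within {0..1})" for x
    unfolding h'_def by blast
  moreover have "continuous_on {0..1} h'" unfolding h'_def by (intro continuous_intros c)
  ultimately have "(LINT x|M01. h' x) = complex_of_real (\<phi> 1) * ek (- k) 1 - complex_of_real (\<phi> 0) * ek (- k) 0"
    by (rule LINT_vector_derivative[OF zero_le_one])
  also have "\<dots> = 0"
    using \<phi> ek_periodic[of "- k" 0] by (simp add: test_fun_def periodic1_def) (metis add_0)
  finally have "(LINT x|M01. h' x) = 0" .
  moreover have "(LINT x|M01. h' x) = - dk k * rc \<phi> k + rc (deriv \<phi>) k"
  proof -
    have eq: "h' x = - dk k * (complex_of_real (\<phi> x) * ek (- k) x) + complex_of_real (deriv \<phi> x) * ek (- k) x" for x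
      by (simp add: h'_def dk_def algebra_simps)
    show ?thesis unfolding eq
      using integrable_mult_ek[OF L2c_integrable[OF in_L2_L2c[OF test_fun_in_L2[OF \<phi>]]]]
        integrable_mult_ek[OF L2c_integrable[OF in_L2_L2c[OF test_fun_in_L2[OF test_fun_deriv[OF \<phi>]]]]]
      by (subst Bochner_Integration.integral_add) (auto simp: fc_def)
  qed
  ultimately show ?thesis by simp
qed

lemma rc_funpow_deriv: "test_fun \<phi> \<Longrightarrow> rc ((deriv ^^ m) \<phi>) k = dk k ^ m * rc \<phi> k"
proof (induction m)
  case (Suc m)
  then show ?case using rc_deriv[OF test_fun_funpow[OF Suc.prems, of m]] by (simp add: mult.assoc)
qed simp

text \<open>Test functions are real-valued, so exponentials enter through real parts. Varying the
  amplitude \<open>a\<close> recovers both the real and the imaginary part of a coefficient.\<close>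

definition trig :: "complex \<Rightarrow> int \<Rightarrow> real \<Rightarrow> real" where
  "trig a k x = Re (a * ek k x)"

lemma trig_has_derivative: "(trig a k has_field_derivative trig (a * dk k) k x) (at x)"
proof -
  have "((\<lambda>x. a * ek k x) has_vector_derivative a * ((2 * pi * of_int k * \<i>) * ek k x)) (at x)"
    by (rule has_vector_derivative_mult_right[OF ek_has_vector_derivative])
  from bounded_linear.has_vector_derivative[OF bounded_linear_Re this]
  show ?thesis
    by (simp add: trig_def[abs_def] has_real_derivative_iff_has_vector_derivative dk_def algebra_simps)
qed

lemma deriv_trig: "deriv (trig a k) = trig (a * dk k) k"
  using DERIV_imp_deriv[OF trig_has_derivative] by blast

lemma funpow_deriv_trig: "(deriv ^^ m) (trig a k) = trig (a * dk k ^ m) k"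
  by (induction m) (auto simp: deriv_trig mult.assoc mult.commute mult.left_commute)

lemma test_fun_trig: "test_fun (trig a k)"
  unfolding test_fun_def funpow_deriv_trig
  using trig_has_derivative real_differentiable_def
  by (auto simp: periodic1_def) (auto simp: trig_def ek_periodic)

lemma l2_inner_trig:
  assumes "integrable M01 u" shows "l2_inner u (trig a k) = Re (a * cnj (rc u k))"
proof -
  have i: "integrable M01 (\<lambda>x. a * (complex_of_real (u x) * ek k x))"
    by (intro integrable_mult_right integrable_mult_ek integrable_of_real assms)
  have "l2_inner u (trig a k) = (LINT x|M01. Re (a * (complex_of_real (u x) * ek k x)))"
    unfolding l2_inner_def trig_def by (intro Bochner_Integration.integral_cong refl) (simp add: algebra_simps)
  also have "\<dots> = Re (LINT x|M01. a * (complex_of_real (u x) * ek k x))"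
    by (rule integral_Re[OF i])
  also have "\<dots> = Re (a * rc u (- k))" by (simp add: fc_def)
  finally show ?thesis by (simp add: rc_minus)
qed

lemma complex_eq_Re_mult: "(\<And>a. Re (a * x) = Re (a * y)) \<Longrightarrow> x = y"
  using complex_eqI[of x y] by (metis Re_i_times mult_1 neg_equal_iff_equal)

text \<open>Forward, the test functions \<open>trig a (- k)\<close> read off one coefficient at a
  time, and \<open>(- 1) ^ m\<close> matches the sign of \<open>dk (- k) ^ m\<close>. Backward,
  Parseval's identity moves the symbol from one factor to the other.\<close>

lemma weak_deriv_iff:
  assumes u: "in_L2 u" and g: "in_L2 g"
  shows "weak_deriv m u g \<longleftrightarrow> (\<forall>k. rc g k = dk k ^ m * rc u k)"
proof
  assume w: "weak_deriv m u g"
  show "\<forall>k. rc g k = dk k ^ m * rc u k"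
  proof
    fix k
    have "Re (a * (dk k ^ m * rc u k)) = Re (a * rc g k)" for a
    proof -
      have "l2_inner u ((deriv ^^ m) (trig a (- k))) = (- 1) ^ m * l2_inner g (trig a (- k))"
        using w test_fun_trig by (simp add: weak_deriv_def)
      then have "Re (a * dk (- k) ^ m * rc u k) = (- 1) ^ m * Re (a * rc g k)"
        by (simp add: funpow_deriv_trig l2_inner_trig in_L2_integrable u g rc_minus)
      moreover have "dk (- k) ^ m = (- 1) ^ m * dk k ^ m"
        unfolding dk_minus by (rule power_minus)
      moreover have "Re (a * ((- 1) ^ m * z)) = (- 1) ^ m * Re (a * z)" for z
        by (cases "even m") simp_all
      ultimately have "(- 1) ^ m * Re (a * (dk k ^ m * rc u k)) = (- 1) ^ m * Re (a * rc g k)"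
        by (simp only: mult.assoc)
      then show ?thesis by (cases "even m") simp_all
    qed
    then show "rc g k = dk k ^ m * rc u k" by (intro complex_eq_Re_mult) simp
  qed
next
  assume gk: "\<forall>k. rc g k = dk k ^ m * rc u k"
  show "weak_deriv m u g"
    unfolding weak_deriv_def
  proof (intro allI impI)
    fix \<phi> assume \<phi>: "test_fun \<phi>"
    have "((\<lambda>k. Re (rc u k * cnj (dk k ^ m * rc \<phi> k))) has_sum l2_inner u ((deriv ^^ m) \<phi>)) UNIV"
      using l2_inner_has_sum[OF u test_fun_in_L2[OF test_fun_funpow[OF \<phi>, of m]]]
      by (simp add: rc_funpow_deriv[OF \<phi>])
    moreover have "Re (rc u k * cnj (dk k ^ m * rc \<phi> k)) = (- 1) ^ m * Re (rc g k * cnj (rc \<phi> k))" for k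
    proof -
      have "cnj (dk k ^ m) = (- 1) ^ m * dk k ^ m" by (simp add: power_minus[of "dk k"])
      then have "rc u k * cnj (dk k ^ m * rc \<phi> k) = (- 1) ^ m * (rc g k * cnj (rc \<phi> k))"
        using gk by (simp only: complex_cnj_mult mult_ac)
      moreover have "Re ((- 1) ^ m * z) = (- 1) ^ m * Re z" for z
        by (cases "even m") simp_all
      ultimately show ?thesis by (simp only:)
    qed
    moreover have "((\<lambda>k. (- 1) ^ m * Re (rc g k * cnj (rc \<phi> k))) has_sum (- 1) ^ m * l2_inner g \<phi>) UNIV"
      by (rule has_sum_cmult_right[OF l2_inner_has_sum[OF g test_fun_in_L2[OF \<phi>]]])
    ultimately show "l2_inner u ((deriv ^^ m) \<phi>) = (- 1) ^ m * l2_inner g \<phi>"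
      by (simp add: has_sum_unique)
  qed
qed

text \<open>Taking the real part symmetrises the coefficients, and \<open>c\<close> already has this
  symmetry.\<close>

lemma riesz_fischer_real:
  assumes "sqs c" "\<And>k. c (- k) = cnj (c k)"
  shows "\<exists>u. in_L2 u \<and> rc u = c"
proof -
  obtain g where g: "L2c g" "\<And>x. g (x + 1) = g x" "\<And>k. fc g k = c k"
    using riesz_fischer[OF assms(1)] by metis
  have gi: "integrable M01 g" "integrable M01 (\<lambda>x. cnj (g x))" using L2c_integrable[OF g(1)] by auto
  have eq: "(\<lambda>x. complex_of_real (Re (g x))) = (\<lambda>x. (1/2) * (g x + cnj (g x)))"
    by (simp add: fun_eq_iff complex_eq_iff)
  have "L2c (\<lambda>x. cnj (g x))" using g(1) by (auto simp: L2c_def)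
  then have "in_L2 (\<lambda>x. Re (g x))"
    unfolding in_L2_iff eq periodic1_def using g(1) by (intro conjI L2c_cmult L2c_add) (simp_all add: g(2))
  moreover have "rc (\<lambda>x. Re (g x)) k = c k" for k
    using gi g(3) assms(2)[of k] by (simp only: eq fc_cmult fc_add fc_cnj) simp
  ultimately show ?thesis by blast
qed

lemma rc_0: "rc u 0 = complex_of_real (LINT x|M01. u x)"
  by (simp add: fc_def)

text \<open>The coefficients of a weak derivative are determined by those of \<open>u\<close>.
  Bessel's inequality makes them square-summable if the derivative exists, and the Riesz-Fischer
  theorem produces it if they are.\<close>

lemma Hs_iff: "u \<in> Hs m \<longleftrightarrow> in_L2 u \<and> rc u 0 = 0 \<and> sqs (\<lambda>k. dk k ^ m * rc u k)"
proof
  assume u: "u \<in> Hs m"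
  then obtain g where g: "in_L2 g" "weak_deriv m u g" and u': "in_L2 u" by (auto simp: Hs_def)
  then have "rc g = (\<lambda>k. dk k ^ m * rc u k)" using weak_deriv_iff by blast
  then show "in_L2 u \<and> rc u 0 = 0 \<and> sqs (\<lambda>k. dk k ^ m * rc u k)"
    using u sqs_rc[OF g(1)] by (auto simp: Hs_def rc_0)
next
  assume u: "in_L2 u \<and> rc u 0 = 0 \<and> sqs (\<lambda>k. dk k ^ m * rc u k)"
  obtain g where "in_L2 g" "rc g = (\<lambda>k. dk k ^ m * rc u k)"
    using riesz_fischer_real[of "\<lambda>k. dk k ^ m * rc u k"] u by (auto simp: dk_minus rc_minus)
  then show "u \<in> Hs m" using u by (auto simp: Hs_def rc_0 weak_deriv_iff)
qed

text \<open>\<open>Dx m u\<close> is an arbitrary choice, but all weak derivatives of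
  \<open>u\<close> share their coefficients, and these fix the norm.\<close>

lemma Hnorm_eq:
  assumes "u \<in> Hs m"
  shows "Hnorm m u = sqrt (nsq (\<lambda>k. dk k ^ m * rc u k))"
proof -
  have u: "in_L2 u" using assms by (simp add: Hs_iff)
  have "\<exists>g. in_L2 g \<and> weak_deriv m u g" using assms by (simp add: Hs_def)
  then have "in_L2 (Dx m u) \<and> weak_deriv m u (Dx m u)" unfolding Dx_def by (rule someI_ex)
  moreover from this have "rc (Dx m u) = (\<lambda>k. dk k ^ m * rc u k)"
    using weak_deriv_iff[OF u] by blast
  ultimately show ?thesis using l2_norm_eq[of "Dx m u"] by (simp add: Hnorm_def)
qed

lemma nsq_dk_lam: "nsq (\<lambda>k. dk k ^ m * a k) = nsq (\<lambda>k. of_real (lam k ^ m) * a k)"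
  and sqs_dk_lam: "sqs (\<lambda>k. dk k ^ m * a k) \<longleftrightarrow> sqs (\<lambda>k. of_real (lam k ^ m) * a k)"
  by (simp_all add: nsq_def sqs_def norm_mult norm_power)

text \<open>\<open>H\<^sup>n\<close> is identified with \<open>hseq\<close> by weighting the Fourier coefficient at \<open>k\<close> with \<open>(2 \<pi> \<bar>k\<bar>)\<^sup>n\<close>.\<close>

definition toX :: "nat \<Rightarrow> (real \<Rightarrow> real) \<Rightarrow> hseq" where
  "toX n u = Hseq (\<lambda>k. of_real (lam k ^ n) * rc u k)"

lemma cf_toX:
  assumes "u \<in> Hs n" shows "cf (toX n u) k = of_real (lam k ^ n) * rc u k"
proof -
  have "cf (toX n u) = (\<lambda>k. of_real (lam k ^ n) * rc u k)"
    unfolding toX_def using assms by (intro cf_Hseq) (auto simp: Hs_iff rc_minus sqs_dk_lam)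
  then show ?thesis by simp
qed

lemma norm_toX: "u \<in> Hs n \<Longrightarrow> norm (toX n u) = Hnorm n u"
proof -
  assume u: "u \<in> Hs n"
  have "cf (toX n u) = (\<lambda>k. of_real (lam k ^ n) * rc u k)" using cf_toX[OF u] by blast
  then show ?thesis by (simp add: norm_hseq_def Hnorm_eq[OF u] nsq_dk_lam)
qed

lemma Hs_diff:
  assumes "u \<in> Hs n" "v \<in> Hs n" shows "(\<lambda>x. u x - v x) \<in> Hs n"
proof -
  have L: "in_L2 u" "in_L2 v" using assms by (auto simp: Hs_iff)
  have "(\<lambda>k. dk k ^ n * rc (\<lambda>x. u x - v x) k) = (\<lambda>k. dk k ^ n * rc u k - dk k ^ n * rc v k)"
    by (simp add: rc_diff[OF L] right_diff_distrib del: of_real_diff)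
  moreover have "rc (\<lambda>x. u x - v x) 0 = 0"
    using assms by (simp add: rc_diff[OF L] Hs_iff del: of_real_diff)
  moreover have "sqs (\<lambda>k. dk k ^ n * rc u k - dk k ^ n * rc v k)"
    using assms by (intro sqs_diff) (auto simp: Hs_iff)
  ultimately show ?thesis
    by (simp add: Hs_iff in_L2_diff[OF L] del: of_real_diff)
qed

lemma toX_diff: "u \<in> Hs n \<Longrightarrow> v \<in> Hs n \<Longrightarrow> toX n (u - v) = toX n u - toX n v"
  by (rule hseq_eqI) (simp add: cf_diff cf_toX Hs_diff fun_diff_def rc_diff Hs_iff[THEN iffD1] right_diff_distrib del: of_real_diff)

lemma Hnorm_diff:
  assumes "u \<in> Hs n" "v \<in> Hs n" shows "Hnorm n (u - v) = norm (toX n u - toX n v)"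
  using norm_toX[of "u - v" n] Hs_diff[OF assms] toX_diff[OF assms] by (simp add: fun_diff_def)

lemma rc_of_toX:
  assumes "u \<in> Hs n" shows "rc u k = cf (toX n u) k / of_real (lam k ^ n)"
proof (cases "k = 0")
  case True
  then show ?thesis using assms by (simp add: Hs_iff)
next
  case False
  then have "lam k ^ n \<noteq> 0" using lam_ge_1[of k] by auto
  then show ?thesis by (simp add: cf_toX[OF assms])
qed

lemma toX_eq_imp_AE:
  assumes "u \<in> Hs n" "v \<in> Hs n" "toX n u = toX n v"
  shows "AE x in M01. u x = v x"
proof -
  have L: "in_L2 u" "in_L2 v" using assms by (auto simp: Hs_iff)
  have "AE x in M01. u x - v x = 0"
  proof (rule fourier_uniqueness_real)
    show "integrable M01 (\<lambda>x. u x - v x)" using L by (auto intro: in_L2_integrable)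
    show "rc (\<lambda>x. u x - v x) k = 0" for k
      using rc_diff[OF L, of k] rc_of_toX[OF assms(1)] rc_of_toX[OF assms(2)] assms(3) by simp
  qed
  then show ?thesis by simp
qed

lemma lam_pow_ge_1: "k \<noteq> 0 \<Longrightarrow> 1 \<le> lam k ^ n"
  using lam_ge_1 by simp

text \<open>Surjectivity of the identification. Dividing by the weight keeps coefficients
  square-summable because \<open>lam k\<close> is at least 1 away from 0, and at 0 the coefficient
  vanishes.\<close>

lemma ex_toX: "\<exists>u\<in>Hs n. toX n u = x"
proof -
  define c where "c = (\<lambda>k. cf x k / of_real (lam k ^ n))"
  have le: "cmod (c k) \<le> cmod (cf x k)" for k
  proof (cases "k = 0")
    case False
    then show ?thesis using lam_pow_ge_1[OF False, of n]
      by (simp add: c_def norm_divide norm_power divide_le_eq mult_left_le) (simp add: mult_le_cancel_left1)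
  qed (simp add: c_def)
  obtain u where u: "in_L2 u" "rc u = c"
    using riesz_fischer_real[OF sqs_comparison(1)[OF sqs_cf le]] by (auto simp: c_def)
  have *: "of_real (lam k ^ n) * rc u k = cf x k" for k
    using lam_ge_1[of k] by (cases "k = 0") (auto simp: u c_def)
  then have "(\<lambda>k. of_real (lam k ^ n) * rc u k) = cf x" by blast
  then have "sqs (\<lambda>k. dk k ^ n * rc u k)" unfolding sqs_dk_lam by simp
  then have "u \<in> Hs n" using u by (auto simp: Hs_iff c_def)
  moreover have "toX n u = x" using cf_toX[OF \<open>u \<in> Hs n\<close>] * by (intro hseq_eqI) simp
  ultimately show ?thesis by blast
qed

text \<open>Parseval's identity for \<open>u\<close> and \<open>u\<close> times \<open>ek k\<close>,
  whose coefficients are those of \<open>u\<close> shifted by \<open>k\<close>. It applies to every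
  \<open>u\<close> in L^2, where the square is merely integrable.\<close>

lemma rc_square:
  assumes "in_L2 u" shows "rc (\<lambda>x. (u x)\<^sup>2) k = conv (rc u) (rc u) k"
proof -
  let ?f = "\<lambda>x. complex_of_real (u x)"
  have f: "L2c ?f" by (rule in_L2_L2c[OF assms])
  have g: "L2c (\<lambda>x. ?f x * ek k x)" by (rule L2c_mult_bounded[OF f, where B = 1]) auto
  have "((\<lambda>j. rc u j * cnj (fc (\<lambda>x. ?f x * ek k x) j)) has_sum (LINT x|M01. ?f x * cnj (?f x * ek k x))) UNIV"
    by (rule parseval_inner[OF f g])
  moreover have "cnj (fc (\<lambda>x. ?f x * ek k x) j) = rc u (k - j)" for j
    using rc_minus[of u "j - k"] by (simp add: fc_ek)
  moreover have "(LINT x|M01. ?f x * cnj (?f x * ek k x)) = rc (\<lambda>x. (u x)\<^sup>2) k"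
    unfolding fc_def by (intro Bochner_Integration.integral_cong) (auto simp: cnj_ek power2_eq_square mult.assoc)
  ultimately show ?thesis by (simp add: conv_def infsumI)
qed

lemma in_L2_square_integrable: "in_L2 u \<Longrightarrow> integrable M01 (\<lambda>x. (u x)\<^sup>2)"
  by (simp add: in_L2_def)

text \<open>The \<open>k\<close>-th Fourier coefficient of
  \<open>\<nu> w_xx - 1/2 d_x (w + v)^2\<close>, with derivatives replaced by their symbols.\<close>

definition mode_rhs :: "real \<Rightarrow> (real \<Rightarrow> real) \<Rightarrow> (real \<Rightarrow> real) \<Rightarrow> int \<Rightarrow> complex" where
  "mode_rhs \<nu> w v k = of_real \<nu> * ((dk k)\<^sup>2 * rc w k) - (1/2) * (dk k * rc (\<lambda>x. (w x + v x)\<^sup>2) k)"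

lemma Re_linear_combination:
  "z = of_real a * x + of_real b * y \<Longrightarrow> Re z = a * Re x + b * Re y"
  by simp

text \<open>Testing with \<open>trig a (- k)\<close> extracts \<open>Re (a * z)\<close> from the
  \<open>k\<close>-th equation; \<open>a = 1\<close> and \<open>a = - \<i>\<close> give the real and
  the imaginary part.\<close>

lemma solves_imp_modes:
  assumes s: "solves \<nu> T v w" and L: "\<And>t. t \<in> {0..T} \<Longrightarrow> in_L2 (w t) \<and> in_L2 (v t)" and t: "t \<in> {0..T}"
  shows "integrable (Leb t) (\<lambda>s. mode_rhs \<nu> (w s) (v s) k)"
    "rc (w t) k = (LINT s|Leb t. mode_rhs \<nu> (w s) (v s) k)"
proof -
  have F: "\<nu> * l2_inner (w s) (deriv (deriv (trig a (- k)))) + 1/2 * l2_inner (\<lambda>x. (w s x + v s x)\<^sup>2) (deriv (trig a (- k)))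
      = Re (a * mode_rhs \<nu> (w s) (v s) k)" if "s \<in> {0..T}" for a s
  proof -
    have "in_L2 (w s)" "in_L2 (\<lambda>x. w s x + v s x)" using L[OF that] by (auto intro: in_L2_add)
    then have 1: "l2_inner (w s) (trig b (- k)) = Re (b * rc (w s) k)"
      and 2: "l2_inner (\<lambda>x. (w s x + v s x)\<^sup>2) (trig b (- k)) = Re (b * rc (\<lambda>x. (w s x + v s x)\<^sup>2) k)" for b
      using rc_minus[of "\<lambda>x. (w s x + v s x)\<^sup>2" k] rc_minus[of "w s" k]
      by (simp_all only: l2_inner_trig in_L2_integrable in_L2_square_integrable complex_cnj_cnj)
    define P where "P = rc (\<lambda>x. (w s x + v s x)\<^sup>2) k"
    define Q where "Q = rc (w s) k"
    show ?thesis
      unfolding deriv_trig 1 2 mode_rhs_def dk_minus P_def[symmetric] Q_def[symmetric]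
      by (rule Re_linear_combination[symmetric]) (simp add: power2_eq_square algebra_simps)
  qed
  have main: "integrable (Leb t) (\<lambda>s. Re (a * mode_rhs \<nu> (w s) (v s) k))
     \<and> Re (a * rc (w t) k) = (LINT s|Leb t. Re (a * mode_rhs \<nu> (w s) (v s) k))" for a
  proof -
    define F where "F = (\<lambda>s. \<nu> * l2_inner (w s) (deriv (deriv (trig a (- k)))) + 1/2 * l2_inner (\<lambda>x. (w s x + v s x)\<^sup>2) (deriv (trig a (- k))))"
    have "integrable (Leb t) F \<and> l2_inner (w t) (trig a (- k)) = (LINT s|Leb t. F s)"
      using s t test_fun_trig[of a "- k"] unfolding solves_def Let_def F_def by blast
    moreover have "F s = Re (a * mode_rhs \<nu> (w s) (v s) k)" if "s \<in> space (Leb t)" for s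
      using F[of s a] that t by (simp add: F_def)
    moreover have "l2_inner (w t) (trig a (- k)) = Re (a * rc (w t) k)"
      using L[OF t] rc_minus[of "w t" k] by (simp add: l2_inner_trig in_L2_integrable)
    ultimately show ?thesis
      using Bochner_Integration.integrable_cong[of "Leb t" _ F "\<lambda>s. Re (a * mode_rhs \<nu> (w s) (v s) k)"]
        Bochner_Integration.integral_cong[of "Leb t" _ F "\<lambda>s. Re (a * mode_rhs \<nu> (w s) (v s) k)"] by auto
  qed
  let ?M = "Leb t"
  have re: "integrable ?M (\<lambda>s. Re (mode_rhs \<nu> (w s) (v s) k))"
    "Re (rc (w t) k) = (LINT s|?M. Re (mode_rhs \<nu> (w s) (v s) k))"
    using main[of 1] by auto
  have im: "integrable ?M (\<lambda>s. Im (mode_rhs \<nu> (w s) (v s) k))"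
    "Im (rc (w t) k) = (LINT s|?M. Im (mode_rhs \<nu> (w s) (v s) k))"
    using main[of "- \<i>"] by auto
  have eq: "mode_rhs \<nu> (w s) (v s) k = complex_of_real (Re (mode_rhs \<nu> (w s) (v s) k))
      + \<i> * complex_of_real (Im (mode_rhs \<nu> (w s) (v s) k))" for s
    by (rule complex_eq)
  show i: "integrable ?M (\<lambda>s. mode_rhs \<nu> (w s) (v s) k)"
    by (subst eq) (intro Bochner_Integration.integrable_add integrable_mult_right integrable_of_real re im)
  show "rc (w t) k = (LINT s|?M. mode_rhs \<nu> (w s) (v s) k)"
    by (rule complex_eqI) (simp_all add: re(2) im(2) integral_Re[OF i] integral_Im[OF i])
qed

text \<open>By Parseval's identity the tested equation is, at each time, a series over the modes.
  All derivatives fall on \<open>\<phi>\<close>, so Cauchy-Schwarz bounds the partial sums by one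
  constant and the limit may be taken under the time integral.\<close>

lemma modes_imp_solves:
  assumes L: "\<And>t. t \<in> {0..T} \<Longrightarrow> in_L2 (w t)" "\<And>t. t \<in> {0..T} \<Longrightarrow> in_L2 (\<lambda>x. (w t x + v t x)\<^sup>2)"
    and B: "\<And>t. t \<in> {0..T} \<Longrightarrow> nsq (rc (w t)) \<le> B" "\<And>t. t \<in> {0..T} \<Longrightarrow> nsq (rc (\<lambda>x. (w t x + v t x)\<^sup>2)) \<le> B"
    and modes: "\<And>t k. t \<in> {0..T} \<Longrightarrow> integrable (Leb t) (\<lambda>s. mode_rhs \<nu> (w s) (v s) k)"
      "\<And>t k. t \<in> {0..T} \<Longrightarrow> rc (w t) k = (LINT s|Leb t. mode_rhs \<nu> (w s) (v s) k)"
  shows "solves \<nu> T v w"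
  unfolding solves_def Let_def
proof (intro ballI allI impI)
  fix t \<phi> assume t: "t \<in> {0..T}" and \<phi>: "test_fun \<phi>"
  let ?M = "Leb t"
  define F where "F = (\<lambda>s. \<nu> * l2_inner (w s) (deriv (deriv \<phi>)) + 1/2 * l2_inner (\<lambda>x. (w s x + v s x)\<^sup>2) (deriv \<phi>))"
  define R where "R = (\<lambda>s k. mode_rhs \<nu> (w s) (v s) k)"
  have \<phi>1: "test_fun (deriv \<phi>)" and \<phi>2: "test_fun (deriv (deriv \<phi>))" using \<phi> test_fun_deriv by auto
  have trm: "Re (cnj (rc \<phi> k) * R s k) = \<nu> * Re (rc (w s) k * cnj (rc (deriv (deriv \<phi>)) k))
       + 1/2 * Re (rc (\<lambda>x. (w s x + v s x)\<^sup>2) k * cnj (rc (deriv \<phi>) k))" for s k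
    unfolding R_def mode_rhs_def rc_deriv[OF \<phi>] rc_deriv[OF \<phi>1]
    by (rule Re_linear_combination) (simp add: power2_eq_square ring_distribs ac_simps del: of_real_power of_real_add)
  have hs: "((\<lambda>k. Re (cnj (rc \<phi> k) * R s k)) has_sum F s) UNIV" if "s \<in> {0..T}" for s
    unfolding trm F_def
    by (intro has_sum_add has_sum_cmult_right l2_inner_has_sum L that test_fun_in_L2 \<phi>1 \<phi>2)
  define S where "S = (\<lambda>N s. \<Sum>k\<in>isym N. Re (cnj (rc \<phi> k) * R s k))"
  have Slim: "(\<lambda>N. S N s) \<longlonglongrightarrow> F s" if "s \<in> {0..T}" for s
    unfolding S_def by (rule has_sum_isym_tendsto[OF hs[OF that]])
  have iR: "integrable ?M (\<lambda>s. cnj (rc \<phi> k) * R s k)" for k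
    unfolding R_def by (intro integrable_mult_right modes t)
  have iS: "integrable ?M (S N)" for N
    unfolding S_def by (intro Bochner_Integration.integrable_sum integrable_Re iR)
  define C where "C = \<bar>\<nu>\<bar> * (sqrt B * sqrt (nsq (rc (deriv (deriv \<phi>))))) + sqrt B * sqrt (nsq (rc (deriv \<phi>)))"
  have cs: "(\<Sum>k\<in>isym N. \<bar>Re (a k * cnj (b k))\<bar>) \<le> sqrt B * sqrt (nsq b)"
    if "sqs a" "nsq a \<le> B" "sqs b" for N a b
  proof -
    have "(\<Sum>k\<in>isym N. \<bar>Re (a k * cnj (b k))\<bar>) \<le> (\<Sum>k\<in>isym N. cmod (a k) * cmod (b k))"
      by (intro sum_mono order_trans[OF abs_Re_le_cmod]) (simp add: norm_mult)
    also have "\<dots> \<le> sqrt (nsq a) * sqrt (nsq b)"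
      using sqs_cauchy_schwarz[OF that(1,3)] by (intro order_trans[OF finite_sum_le_infsum]) auto
    also have "\<dots> \<le> sqrt B * sqrt (nsq b)" using that(2) by (intro mult_right_mono) auto
    finally show ?thesis .
  qed
  have aux: "\<bar>\<nu> * a + 1/2 * b\<bar> \<le> \<bar>\<nu>\<bar> * \<bar>a\<bar> + \<bar>b\<bar>" for a b
    using abs_triangle_ineq[of "\<nu> * a" "1/2 * b"] unfolding abs_mult by simp
  have Sb: "norm (S N s) \<le> C" if s: "s \<in> {0..T}" for s N
  proof -
    have "\<bar>S N s\<bar> \<le> (\<Sum>k\<in>isym N. \<bar>Re (cnj (rc \<phi> k) * R s k)\<bar>)"
      unfolding S_def by (rule sum_abs)
    also have "\<dots> \<le> (\<Sum>k\<in>isym N. \<bar>\<nu>\<bar> * \<bar>Re (rc (w s) k * cnj (rc (deriv (deriv \<phi>)) k))\<bar>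
        + \<bar>Re (rc (\<lambda>x. (w s x + v s x)\<^sup>2) k * cnj (rc (deriv \<phi>) k))\<bar>)"
      unfolding trm
    proof (intro sum_mono)
      fix k
      show "\<bar>\<nu> * Re (rc (w s) k * cnj (rc (deriv (deriv \<phi>)) k)) + 1/2 * Re (rc (\<lambda>x. (w s x + v s x)\<^sup>2) k * cnj (rc (deriv \<phi>) k))\<bar>
        \<le> \<bar>\<nu>\<bar> * \<bar>Re (rc (w s) k * cnj (rc (deriv (deriv \<phi>)) k))\<bar> + \<bar>Re (rc (\<lambda>x. (w s x + v s x)\<^sup>2) k * cnj (rc (deriv \<phi>) k))\<bar>"
        by (rule aux)
    qed
    also have "\<dots> \<le> C"
      unfolding C_def sum.distrib sum_distrib_left[symmetric]
      by (intro add_mono mult_left_mono cs sqs_rc L B s test_fun_in_L2 \<phi>1 \<phi>2) auto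
    finally show ?thesis by simp
  qed
  have Fm: "F \<in> borel_measurable ?M"
  proof (rule borel_measurable_LIMSEQ_metric)
    show "S N \<in> borel_measurable ?M" for N using iS by (rule borel_measurable_integrable)
    show "(\<lambda>N. S N s) \<longlonglongrightarrow> F s" if "s \<in> space ?M" for s
      using that t by (intro Slim) simp
  qed
  have lim: "AE s in ?M. (\<lambda>N. S N s) \<longlonglongrightarrow> F s" using Slim t by (intro AE_I2) auto
  have bd: "AE s in ?M. norm (S N s) \<le> C" for N using Sb t by (intro AE_I2) auto
  have iC: "integrable ?M (\<lambda>s. C)" using integrable_continuous_Icc[of 0 t "\<lambda>s. C"] by simp
  have Sm: "S N \<in> borel_measurable ?M" for N using iS by (rule borel_measurable_integrable)
  have iF: "integrable ?M F"
    by (rule integrable_dominated_convergence[OF Fm Sm iC lim bd])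
  have "(\<lambda>N. LINT s|?M. S N s) \<longlonglongrightarrow> (LINT s|?M. F s)"
    by (rule integral_dominated_convergence[OF Fm Sm iC lim bd])
  moreover have "(LINT s|?M. S N s) = (\<Sum>k\<in>isym N. Re (rc (w t) k * cnj (rc \<phi> k)))" for N
  proof -
    have "(LINT s|?M. S N s) = (\<Sum>k\<in>isym N. LINT s|?M. Re (cnj (rc \<phi> k) * R s k))"
      unfolding S_def by (intro Bochner_Integration.integral_sum integrable_Re iR)
    also have "\<dots> = (\<Sum>k\<in>isym N. Re (cnj (rc \<phi> k) * rc (w t) k))"
      using modes(2)[OF t] by (intro sum.cong refl) (subst integral_Re[OF iR], simp add: R_def)
    finally show ?thesis by (simp add: mult.commute)
  qed
  moreover have "(\<lambda>N. \<Sum>k\<in>isym N. Re (rc (w t) k * cnj (rc \<phi> k))) \<longlonglongrightarrow> l2_inner (w t) \<phi>"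
    by (intro has_sum_isym_tendsto l2_inner_has_sum L t test_fun_in_L2 \<phi>)
  ultimately have "l2_inner (w t) \<phi> = (LINT s|?M. F s)" by (simp add: LIMSEQ_unique)
  then show "integrable ?M (\<lambda>s. \<nu> * l2_inner (w s) (deriv (deriv \<phi>)) + 1/2 * l2_inner (\<lambda>x. (w s x + v s x)\<^sup>2) (deriv \<phi>))
      \<and> l2_inner (w t) \<phi> = (LINT s|?M. \<nu> * l2_inner (w s) (deriv (deriv \<phi>)) + 1/2 * l2_inner (\<lambda>x. (w s x + v s x)\<^sup>2) (deriv \<phi>))"
    using iF by (simp add: F_def)
qed

section \<open>Products in Sobolev spaces\<close>

text \<open>Inverse of the weighting in \<open>toX\<close>; at \<open>k = 0\<close> the convention \<open>0 / 0 = 0\<close> gives the right value.\<close>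

definition uc :: "nat \<Rightarrow> hseq \<Rightarrow> int \<Rightarrow> complex" where
  "uc n x k = cf x k / of_real (lam k ^ n)"

text \<open>The squared H^1 norm of the function that \<open>x\<close> represents through the
  weighting of order \<open>n\<close>, not a norm of the sequence \<open>x\<close> itself.\<close>

definition E1 :: "nat \<Rightarrow> hseq \<Rightarrow> real" where
  "E1 n x = nsq (\<lambda>k. dk k * uc n x k)"

definition l1 :: "(int \<Rightarrow> complex) \<Rightarrow> bool" where
  "l1 a \<longleftrightarrow> (\<lambda>k. cmod (a k)) summable_on UNIV"

definition nl1 :: "(int \<Rightarrow> complex) \<Rightarrow> real" where
  "nl1 a = (\<Sum>\<^sub>\<infinity>k. cmod (a k))"

text \<open>Convolution of the moduli: the majorant of \<open>conv\<close> on which all estimates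
  are made.\<close>

definition cnv :: "(int \<Rightarrow> complex) \<Rightarrow> (int \<Rightarrow> complex) \<Rightarrow> int \<Rightarrow> real" where
  "cnv a b k = (\<Sum>\<^sub>\<infinity>j. cmod (a j) * cmod (b (k - j)))"

lemma nl1_nonneg [simp]: "0 \<le> nl1 a"
  unfolding nl1_def by (intro infsum_nonneg) auto

lemma uc_0 [simp]: "uc n x 0 = 0" by (simp add: uc_def)

lemma uc_minus: "uc n x (- k) = cnj (uc n x k)" by (simp add: uc_def)

lemma uc_add: "uc n (x + y) k = uc n x k + uc n y k" by (simp add: uc_def cf_plus add_divide_distrib)

lemma uc_diff: "uc n (x - y) k = uc n x k - uc n y k" by (simp add: uc_def cf_diff diff_divide_distrib)

lemma uc_scaleR: "uc n (c *\<^sub>R x) k = of_real c * uc n x k" by (simp add: uc_def cf_scaleR scaleR_conv_of_real)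

lemma lam_pow_uc: "of_real (lam k ^ n) * uc n x k = cf x k"
  using lam_ge_1[of k] by (cases "k = 0") (auto simp: uc_def)

lemma norm_uc_le: "cmod (uc n x k) \<le> cmod (cf x k)"
proof (cases "k = 0")
  case False
  then have "1 * cmod (uc n x k) \<le> lam k ^ n * cmod (uc n x k)"
    by (intro mult_right_mono lam_pow_ge_1) auto
  also have "\<dots> = cmod (cf x k)" using lam_pow_uc[of k n x]
    by (metis norm_mult norm_of_real abs_of_nonneg lam_nonneg zero_le_power)
  finally show ?thesis by simp
qed simp

lemma norm_dk_uc_le: "cmod (uc n x k) \<le> cmod (dk k * uc n x k)"
  using lam_ge_1[of k] by (cases "k = 0") (auto simp: norm_mult mult_le_cancel_right1)

lemma norm_dk_uc_le_cf:
  assumes "1 \<le> n" shows "cmod (dk k * uc n x k) \<le> cmod (cf x k)"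
proof (cases "k = 0")
  case False
  have "lam k ^ 1 \<le> lam k ^ n" using lam_ge_1[OF False] assms by (rule power_increasing[rotated])
  then have "lam k * cmod (uc n x k) \<le> lam k ^ n * cmod (uc n x k)" by (intro mult_right_mono) auto
  also have "\<dots> = cmod (cf x k)" using lam_pow_uc[of k n x]
    by (metis norm_mult norm_of_real abs_of_nonneg lam_nonneg zero_le_power)
  finally show ?thesis by (simp add: norm_mult)
qed simp

lemma sqs_uc [simp]: "sqs (uc n x)"
  by (rule sqs_comparison(1)[OF sqs_cf norm_uc_le])

lemma sqs_dk_uc: "1 \<le> n \<Longrightarrow> sqs (\<lambda>k. dk k * uc n x k)"
  by (rule sqs_comparison(1)[OF sqs_cf norm_dk_uc_le_cf])

lemma E1_le: "1 \<le> n \<Longrightarrow> E1 n x \<le> (norm x)\<^sup>2"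
  unfolding E1_def norm_hseq_sq by (rule sqs_comparison(2)[OF sqs_cf norm_dk_uc_le_cf])

lemma E1_nonneg [simp]: "0 \<le> E1 n x" by (simp add: E1_def)

lemma nsq_uc_le: "nsq (uc n x) \<le> (norm x)\<^sup>2"
  unfolding norm_hseq_sq by (rule sqs_comparison(2)[OF sqs_cf norm_uc_le])

lemma E1_add: "1 \<le> n \<Longrightarrow> E1 n (x + y) \<le> 2 * E1 n x + 2 * E1 n y"
  unfolding E1_def uc_add distrib_left by (intro sqs_add sqs_dk_uc)

text \<open>The telescoping bound \<open>2 / (2 \<pi> N)\<^sup>2 \<le> 1 / (N (N + 1))\<close> keeps the sum of \<open>1 / (2 \<pi> k)\<^sup>2\<close> below 1.\<close>

lemma inverse_lam_square_sum: "sqs (\<lambda>k. of_real (inverse (lam k)))" "nsq (\<lambda>k. of_real (inverse (lam k))) \<le> 1"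
proof -
  have "(\<Sum>k\<in>isym N. (cmod (of_real (inverse (lam k))))\<^sup>2) \<le> 1 - 1 / (real N + 1)" for N
  proof (induction N)
    case 0
    then show ?case by (simp add: isym_def)
  next
    case (Suc N)
    define m where "m = int N + 1"
    have "isym (Suc N) = insert m (insert (- m) (isym N))" by (auto simp: isym_def m_def)
    moreover have "m \<notin> insert (- m) (isym N)" "- m \<notin> isym N" by (auto simp: isym_def m_def)
    ultimately have "(\<Sum>k\<in>isym (Suc N). (cmod (of_real (inverse (lam k))))\<^sup>2)
        = 2 * (inverse (lam m))\<^sup>2 + (\<Sum>k\<in>isym N. (cmod (of_real (inverse (lam k))))\<^sup>2)"
      by (simp del: of_real_inverse)
    also have "2 * (inverse (lam m))\<^sup>2 \<le> 1 / (real N + 1) - 1 / (real N + 2)"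
    proof -
      have l: "lam m = 2 * pi * (real N + 1)" by (simp add: lam_def m_def)
      have "6 * (real N + 1) \<le> lam m" unfolding l using pi_gt3 by (intro mult_right_mono) auto
      then have "(6 * (real N + 1))\<^sup>2 \<le> (lam m)\<^sup>2" by (intro power_mono) auto
      then have "2 / (lam m)\<^sup>2 \<le> 2 / (6 * (real N + 1))\<^sup>2" by (intro divide_left_mono) (auto simp: l)
      also have "\<dots> \<le> 1 / ((real N + 1) * (real N + 2))"
        by (simp add: divide_simps) (simp add: power2_eq_square algebra_simps)
      also have "\<dots> = 1 / (real N + 1) - 1 / (real N + 2)" by (simp add: field_simps)
      finally show ?thesis by (simp add: power_inverse divide_inverse)
    qed
    finally show ?case using Suc by (simp add: add.commute)
  qed
  then have "(\<Sum>k\<in>isym N. (cmod (of_real (inverse (lam k))))\<^sup>2) \<le> 1" for N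
    by (rule order_trans) simp
  then show "sqs (\<lambda>k. of_real (inverse (lam k)))" "nsq (\<lambda>k. of_real (inverse (lam k))) \<le> 1"
    using sqsI_isym[of "\<lambda>k. of_real (inverse (lam k))" 1] by auto
qed

text \<open>Cauchy-Schwarz with the factors \<open>1 / lam k\<close> and \<open>lam k\<close>: the
  embedding of H^1 into the absolutely convergent Fourier series. The constant is 1 because the
  reciprocals have l^2 norm at most 1.\<close>

lemma l1_uc:
  assumes "1 \<le> n" shows "l1 (uc n x)" "nl1 (uc n x) \<le> sqrt (E1 n x)"
proof -
  have eq: "cmod (of_real (inverse (lam k))) * cmod (dk k * uc n x k) = cmod (uc n x k)" for k
    using lam_ge_1[of k] by (cases "k = 0") (auto simp: norm_mult simp del: of_real_inverse)
  note cs = sqs_cauchy_schwarz[OF inverse_lam_square_sum(1) sqs_dk_uc[OF assms, of x], unfolded eq]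
  show "l1 (uc n x)" using cs(1) by (simp add: l1_def)
  have "sqrt (nsq (\<lambda>k. of_real (inverse (lam k)))) * sqrt (E1 n x) \<le> 1 * sqrt (E1 n x)"
    using inverse_lam_square_sum(2) by (intro mult_right_mono) auto
  then show "nl1 (uc n x) \<le> sqrt (E1 n x)" using cs(2) by (simp add: nl1_def E1_def)
qed

lemma has_sum_sum:
  fixes f :: "'b \<Rightarrow> 'a \<Rightarrow> real"
  assumes "finite F" "\<And>k. k \<in> F \<Longrightarrow> (f k has_sum s k) A"
  shows "((\<lambda>x. \<Sum>k\<in>F. f k x) has_sum (\<Sum>k\<in>F. s k)) A"
  using assms by (induction F) (auto intro!: has_sum_add)

section \<open>Convolutions of coefficient sequences\<close>

lemma bij_reflect: "bij (\<lambda>j. k - j)" for k :: int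
  by (rule o_bij[of "\<lambda>j. k - j"]) auto

lemma sqs_shift: "sqs b \<Longrightarrow> sqs (\<lambda>j. b (k - j))"
  by (rule sqs_reindex(1)[OF _ bij_reflect])

lemma cnv_commute: "cnv a b k = cnv b a k"
  unfolding cnv_def
  by (subst infsum_reindex_bij_betw[OF bij_reflect[of k], symmetric]) (simp add: mult.commute)

lemma conv_commute: "conv a b k = conv b a k"
  unfolding conv_def
  by (subst infsum_reindex_bij_betw[OF bij_reflect[of k], symmetric]) (simp add: mult.commute)

lemma cnv_summable: "sqs a \<Longrightarrow> sqs b \<Longrightarrow> (\<lambda>j. cmod (a j) * cmod (b (k - j))) summable_on UNIV"
  by (rule sqs_cauchy_schwarz(1)[OF _ sqs_shift])

lemma conv_summable: "sqs a \<Longrightarrow> sqs b \<Longrightarrow> (\<lambda>j. a j * b (k - j)) summable_on UNIV"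
  by (rule sqs_mult_abs_summable(2)[OF _ sqs_shift])

lemma norm_conv_le: "sqs a \<Longrightarrow> sqs b \<Longrightarrow> cmod (conv a b k) \<le> cnv a b k"
  unfolding conv_def cnv_def
  using norm_infsum_bound[of "\<lambda>j. a j * b (k - j)" UNIV] cnv_summable[of a b k] by (simp add: norm_mult)

lemma cnv_nonneg [simp]: "0 \<le> cnv a b k"
  unfolding cnv_def by (intro infsum_nonneg) auto

lemma conv_add_left: "sqs a \<Longrightarrow> sqs b \<Longrightarrow> sqs c \<Longrightarrow> conv (\<lambda>k. a k + b k) c k = conv a c k + conv b c k"
  unfolding conv_def distrib_right by (intro infsum_add conv_summable)

lemma conv_add_right: "sqs a \<Longrightarrow> sqs b \<Longrightarrow> sqs c \<Longrightarrow> conv c (\<lambda>k. a k + b k) k = conv c a k + conv c b k"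
  unfolding conv_def distrib_left by (intro infsum_add conv_summable)

lemma conv_cmult_left: "conv (\<lambda>k. c * a k) b k = c * conv a b k"
  unfolding conv_def mult.assoc by (rule infsum_cmult_right')

lemma conv_cmult_right: "conv a (\<lambda>k. c * b k) k = c * conv a b k"
  unfolding conv_def mult.left_commute[of _ c] by (rule infsum_cmult_right')

lemma conv_minus:
  assumes "\<And>k. a (- k) = cnj (a k)" "\<And>k. b (- k) = cnj (b k)"
  shows "conv a b (- k) = cnj (conv a b k)"
proof -
  have "conv a b (- k) = (\<Sum>\<^sub>\<infinity>j. a (- j) * b (- k - - j))"
    unfolding conv_def using infsum_reindex_bij_betw[OF bij_reflect[of 0], of "\<lambda>j. a j * b (- k - j)"] by simp
  also have "\<dots> = (\<Sum>\<^sub>\<infinity>j. cnj (a j * b (k - j)))"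
  proof (rule infsum_cong)
    fix j
    have "b (- k - - j) = cnj (b (k - j))" using assms(2)[of "k - j"] by simp
    then show "a (- j) * b (- k - - j) = cnj (a j * b (k - j))" using assms(1)[of j] by simp
  qed
  finally show ?thesis by (simp only: conv_def infsum_cnj)
qed

text \<open>Splits \<open>\<bar>a j\<bar> = \<surd>\<bar>a j\<bar> \<surd>\<bar>a j\<bar>\<close> in the Cauchy-Schwarz inequality for each \<open>k\<close>.\<close>

lemma young:
  assumes a: "l1 a" "sqs a" and b: "sqs b"
  shows "sqs (\<lambda>k. of_real (cnv a b k))" "nsq (\<lambda>k. of_real (cnv a b k)) \<le> (nl1 a)\<^sup>2 * nsq b"
proof -
  define r where "r = (\<lambda>j. complex_of_real (sqrt (cmod (a j))))"
  have rr: "(cmod (r j))\<^sup>2 = cmod (a j)" for j by (simp add: r_def)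
  have sr: "sqs r" "nsq r = nl1 a" using a by (auto simp: sqs_def nsq_def rr l1_def nl1_def)
  have sab: "(\<lambda>j. cmod (a j) * (cmod (b (k - j)))\<^sup>2) summable_on UNIV" for k
  proof (rule summable_on_comparison_test[OF summable_on_cmult_left[OF a(1)[unfolded l1_def], of "nsq b"]])
    fix j
    have "(cmod (b (k - j)))\<^sup>2 \<le> nsq b" using sqs_sum_le[OF b, of "{k - j}"] by simp
    then show "cmod (a j) * (cmod (b (k - j)))\<^sup>2 \<le> cmod (a j) * nsq b"
      by (simp add: mult_left_mono)
  qed auto
  have cs: "(cnv a b k)\<^sup>2 \<le> nl1 a * (\<Sum>\<^sub>\<infinity>j. cmod (a j) * (cmod (b (k - j)))\<^sup>2)" for k
  proof -
    have eq: "(cmod (r j * b (k - j)))\<^sup>2 = cmod (a j) * (cmod (b (k - j)))\<^sup>2" for j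
      by (simp add: norm_mult power_mult_distrib rr)
    have s2: "sqs (\<lambda>j. r j * b (k - j))" unfolding sqs_def eq by (rule sab)
    have eq2: "cmod (r j) * cmod (r j * b (k - j)) = cmod (a j) * cmod (b (k - j))" for j
      using rr[of j] by (simp add: norm_mult power2_eq_square)
    have "cnv a b k \<le> sqrt (nsq r) * sqrt (nsq (\<lambda>j. r j * b (k - j)))"
      using sqs_cauchy_schwarz(2)[OF sr(1) s2] by (simp only: eq2 cnv_def)
    then have "(cnv a b k)\<^sup>2 \<le> (sqrt (nsq r) * sqrt (nsq (\<lambda>j. r j * b (k - j))))\<^sup>2"
      by (intro power_mono) auto
    also have "\<dots> = nl1 a * (\<Sum>\<^sub>\<infinity>j. cmod (a j) * (cmod (b (k - j)))\<^sup>2)"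
      by (simp add: power_mult_distrib sr(2)) (simp add: nsq_def eq)
    finally show ?thesis .
  qed
  have bd: "(\<Sum>k\<in>F. (cmod (of_real (cnv a b k)))\<^sup>2) \<le> (nl1 a)\<^sup>2 * nsq b" if F: "finite F" for F
  proof -
    have "(\<Sum>k\<in>F. (cmod (complex_of_real (cnv a b k)))\<^sup>2) \<le> (\<Sum>k\<in>F. nl1 a * (\<Sum>\<^sub>\<infinity>j. cmod (a j) * (cmod (b (k - j)))\<^sup>2))"
      using cs by (intro sum_mono) simp
    \<comment> \<open>Only finitely many \<open>k\<close> are summed, so exchanging the two sums is
      finite additivity.\<close>
    also have "\<dots> = nl1 a * (\<Sum>\<^sub>\<infinity>j. \<Sum>k\<in>F. cmod (a j) * (cmod (b (k - j)))\<^sup>2)"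
      using has_sum_sum[OF F, where f = "\<lambda>k j. cmod (a j) * (cmod (b (k - j)))\<^sup>2"
          and s = "\<lambda>k. \<Sum>\<^sub>\<infinity>j. cmod (a j) * (cmod (b (k - j)))\<^sup>2" and A = UNIV] sab
      by (simp add: sum_distrib_left infsumI)
    also have "\<dots> \<le> nl1 a * (\<Sum>\<^sub>\<infinity>j. cmod (a j) * nsq b)"
    proof (rule mult_left_mono, rule infsum_mono)
      show "(\<lambda>j. \<Sum>k\<in>F. cmod (a j) * (cmod (b (k - j)))\<^sup>2) summable_on UNIV"
        using has_sum_sum[OF F, where f = "\<lambda>k j. cmod (a j) * (cmod (b (k - j)))\<^sup>2"
          and s = "\<lambda>k. \<Sum>\<^sub>\<infinity>j. cmod (a j) * (cmod (b (k - j)))\<^sup>2" and A = UNIV] sab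
        by (auto simp: summable_on_def)
      show "(\<lambda>j. cmod (a j) * nsq b) summable_on UNIV"
        by (rule summable_on_cmult_left[OF a(1)[unfolded l1_def]])
      show "(\<Sum>k\<in>F. cmod (a j) * (cmod (b (k - j)))\<^sup>2) \<le> cmod (a j) * nsq b" for j
      proof -
        have "(\<Sum>k\<in>F. (cmod (b (k - j)))\<^sup>2) = (\<Sum>k\<in>(\<lambda>k. k - j) ` F. (cmod (b k))\<^sup>2)"
          by (subst sum.reindex) (auto simp: inj_on_def)
        also have "\<dots> \<le> nsq b" using F by (intro sqs_sum_le b) auto
        finally show ?thesis by (simp add: mult_left_mono flip: sum_distrib_left)
      qed
    qed simp
    also have "\<dots> = (nl1 a)\<^sup>2 * nsq b"
      by (simp add: infsum_cmult_left' nl1_def power2_eq_square)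
    finally show ?thesis .
  qed
  show "sqs (\<lambda>k. of_real (cnv a b k))" "nsq (\<lambda>k. of_real (cnv a b k)) \<le> (nl1 a)\<^sup>2 * nsq b"
    using sqsI[OF bd] by auto
qed

lemma young_conv:
  assumes "l1 a" "sqs a" "sqs b"
  shows "sqs (conv a b)" "nsq (conv a b) \<le> (nl1 a)\<^sup>2 * nsq b"
proof -
  have le: "cmod (conv a b k) \<le> cmod (of_real (cnv a b k))" for k
    using norm_conv_le[OF assms(2,3), of k] by simp
  show "sqs (conv a b)" by (rule sqs_comparison(1)[OF young(1)[OF assms] le])
  show "nsq (conv a b) \<le> (nl1 a)\<^sup>2 * nsq b"
    using sqs_comparison(2)[OF young(1)[OF assms] le] young(2)[OF assms] by simp
qed

lemma lam_pow_le: "lam k ^ n \<le> 2 ^ n * (lam j ^ n + lam (k - j) ^ n)"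
proof -
  have "lam k \<le> lam j + lam (k - j)"
    unfolding lam_def distrib_left[symmetric] by (intro mult_left_mono) auto
  also have "\<dots> \<le> 2 * max (lam j) (lam (k - j))" by simp
  finally have "lam k ^ n \<le> (2 * max (lam j) (lam (k - j))) ^ n" by (intro power_mono) auto
  also have "\<dots> \<le> 2 ^ n * (lam j ^ n + lam (k - j) ^ n)"
    by (auto simp: power_mult_distrib max_def)
  finally show ?thesis .
qed

text \<open>\<open>4 ^ n\<close> is the square of the factor \<open>2 ^ n\<close> in
  \<open>lam_pow_le\<close>; of the remaining 4, one factor 2 comes from squaring a sum of two terms
  and the other from their contributing equally.\<close>

definition conv_bound :: "nat \<Rightarrow> real" where "conv_bound n = 4 * 4 ^ n"

text \<open>Up to \<open>2 ^ n\<close>, the weight at \<open>k\<close> is carried by the index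
  \<open>j\<close> or by \<open>k - j\<close>. The factor that carries it stays in l^2, while the
  other is measured in l^1, hence by \<open>E1\<close>. As only one factor per term bears
  \<open>n\<close> derivatives, the later Gronwall inequality is linear in the squared H^n
  norm.\<close>

lemma weighted_conv:
  fixes x y :: hseq
  assumes n: "1 \<le> n"
  defines "a \<equiv> uc n x" and "b \<equiv> uc n y"
  shows "sqs (\<lambda>k. of_real (lam k ^ n) * conv a b k)"
    "nsq (\<lambda>k. of_real (lam k ^ n) * conv a b k) \<le> 2 * 4 ^ n * (E1 n y * (norm x)\<^sup>2 + E1 n x * (norm y)\<^sup>2)"
proof -
  have sa: "l1 a" "sqs a" "l1 b" "sqs b" using l1_uc[OF n] by (auto simp: a_def b_def)
  have aw: "cmod (cf x j) = lam j ^ n * cmod (a j)" "cmod (cf y j) = lam j ^ n * cmod (b j)" for j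
    using lam_pow_uc[of j n x] lam_pow_uc[of j n y]
    by (metis (no_types) a_def b_def norm_mult norm_of_real abs_of_nonneg lam_nonneg zero_le_power)+
  have le: "cmod (of_real (lam k ^ n) * conv a b k)
      \<le> cmod (of_real (2 ^ n) * (of_real (cnv b (cf x) k) + of_real (cnv a (cf y) k)))" for k
  proof -
    have s1: "(\<lambda>j. cmod (cf x j) * cmod (b (k - j))) summable_on UNIV"
      and s2: "(\<lambda>j. cmod (a j) * cmod (cf y (k - j))) summable_on UNIV"
      using sa by (auto intro: cnv_summable)
    have "cmod (of_real (lam k ^ n) * conv a b k) \<le> lam k ^ n * cnv a b k"
      using norm_conv_le[OF sa(2,4), of k] by (simp add: norm_mult norm_power mult_left_mono)
    also have "\<dots> = (\<Sum>\<^sub>\<infinity>j. lam k ^ n * (cmod (a j) * cmod (b (k - j))))"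
      by (simp add: cnv_def infsum_cmult_right')
    also have "\<dots> \<le> (\<Sum>\<^sub>\<infinity>j. 2 ^ n * (cmod (cf x j) * cmod (b (k - j)) + cmod (a j) * cmod (cf y (k - j))))"
    proof (rule infsum_mono)
      show "(\<lambda>j. lam k ^ n * (cmod (a j) * cmod (b (k - j)))) summable_on UNIV"
        using sa by (intro summable_on_cmult_right cnv_summable)
      show "(\<lambda>j. 2 ^ n * (cmod (cf x j) * cmod (b (k - j)) + cmod (a j) * cmod (cf y (k - j)))) summable_on UNIV"
        by (intro summable_on_cmult_right summable_on_add s1 s2)
      fix j
      have "lam k ^ n * (cmod (a j) * cmod (b (k - j)))
          \<le> (2 ^ n * (lam j ^ n + lam (k - j) ^ n)) * (cmod (a j) * cmod (b (k - j)))"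
        by (intro mult_right_mono lam_pow_le) auto
      then show "lam k ^ n * (cmod (a j) * cmod (b (k - j)))
          \<le> 2 ^ n * (cmod (cf x j) * cmod (b (k - j)) + cmod (a j) * cmod (cf y (k - j)))"
        by (simp add: aw algebra_simps)
    qed
    also have "\<dots> = 2 ^ n * (cnv (cf x) b k + cnv a (cf y) k)"
      unfolding cnv_def by (simp add: infsum_cmult_right' infsum_add[OF s1 s2])
    also have "\<dots> = cmod (of_real (2 ^ n * (cnv b (cf x) k + cnv a (cf y) k)))"
      unfolding norm_of_real cnv_commute[of "cf x" b] by simp
    finally show ?thesis by simp
  qed
  have y1: "sqs (\<lambda>k. of_real (cnv b (cf x) k))" "nsq (\<lambda>k. of_real (cnv b (cf x) k)) \<le> (nl1 b)\<^sup>2 * nsq (cf x)"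
    and y2: "sqs (\<lambda>k. of_real (cnv a (cf y) k))" "nsq (\<lambda>k. of_real (cnv a (cf y) k)) \<le> (nl1 a)\<^sup>2 * nsq (cf y)"
    using young[OF sa(3,4) sqs_cf[of x]] young[OF sa(1,2) sqs_cf[of y]] by auto
  note s = sqs_cmult[OF sqs_add(1)[OF y1(1) y2(1)], of "of_real (2 ^ n)"]
  show "sqs (\<lambda>k. of_real (lam k ^ n) * conv a b k)" by (rule sqs_comparison(1)[OF s(1) le])
  have sq: "(nl1 (uc n z))\<^sup>2 \<le> E1 n z" for z
    using power_mono[OF l1_uc(2)[OF n, of z], of 2] by simp
  have "nsq (\<lambda>k. of_real (lam k ^ n) * conv a b k)
      \<le> (cmod (of_real (2 ^ n)))\<^sup>2 * nsq (\<lambda>k. of_real (cnv b (cf x) k) + of_real (cnv a (cf y) k))"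
    using sqs_comparison(2)[OF s(1) le] unfolding s(2) .
  also have "(cmod (of_real (2 ^ n)))\<^sup>2 = (4::real) ^ n"
  proof -
    have "(cmod (of_real (2 ^ n)))\<^sup>2 = ((2::real) ^ n)\<^sup>2" by (simp add: norm_power)
    also have "\<dots> = 4 ^ n" by (simp add: power2_eq_square flip: power_mult_distrib)
    finally show ?thesis .
  qed
  also have "4 ^ n * nsq (\<lambda>k. of_real (cnv b (cf x) k) + of_real (cnv a (cf y) k))
      \<le> 4 ^ n * (2 * ((nl1 b)\<^sup>2 * nsq (cf x)) + 2 * ((nl1 a)\<^sup>2 * nsq (cf y)))"
    using sqs_add(2)[OF y1(1) y2(1)] y1(2) y2(2) by (intro mult_left_mono) auto
  also have "\<dots> \<le> 4 ^ n * (2 * (E1 n y * (norm x)\<^sup>2) + 2 * (E1 n x * (norm y)\<^sup>2))"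
    unfolding norm_hseq_sq a_def b_def by (intro mult_left_mono add_mono mult_right_mono sq) auto
  finally show "nsq (\<lambda>k. of_real (lam k ^ n) * conv a b k) \<le> 2 * 4 ^ n * (E1 n y * (norm x)\<^sup>2 + E1 n x * (norm y)\<^sup>2)"
    by (simp add: algebra_simps)
qed

text \<open>The product of two elements of \<open>H\<^sup>n\<close>. The weight at \<open>k = 0\<close> removes its mean, which the derivative of
  the product does not see.\<close>

definition Bx :: "nat \<Rightarrow> hseq \<Rightarrow> hseq \<Rightarrow> hseq" where
  "Bx n x y = Hseq (\<lambda>k. of_real (lam k ^ n) * conv (uc n x) (uc n y) k)"

lemma cf_Bx:
  assumes "1 \<le> n" shows "cf (Bx n x y) k = of_real (lam k ^ n) * conv (uc n x) (uc n y) k"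
proof -
  have "cf (Bx n x y) = (\<lambda>k. of_real (lam k ^ n) * conv (uc n x) (uc n y) k)"
    unfolding Bx_def using assms
    by (intro cf_Hseq weighted_conv) (simp_all add: conv_minus uc_minus)
  then show ?thesis by simp
qed

lemma norm_Bx_sq:
  assumes "1 \<le> n"
  shows "(norm (Bx n x y))\<^sup>2 \<le> 2 * 4 ^ n * (E1 n y * (norm x)\<^sup>2 + E1 n x * (norm y)\<^sup>2)"
proof -
  have "cf (Bx n x y) = (\<lambda>k. of_real (lam k ^ n) * conv (uc n x) (uc n y) k)"
    using cf_Bx[OF assms] by blast
  then show ?thesis unfolding norm_hseq_sq[of "Bx n x y"] using weighted_conv(2)[OF assms, of x y] by simp
qed

lemma norm_Bx_diag_sq: "1 \<le> n \<Longrightarrow> (norm (Bx n x x))\<^sup>2 \<le> conv_bound n * E1 n x * (norm x)\<^sup>2"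
  using norm_Bx_sq[of n x x] by (simp add: conv_bound_def)

lemma norm_Bx_le:
  assumes "1 \<le> n" shows "norm (Bx n x y) \<le> sqrt (conv_bound n) * norm x * norm y"
proof (rule power2_le_imp_le)
  have "(norm (Bx n x y))\<^sup>2 \<le> 2 * 4 ^ n * (E1 n y * (norm x)\<^sup>2 + E1 n x * (norm y)\<^sup>2)"
    by (rule norm_Bx_sq[OF assms])
  also have "\<dots> \<le> 2 * 4 ^ n * ((norm y)\<^sup>2 * (norm x)\<^sup>2 + (norm x)\<^sup>2 * (norm y)\<^sup>2)"
    by (intro mult_left_mono add_mono mult_right_mono E1_le assms) auto
  also have "\<dots> = (sqrt (conv_bound n) * norm x * norm y)\<^sup>2"
    by (simp add: power_mult_distrib conv_bound_def)
  finally show "(norm (Bx n x y))\<^sup>2 \<le> (sqrt (conv_bound n) * norm x * norm y)\<^sup>2" .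
qed (simp add: conv_bound_def)

text \<open>The mixed terms cancel by commutativity of the convolution. With
  \<open>norm_Bx_le\<close> this makes squaring locally Lipschitz.\<close>

lemma Bx_diff_squares:
  assumes n: "1 \<le> n" shows "Bx n x x - Bx n y y = Bx n (x - y) (x + y)"
proof (rule hseq_eqI)
  fix k
  let ?a = "uc n x" and ?b = "uc n y"
  have u: "uc n (x - y) = (\<lambda>k. ?a k + (- 1) * ?b k)" "uc n (x + y) = (\<lambda>k. ?a k + ?b k)"
    by (auto simp: uc_add uc_diff)
  have sb: "sqs (\<lambda>k. (- 1) * ?b k)" by (rule sqs_cmult) simp
  have "conv (uc n (x - y)) (uc n (x + y)) k = conv ?a ?a k - conv ?b ?b k"
    unfolding u using sb
    by (subst conv_add_left) (auto simp: conv_add_right conv_cmult_left[of "- 1", simplified] conv_commute[of ?b ?a] sqs_add)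
  then show "cf (Bx n x x - Bx n y y) k = cf (Bx n (x - y) (x + y)) k"
    by (simp add: cf_diff cf_Bx[OF n] right_diff_distrib)
qed

lemma Bx_scaleR_diag:
  assumes n: "1 \<le> n" shows "Bx n (c *\<^sub>R x) (c *\<^sub>R x) = c\<^sup>2 *\<^sub>R Bx n x x"
proof (rule hseq_eqI)
  fix k
  have "uc n (c *\<^sub>R x) = (\<lambda>k. of_real c * uc n x k)" by (auto simp: uc_scaleR)
  then show "cf (Bx n (c *\<^sub>R x) (c *\<^sub>R x)) k = cf (c\<^sup>2 *\<^sub>R Bx n x x) k"
    by (simp add: cf_Bx[OF n] cf_scaleR conv_cmult_left conv_cmult_right scaleR_conv_of_real power2_eq_square)
qed

text \<open>With \<open>m = -k\<close> and \<open>l = k - j\<close> the summand is \<open>\<partial>a(m) a(j) a(l)\<close> over \<open>m + j + l = 0\<close>. Moving the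
  derivative to \<open>j\<close> or to \<open>l\<close> permutes the indices, and the three sums add up to zero.\<close>

lemma cubic_cancellation:
  assumes a: "l1 a" "sqs a" "sqs (\<lambda>k. dk k * a k)" and sym: "\<And>k. a (- k) = cnj (a k)"
  shows "(\<Sum>\<^sub>\<infinity>k. cnj (dk k * a k) * conv a a k) = 0"
proof -
  define H where "H = (\<lambda>(k, j). cnj (dk k * a k) * (a j * a (k - j)))"
  \<comment> \<open>\<open>\<sigma>\<close> exchanges \<open>m\<close> with \<open>j\<close>, and
    \<open>\<tau>\<close> exchanges \<open>m\<close> with \<open>l\<close>; both are
    involutions.\<close>
  define \<sigma> where "\<sigma> = (\<lambda>(k :: int, j :: int). (- j, - k))"
  define \<tau> where "\<tau> = (\<lambda>(k :: int, j :: int). (j - k, j))"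
  have bij: "bij \<sigma>" "bij \<tau>"
    by (rule o_bij[of \<sigma>], auto simp: \<sigma>_def fun_eq_iff)
      (rule o_bij[of \<tau>], auto simp: \<tau>_def fun_eq_iff)
  \<comment> \<open>The rearrangements rest on absolute summability over pairs. It comes from
    Cauchy-Schwarz between \<open>dk k * a k\<close> and the convolution of moduli, which Young's
    inequality places in l^2.\<close>
  have absH: "(\<lambda>p. norm (H p)) summable_on (UNIV \<times> UNIV)"
  proof (rule Infinite_Sum.abs_summable_on_Sigma_iff[THEN iffD2], intro conjI ballI)
    fix k :: int
    show "(\<lambda>j. norm (H (k, j))) summable_on UNIV"
      using summable_on_cmult_right[OF cnv_summable[OF a(2,2), of k], of "cmod (dk k * a k)"]
      by (simp add: H_def norm_mult mult.assoc)
    have "(\<lambda>k. cmod (dk k * a k) * cmod (of_real (cnv a a k))) summable_on UNIV"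
      by (rule sqs_cauchy_schwarz(1)[OF a(3) young(1)[OF a(1,2,2)]])
    then have "(\<lambda>k. cmod (dk k * a k) * cnv a a k) summable_on UNIV" by simp
    moreover have "(\<Sum>\<^sub>\<infinity>j. norm (H (k, j))) = cmod (dk k * a k) * cnv a a k" for k
      unfolding cnv_def by (subst infsum_cmult_right'[symmetric]) (simp add: H_def norm_mult mult.assoc)
    ultimately show "(\<lambda>k. norm (\<Sum>\<^sub>\<infinity>j. norm (H (k, j)))) summable_on UNIV" by simp
  qed
  then have sH: "H summable_on UNIV" by (simp add: abs_summable_summable)
  have "infsum H UNIV = (\<Sum>\<^sub>\<infinity>k. \<Sum>\<^sub>\<infinity>j. H (k, j))"
    using infsum_Sigma'_banach[of "\<lambda>k j. H (k, j)" UNIV "\<lambda>_. UNIV"] sH by simp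
  also have "\<dots> = (\<Sum>\<^sub>\<infinity>k. cnj (dk k * a k) * conv a a k)"
    unfolding conv_def H_def prod.case by (intro infsum_cong infsum_cmult_right')
  finally have S: "infsum H UNIV = (\<Sum>\<^sub>\<infinity>k. cnj (dk k * a k) * conv a a k)" .
  have s\<sigma>: "(\<lambda>p. H (\<sigma> p)) summable_on UNIV" "infsum (\<lambda>p. H (\<sigma> p)) UNIV = infsum H UNIV"
    using summable_on_reindex_bij_betw[OF bij(1), of H] infsum_reindex_bij_betw[OF bij(1), of H] sH by auto
  have s\<tau>: "(\<lambda>p. H (\<tau> p)) summable_on UNIV" "infsum (\<lambda>p. H (\<tau> p)) UNIV = infsum H UNIV"
    using summable_on_reindex_bij_betw[OF bij(2), of H] infsum_reindex_bij_betw[OF bij(2), of H] sH by auto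
  have z: "H p + H (\<sigma> p) + H (\<tau> p) = 0" for p
  proof (cases p)
    case (Pair k j)
    have h1: "H p = - dk k * (cnj (a k) * a j * a (k - j))" by (simp add: Pair H_def)
    have h2: "H (\<sigma> p) = dk j * (cnj (a k) * a j * a (k - j))"
      by (simp add: Pair H_def \<sigma>_def sym dk_minus)
    have c: "cnj (a (j - k)) = a (k - j)" using sym[of "j - k"] by simp
    have d: "dk (j - k) = dk j - dk k" by (simp add: dk_def algebra_simps)
    have "H (\<tau> p) = - dk (j - k) * cnj (a (j - k)) * (a j * cnj (a k))"
      by (simp add: Pair H_def \<tau>_def sym)
    then have h3: "H (\<tau> p) = (dk k - dk j) * (cnj (a k) * a j * a (k - j))"
      unfolding c d by (simp add: algebra_simps)
    show ?thesis unfolding h1 h2 h3 by (simp add: algebra_simps)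
  qed
  have "infsum H UNIV + infsum (\<lambda>p. H (\<sigma> p)) UNIV + infsum (\<lambda>p. H (\<tau> p)) UNIV = 0"
    using infsum_add[OF summable_on_add[OF sH s\<sigma>(1)] s\<tau>(1)] infsum_add[OF sH s\<sigma>(1)] z by simp
  then have "3 * infsum H UNIV = 0" using s\<sigma>(2) s\<tau>(2) by simp
  then show ?thesis using S by simp
qed

text \<open>The cubic part cancels, and what is left of the square is \<open>v (2 w + v)\<close>, at
  most linear in \<open>w\<close>. With \<open>v\<close> measured in l^1 and \<open>2 w + v\<close>
  in l^2, the bound grows only linearly in the L^2 norm of \<open>w\<close>, so the energy
  inequality closes.\<close>

lemma energy_flux:
  fixes w v :: hseq
  assumes n: "1 \<le> n"
  defines "q \<equiv> conv (uc n (w + v)) (uc n (w + v))"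
  shows "(\<lambda>k. cnj (dk k * uc n w k) * q k) summable_on UNIV"
    "cmod (\<Sum>\<^sub>\<infinity>k. cnj (dk k * uc n w k) * q k) \<le> sqrt (E1 n w) * (norm v * (2 * sqrt (nsq (uc n w)) + norm v))"
proof -
  let ?w = "uc n w" and ?v = "uc n v"
  define z where "z = (\<lambda>k. 2 * ?w k + ?v k)"
  have sz: "sqs z" unfolding z_def by (intro sqs_add sqs_cmult sqs_uc)
  have sw: "sqs (\<lambda>k. cnj (dk k * ?w k))" "nsq (\<lambda>k. cnj (dk k * ?w k)) = E1 n w"
    using sqs_cnj(1)[OF sqs_dk_uc[OF n]] sqs_cnj(2)[of "\<lambda>k. dk k * ?w k"] by (auto simp: E1_def)
  have q: "q k = conv ?w ?w k + conv ?v z k" for k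
  proof -
    have "uc n (w + v) = (\<lambda>k. ?w k + ?v k)" by (auto simp: uc_add)
    moreover have "sqs (\<lambda>k. 2 * ?w k)" by (intro sqs_cmult sqs_uc)
    ultimately show ?thesis
      unfolding q_def z_def
      by (simp add: conv_add_left conv_add_right sqs_add conv_cmult_right conv_commute[of ?w ?v])
  qed
  have c1: "sqs (conv ?w ?w)" "sqs (conv ?v z)" "nsq (conv ?v z) \<le> (nl1 ?v)\<^sup>2 * nsq z"
    using young_conv[of ?w ?w] young_conv[of ?v z] l1_uc[OF n] sz by auto
  have s: "(\<lambda>k. cnj (dk k * ?w k) * conv ?w ?w k) summable_on UNIV"
    "(\<lambda>k. cnj (dk k * ?w k) * conv ?v z k) summable_on UNIV"
    using sqs_mult_abs_summable(2)[OF sw(1)] c1 by auto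
  show "(\<lambda>k. cnj (dk k * ?w k) * q k) summable_on UNIV"
    unfolding q distrib_left by (intro summable_on_add s)
  have "(\<Sum>\<^sub>\<infinity>k. cnj (dk k * ?w k) * q k) = (\<Sum>\<^sub>\<infinity>k. cnj (dk k * ?w k) * conv ?v z k)"
    unfolding q distrib_left infsum_add[OF s]
    using cubic_cancellation[OF l1_uc(1)[OF n] sqs_uc sqs_dk_uc[OF n] uc_minus] by simp
  also have "cmod \<dots> \<le> sqrt (E1 n w) * sqrt (nsq (conv ?v z))"
    using sqs_mult_abs_summable(3)[OF sw(1) c1(2)] sw(2) by simp
  also have "sqrt (nsq (conv ?v z)) \<le> norm v * (2 * sqrt (nsq ?w) + norm v)"
  proof -
    have "sqrt (nsq (conv ?v z)) \<le> sqrt ((nl1 ?v)\<^sup>2 * nsq z)" using c1(3) by simp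
    also have "\<dots> = nl1 ?v * sqrt (nsq z)" by (simp add: real_sqrt_mult)
    also have "\<dots> \<le> norm v * (2 * sqrt (nsq ?w) + norm v)"
    proof (rule mult_mono)
      have "nl1 ?v \<le> sqrt (E1 n v)" by (rule l1_uc(2)[OF n])
      also have "\<dots> \<le> sqrt ((norm v)\<^sup>2)" using E1_le[OF n] by (rule real_sqrt_le_mono)
      finally show "nl1 ?v \<le> norm v" by simp
      \<comment> \<open>The sequences are lifted to \<open>hseq\<close> to have the triangle
        inequality for the square root of \<open>nsq\<close>.\<close>
      define W where "W = Hseq ?w"
      define Z where "Z = Hseq z"
      have cW: "cf W = ?w" and cZ: "cf Z = z"
        unfolding W_def Z_def using sz by (auto intro!: cf_Hseq simp: uc_minus z_def)
      have cV: "cf (Hseq ?v) = ?v" by (auto intro!: cf_Hseq simp: uc_minus)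
      have "Z = 2 *\<^sub>R W + Hseq ?v"
        by (rule hseq_eqI) (simp add: cf_plus cf_scaleR cZ cW cV z_def scaleR_conv_of_real)
      then have "norm Z \<le> 2 * norm W + norm (Hseq ?v)"
        using norm_triangle_ineq[of "2 *\<^sub>R W" "Hseq ?v"] by simp
      moreover have "norm (Hseq ?v) \<le> norm v"
        using nsq_uc_le[of n v] by (subst norm_hseq_le_iff) (auto simp: cV)
      moreover have "norm Z = sqrt (nsq z)" "norm W = sqrt (nsq ?w)" by (simp_all add: norm_hseq_def cZ cW)
      ultimately show "sqrt (nsq z) \<le> 2 * sqrt (nsq ?w) + norm v" by linarith
    qed auto
    finally show ?thesis .
  qed
  finally show "cmod (\<Sum>\<^sub>\<infinity>k. cnj (dk k * ?w k) * q k) \<le> sqrt (E1 n w) * (norm v * (2 * sqrt (nsq ?w) + norm v))"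
    by (simp add: mult_left_mono)
qed

section \<open>Estimates for the heat equation\<close>

text \<open>Right-continuity on the whole line gives Borel measurability directly. The class
  contains the given path, once extended by constants, as well as continuous solutions.\<close>

definition rcont :: "(real \<Rightarrow> 'a::topological_space) \<Rightarrow> bool" where
  "rcont U \<longleftrightarrow> (\<forall>t. (U \<longlongrightarrow> U t) (at_right t))"

lemma rcont_compose: "rcont U \<Longrightarrow> (\<And>x. isCont f x) \<Longrightarrow> rcont (\<lambda>s. f (U s))"
  unfolding rcont_def by (blast intro: isCont_tendsto_compose)

lemma rcont_add: "rcont U \<Longrightarrow> rcont V \<Longrightarrow> rcont (\<lambda>s. U s + V s)"
  for U :: "real \<Rightarrow> 'a::real_normed_vector"
  unfolding rcont_def by (blast intro: tendsto_add)

lemma rcont_diff: "rcont U \<Longrightarrow> rcont V \<Longrightarrow> rcont (\<lambda>s. U s - V s)"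
  for U :: "real \<Rightarrow> 'a::real_normed_vector"
  unfolding rcont_def by (blast intro: tendsto_diff)

lemma rcont_scaleR: "rcont U \<Longrightarrow> rcont V \<Longrightarrow> rcont (\<lambda>s. U s *\<^sub>R V s)"
  for V :: "real \<Rightarrow> 'a::real_normed_vector"
  unfolding rcont_def by (blast intro: tendsto_scaleR)

lemma rcont_measurable: "rcont f \<Longrightarrow> f \<in> borel_measurable borel"
  for f :: "real \<Rightarrow> 'a::real_normed_vector"
  unfolding rcont_def by (intro borel_measurable_right_continuous) auto

lemma rcont_cf_measurable: "rcont U \<Longrightarrow> (\<lambda>s. cf (U s) k) \<in> borel_measurable borel"
  by (intro rcont_measurable rcont_compose[of U "\<lambda>x. cf x k"])
    (auto intro!: bounded_linear.isCont[OF bounded_linear_cf])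

lemma rcont_norm_measurable: "rcont U \<Longrightarrow> (\<lambda>s. norm (U s)) \<in> borel_measurable borel"
  for U :: "real \<Rightarrow> 'a::real_normed_vector"
  by (intro rcont_measurable rcont_compose[of U norm]) (auto intro!: continuous_intros)

lemma nsq_measurable:
  assumes "\<And>k. (\<lambda>s. a s k) \<in> borel_measurable M" "\<And>s. sqs (a s)"
  shows "(\<lambda>s. nsq (a s)) \<in> borel_measurable M"
proof (rule borel_measurable_LIMSEQ_metric)
  show "(\<lambda>N. \<Sum>k\<in>isym N. (cmod (a s k))\<^sup>2) \<longlonglongrightarrow> nsq (a s)" for s
    by (rule nsq_isym_tendsto[OF assms(2)])
  have [measurable]: "(\<lambda>s. a s k) \<in> borel_measurable M" for k by fact
  show "(\<lambda>s. \<Sum>k\<in>isym N. (cmod (a s k))\<^sup>2) \<in> borel_measurable M" for N by measurable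
qed

lemma rcont_uc_measurable: "rcont U \<Longrightarrow> (\<lambda>s. uc n (U s) k) \<in> borel_measurable borel"
proof -
  assume "rcont U"
  note [measurable] = rcont_cf_measurable[OF this]
  show ?thesis unfolding uc_def by measurable
qed

lemma rcont_E1_measurable:
  assumes "1 \<le> n" "rcont U" shows "(\<lambda>s. E1 n (U s)) \<in> borel_measurable borel"
proof -
  note [measurable] = rcont_uc_measurable[OF assms(2)]
  show ?thesis unfolding E1_def by (rule nsq_measurable) (measurable, rule sqs_dk_uc[OF assms(1)])
qed

lemma rcont_nsq_uc_measurable: "rcont U \<Longrightarrow> (\<lambda>s. nsq (uc n (U s))) \<in> borel_measurable borel"
  by (rule nsq_measurable) (auto intro: rcont_uc_measurable)

lemma isCont_Bx_diag:
  assumes n: "1 \<le> n" shows "isCont (\<lambda>x. Bx n x x) x"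
proof -
  have "((\<lambda>y. norm (Bx n y y - Bx n x x)) \<longlongrightarrow> 0) (at x)"
  proof (rule tendsto_sandwich)
    show "\<forall>\<^sub>F y in at x. 0 \<le> norm (Bx n y y - Bx n x x)" by simp
    show "\<forall>\<^sub>F y in at x. norm (Bx n y y - Bx n x x) \<le> sqrt (conv_bound n) * norm (y - x) * norm (y + x)"
      unfolding Bx_diff_squares[OF n] using norm_Bx_le[OF n] by (intro always_eventually) blast
    have "((\<lambda>y. sqrt (conv_bound n) * norm (y - x) * norm (y + x)) \<longlongrightarrow> sqrt (conv_bound n) * norm (x - x) * norm (x + x)) (at x)"
      by (intro tendsto_intros)
    then show "((\<lambda>y. sqrt (conv_bound n) * norm (y - x) * norm (y + x)) \<longlongrightarrow> 0) (at x)" by simp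
  qed simp
  then show ?thesis unfolding isCont_def using LIM_zero_iff tendsto_norm_zero_iff by blast
qed

text \<open>One mode of \<open>\<nu> w_xx - 1/2 g_x\<close>, where \<open>g\<close> is the flux
  before differentiation.\<close>

definition heat_mode :: "real \<Rightarrow> int \<Rightarrow> (real \<Rightarrow> complex) \<Rightarrow> (real \<Rightarrow> complex) \<Rightarrow> real \<Rightarrow> complex" where
  "heat_mode \<nu> k w g s = of_real (- (\<nu> * (lam k)\<^sup>2)) * w s + (- (1/2) * dk k) * g s"

lemma integrable_norm_sq_bounded:
  fixes g :: "real \<Rightarrow> complex"
  assumes "g \<in> borel_measurable (Leb t)" "\<And>s. s \<in> {0..t} \<Longrightarrow> cmod (g s) \<le> B"
  shows "integrable (Leb t) (\<lambda>s. (cmod (g s))\<^sup>2)"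
proof (rule integrable_bounded_Icc)
  have [measurable]: "g \<in> borel_measurable (Leb t)" by fact
  show "(\<lambda>s. (cmod (g s))\<^sup>2) \<in> borel_measurable (Leb t)" by measurable
  show "norm ((cmod (g s))\<^sup>2) \<le> B\<^sup>2" if "s \<in> {0..t}" for s
    using assms(2)[OF that] by (simp add: power_mono)
qed

lemma measurable_lebesgue_on_mono:
  fixes g :: "real \<Rightarrow> 'a::euclidean_space"
  assumes "g \<in> borel_measurable (Leb T)" "t \<le> T"
  shows "g \<in> borel_measurable (Leb t)"
  by (rule measurable_restrict_mono[OF assms(1)]) (use assms(2) in auto)

text \<open>The energy identity has dissipation \<open>2 * \<nu> * (lam k)\<^sup>2\<close> times the
  squared modulus of \<open>w\<close>. Young's inequality spends half of it on the flux term, at the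
  price of the factor \<open>1 / (4 * \<nu>)\<close>, and the other half stays on the left.\<close>

lemma mode_estimate:
  assumes \<nu>: "0 < \<nu>" and t: "t \<in> {0..T}"
    and i: "integrable (Leb T) (heat_mode \<nu> k w g)"
    and w: "\<And>t. t \<in> {0..T} \<Longrightarrow> w t = (LINT s|Leb t. heat_mode \<nu> k w g s)"
    and m: "w \<in> borel_measurable (Leb T)" "g \<in> borel_measurable (Leb T)"
    and b: "\<And>s. s \<in> {0..T} \<Longrightarrow> cmod (w s) \<le> B" "\<And>s. s \<in> {0..T} \<Longrightarrow> cmod (g s) \<le> B'"
  shows "(cmod (w t))\<^sup>2 + \<nu> * (LINT s|Leb t. (lam k)\<^sup>2 * (cmod (w s))\<^sup>2)
    \<le> (1 / (4 * \<nu>)) * (LINT s|Leb t. (cmod (g s))\<^sup>2)"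
proof -
  let ?M = "Leb t"
  have iw: "integrable ?M (\<lambda>s. (cmod (w s))\<^sup>2)" and ig: "integrable ?M (\<lambda>s. (cmod (g s))\<^sup>2)"
    using t by (auto intro: integrable_norm_sq_bounded[OF measurable_lebesgue_on_mono[OF m(1)] b(1)]
        integrable_norm_sq_bounded[OF measurable_lebesgue_on_mono[OF m(2)] b(2)])
  have pt: "2 * Re (cnj (w s) * heat_mode \<nu> k w g s) \<le> (1 / (4 * \<nu>)) * (cmod (g s))\<^sup>2 - \<nu> * ((lam k)\<^sup>2 * (cmod (w s))\<^sup>2)" for s
  proof -
    have "cnj (w s) * heat_mode \<nu> k w g s
        = of_real (- (\<nu> * (lam k)\<^sup>2 * (cmod (w s))\<^sup>2)) * 1 + of_real (- (1/2)) * (cnj (w s) * dk k * g s)"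
      unfolding heat_mode_def using complex_norm_square[of "w s"] by (simp add: algebra_simps)
    from Re_linear_combination[OF this]
    have "2 * Re (cnj (w s) * heat_mode \<nu> k w g s)
        = - 2 * \<nu> * (lam k)\<^sup>2 * (cmod (w s))\<^sup>2 - Re (cnj (w s) * dk k * g s)"
      by (simp only: one_complex.sel) argo
    also have "\<dots> \<le> - 2 * \<nu> * (lam k)\<^sup>2 * (cmod (w s))\<^sup>2 + lam k * cmod (w s) * cmod (g s)"
      using abs_Re_le_cmod[of "cnj (w s) * dk k * g s"] by (simp add: norm_mult mult.commute mult.left_commute)
    also have "lam k * cmod (w s) * cmod (g s) \<le> \<nu> * (lam k)\<^sup>2 * (cmod (w s))\<^sup>2 + (1 / (4 * \<nu>)) * (cmod (g s))\<^sup>2"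
    proof -
      have "0 \<le> (2 * \<nu> * lam k * cmod (w s) - cmod (g s))\<^sup>2" by simp
      then have "4 * \<nu> * (lam k * cmod (w s) * cmod (g s))
          \<le> 4 * \<nu> * (\<nu> * (lam k)\<^sup>2 * (cmod (w s))\<^sup>2) + (cmod (g s))\<^sup>2"
        by (simp add: power2_eq_square algebra_simps)
      then show ?thesis using \<nu> by (simp add: field_simps)
    qed
    finally show ?thesis by (simp add: algebra_simps)
  qed
  have "(cmod (w t))\<^sup>2 = (LINT s|?M. 2 * Re (cnj (w s) * heat_mode \<nu> k w g s))"
    by (rule norm_sq_indefinite_integral(2)[OF i w t])
  also have "\<dots> \<le> (LINT s|?M. (1 / (4 * \<nu>)) * (cmod (g s))\<^sup>2 - \<nu> * ((lam k)\<^sup>2 * (cmod (w s))\<^sup>2))"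
    using iw ig by (intro integral_mono norm_sq_indefinite_integral(1)[OF i w t] pt Bochner_Integration.integrable_diff) auto
  also have "\<dots> = (1 / (4 * \<nu>)) * (LINT s|?M. (cmod (g s))\<^sup>2) - \<nu> * (LINT s|?M. (lam k)\<^sup>2 * (cmod (w s))\<^sup>2)"
    using iw ig by (subst Bochner_Integration.integral_diff) auto
  finally show ?thesis by simp
qed

text \<open>The second derivative leaves the space in which \<open>W\<close> lives, so the equation
  is imposed on each coefficient separately.\<close>

definition heat_sol :: "real \<Rightarrow> real \<Rightarrow> (real \<Rightarrow> hseq) \<Rightarrow> (real \<Rightarrow> hseq) \<Rightarrow> bool" where
  "heat_sol \<nu> T G W \<longleftrightarrow> (\<forall>k. \<forall>t\<in>{0..T}.
     integrable (Leb t) (heat_mode \<nu> k (\<lambda>s. cf (W s) k) (\<lambda>s. cf (G s) k))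
     \<and> cf (W t) k = (LINT s|Leb t. heat_mode \<nu> k (\<lambda>s. cf (W s) k) (\<lambda>s. cf (G s) k) s))"

lemma heat_sol_cong:
  assumes "heat_sol \<nu> T G W" "\<And>s. s \<in> {0..T} \<Longrightarrow> G s = G' s" "\<And>s. s \<in> {0..T} \<Longrightarrow> W s = W' s"
  shows "heat_sol \<nu> T G' W'"
  unfolding heat_sol_def
proof (intro allI ballI)
  fix k t assume t: "t \<in> {0..T}"
  define f where "f = heat_mode \<nu> k (\<lambda>s. cf (W s) k) (\<lambda>s. cf (G s) k)"
  define f' where "f' = heat_mode \<nu> k (\<lambda>s. cf (W' s) k) (\<lambda>s. cf (G' s) k)"
  have eq: "f s = f' s" if "s \<in> space (Leb t)" for s
    using that t assms(2,3)[of s] by (simp add: heat_mode_def f_def f'_def)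
  have "integrable (Leb t) f" "cf (W t) k = (LINT s|Leb t. f s)"
    using assms(1) t unfolding heat_sol_def f_def by auto
  moreover have "integrable (Leb t) f = integrable (Leb t) f'"
    by (rule Bochner_Integration.integrable_cong[OF refl eq])
  moreover have "(LINT s|Leb t. f s) = (LINT s|Leb t. f' s)"
    by (rule Bochner_Integration.integral_cong[OF refl eq])
  ultimately show "integrable (Leb t) (heat_mode \<nu> k (\<lambda>s. cf (W' s) k) (\<lambda>s. cf (G' s) k))
     \<and> cf (W' t) k = (LINT s|Leb t. heat_mode \<nu> k (\<lambda>s. cf (W' s) k) (\<lambda>s. cf (G' s) k) s)"
    using assms(3)[OF t] by (simp add: f'_def)
qed

lemma heat_sol_diff:
  assumes "heat_sol \<nu> T G W" "heat_sol \<nu> T G' W'"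
  shows "heat_sol \<nu> T (\<lambda>s. G s - G' s) (\<lambda>s. W s - W' s)"
  unfolding heat_sol_def
proof (intro allI ballI)
  fix k t assume t: "t \<in> {0..T}"
  have eq: "heat_mode \<nu> k (\<lambda>s. cf (W s - W' s) k) (\<lambda>s. cf (G s - G' s) k)
     = (\<lambda>s. heat_mode \<nu> k (\<lambda>s. cf (W s) k) (\<lambda>s. cf (G s) k) s - heat_mode \<nu> k (\<lambda>s. cf (W' s) k) (\<lambda>s. cf (G' s) k) s)"
    by (simp add: heat_mode_def cf_diff algebra_simps fun_eq_iff)
  show "integrable (Leb t) (heat_mode \<nu> k (\<lambda>s. cf (W s - W' s) k) (\<lambda>s. cf (G s - G' s) k))
     \<and> cf (W t - W' t) k = (LINT s|Leb t. heat_mode \<nu> k (\<lambda>s. cf (W s - W' s) k) (\<lambda>s. cf (G s - G' s) k) s)"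
    unfolding eq using assms t unfolding heat_sol_def by (simp add: cf_diff)
qed

text \<open>Mode estimates summed over finite sets. The dissipation bound is kept for finite
  \<open>K\<close>; the passage to all modes requires monotone convergence in time and happens in
  \<open>smoothing\<close>.\<close>

lemma heat_sol_estimate:
  assumes \<nu>: "0 < \<nu>" and s: "heat_sol \<nu> T G W" and m: "rcont W" "rcont G"
    and b: "\<And>s. s \<in> {0..T} \<Longrightarrow> norm (W s) \<le> B" "\<And>s. s \<in> {0..T} \<Longrightarrow> norm (G s) \<le> B'"
    and t: "t \<in> {0..T}"
  shows "(norm (W t))\<^sup>2 \<le> (1 / (4 * \<nu>)) * (LINT s|Leb t. (norm (G s))\<^sup>2)"
    "finite K \<Longrightarrow> \<nu> * (LINT s|Leb t. (\<Sum>k\<in>K. (lam k)\<^sup>2 * (cmod (cf (W s) k))\<^sup>2))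
       \<le> (1 / (4 * \<nu>)) * (LINT s|Leb t. (norm (G s))\<^sup>2)"
proof -
  let ?M = "Leb t"
  have mw: "(\<lambda>s. cf (W s) k) \<in> borel_measurable (Leb r)" "(\<lambda>s. cf (G s) k) \<in> borel_measurable (Leb r)" for k r
    using m by (auto intro: borel_imp_lebesgue_on rcont_cf_measurable)
  have bw: "cmod (cf (W s) k) \<le> B" "cmod (cf (G s) k) \<le> B'" if "s \<in> {0..T}" for s k
    using b(1)[OF that] b(2)[OF that] norm_cf_le order_trans by blast+
  have iw: "integrable ?M (\<lambda>s. (cmod (cf (W s) k))\<^sup>2)" "integrable ?M (\<lambda>s. (cmod (cf (G s) k))\<^sup>2)" for k
    by (rule integrable_norm_sq_bounded[OF mw(1) bw(1)], use t in simp)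
      (rule integrable_norm_sq_bounded[OF mw(2) bw(2)], use t in simp)
  have iG: "integrable ?M (\<lambda>s. (norm (G s))\<^sup>2)"
  proof (rule integrable_bounded_Icc)
    have [measurable]: "(\<lambda>s. norm (G s)) \<in> borel_measurable ?M"
      using m by (intro borel_imp_lebesgue_on rcont_norm_measurable)
    show "(\<lambda>s. (norm (G s))\<^sup>2) \<in> borel_measurable ?M" by measurable
    show "norm ((norm (G s))\<^sup>2) \<le> B'\<^sup>2" if "s \<in> {0..t}" for s
      using that t b(2)[of s] by (simp add: power_mono)
  qed
  have est: "(\<Sum>k\<in>K. (cmod (cf (W t) k))\<^sup>2) + \<nu> * (LINT s|?M. (\<Sum>k\<in>K. (lam k)\<^sup>2 * (cmod (cf (W s) k))\<^sup>2))
      \<le> (1 / (4 * \<nu>)) * (LINT s|?M. (norm (G s))\<^sup>2)" if K: "finite K" for K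
  proof -
    have "T \<in> {0..T}" using t by simp
    have "(\<Sum>k\<in>K. (cmod (cf (W t) k))\<^sup>2) + \<nu> * (LINT s|?M. (\<Sum>k\<in>K. (lam k)\<^sup>2 * (cmod (cf (W s) k))\<^sup>2))
      = (\<Sum>k\<in>K. (cmod (cf (W t) k))\<^sup>2 + \<nu> * (LINT s|?M. (lam k)\<^sup>2 * (cmod (cf (W s) k))\<^sup>2))"
      using iw by (simp add: Bochner_Integration.integral_sum sum.distrib sum_distrib_left)
    also have "\<dots> \<le> (\<Sum>k\<in>K. (1 / (4 * \<nu>)) * (LINT s|?M. (cmod (cf (G s) k))\<^sup>2))"
    proof (rule sum_mono)
      fix k
      show "(cmod (cf (W t) k))\<^sup>2 + \<nu> * (LINT s|?M. (lam k)\<^sup>2 * (cmod (cf (W s) k))\<^sup>2)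
          \<le> (1 / (4 * \<nu>)) * (LINT s|?M. (cmod (cf (G s) k))\<^sup>2)"
        using s \<open>T \<in> {0..T}\<close>
        by (intro mode_estimate[OF \<nu> t _ _ mw bw]) (auto simp: heat_sol_def)
    qed
    also have "\<dots> = (1 / (4 * \<nu>)) * (LINT s|?M. (\<Sum>k\<in>K. (cmod (cf (G s) k))\<^sup>2))"
      using iw by (simp add: Bochner_Integration.integral_sum sum_distrib_left)
    also have "\<dots> \<le> (1 / (4 * \<nu>)) * (LINT s|?M. (norm (G s))\<^sup>2)"
      using \<nu> iw iG K by (intro mult_left_mono integral_mono Bochner_Integration.integrable_sum)
        (auto simp: norm_hseq_sq sqs_sum_le)
    finally show ?thesis .
  qed
  have nn: "0 \<le> \<nu> * (LINT s|?M. (\<Sum>k\<in>K. (lam k)\<^sup>2 * (cmod (cf (W s) k))\<^sup>2))" for K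
    using \<nu> by (intro mult_nonneg_nonneg Bochner_Integration.integral_nonneg sum_nonneg) auto
  show "(norm (W t))\<^sup>2 \<le> (1 / (4 * \<nu>)) * (LINT s|?M. (norm (G s))\<^sup>2)"
    unfolding norm_hseq_sq[of "W t"]
  proof (rule sqsI(2))
    fix K :: "int set" assume "finite K"
    from est[OF this] nn[of K] show "(\<Sum>k\<in>K. (cmod (cf (W t) k))\<^sup>2) \<le> (1 / (4 * \<nu>)) * (LINT s|?M. (norm (G s))\<^sup>2)"
      by linarith
  qed
  assume "finite K"
  from est[OF this] sum_nonneg[of K "\<lambda>k. (cmod (cf (W t) k))\<^sup>2"]
  show "\<nu> * (LINT s|?M. (\<Sum>k\<in>K. (lam k)\<^sup>2 * (cmod (cf (W s) k))\<^sup>2)) \<le> (1 / (4 * \<nu>)) * (LINT s|?M. (norm (G s))\<^sup>2)"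
    by simp
qed

lemma heat_sol_unique:
  assumes n: "1 \<le> n" and \<nu>: "0 < \<nu>"
    and s: "heat_sol \<nu> T (\<lambda>s. Bx n (W s + V s) (W s + V s)) W" "heat_sol \<nu> T (\<lambda>s. Bx n (W' s + V s) (W' s + V s)) W'"
    and m: "rcont W" "rcont W'" "rcont V"
    and b: "\<And>s. s \<in> {0..T} \<Longrightarrow> norm (W s) \<le> B" "\<And>s. s \<in> {0..T} \<Longrightarrow> norm (W' s) \<le> B"
      "\<And>s. s \<in> {0..T} \<Longrightarrow> norm (V s) \<le> B" and t: "t \<in> {0..T}"
  shows "W t = W' t"
proof -
  define G where "G = (\<lambda>s. Bx n (W s + V s) (W s + V s) - Bx n (W' s + V s) (W' s + V s))"
  define \<phi> where "\<phi> = (\<lambda>s. (norm (W s - W' s))\<^sup>2)"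
  \<comment> \<open>\<open>4 * B\<close> bounds the sum \<open>W + V + (W' + V)\<close> that remains
    after factoring the difference of the squares.\<close>
  define c where "c = sqrt (conv_bound n) * (4 * B)"
  have B0: "0 \<le> B" using b(1)[OF t] norm_ge_zero order_trans by blast
  have c0: "0 \<le> c" using B0 by (simp add: c_def conv_bound_def)
  have Gb: "norm (G s) \<le> c * norm (W s - W' s)" if "s \<in> {0..T}" for s
  proof -
    have "G s = Bx n (W s - W' s) (W s + V s + (W' s + V s))"
      unfolding G_def Bx_diff_squares[OF n] by simp
    then have 1: "norm (G s) \<le> sqrt (conv_bound n) * norm (W s - W' s) * norm (W s + V s + (W' s + V s))"
      using norm_Bx_le[OF n] by simp
    have 2: "norm (W s + V s + (W' s + V s)) \<le> 4 * B"
      using norm_triangle_ineq[of "W s + V s" "W' s + V s"] norm_triangle_ineq[of "W s" "V s"]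
        norm_triangle_ineq[of "W' s" "V s"] b(1)[OF that] b(2)[OF that] b(3)[OF that] by linarith
    have "0 \<le> sqrt (conv_bound n) * norm (W s - W' s)" by (simp add: conv_bound_def)
    from order_trans[OF 1 mult_left_mono[OF 2 this]] show ?thesis by (simp add: c_def mult_ac)
  qed
  have rW: "rcont (\<lambda>s. W s - W' s)" by (intro rcont_diff m)
  have rG: "rcont G"
    unfolding G_def using m
    by (intro rcont_diff rcont_compose[of _ "\<lambda>x. Bx n x x"] rcont_add isCont_Bx_diag[OF n])
  have Wb: "norm (W s - W' s) \<le> 2 * B" if "s \<in> {0..T}" for s
    using norm_triangle_ineq4[of "W s" "W' s"] b(1)[OF that] b(2)[OF that] by linarith
  have Gb': "norm (G s) \<le> c * (2 * B)" if "s \<in> {0..T}" for s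
    using Gb[OF that] mult_left_mono[OF Wb[OF that] c0] by linarith
  have [measurable]: "(\<lambda>s. norm (W s - W' s)) \<in> borel_measurable (Leb r)"
    "(\<lambda>s. norm (G s)) \<in> borel_measurable (Leb r)" for r
    by (intro borel_imp_lebesgue_on rcont_norm_measurable rW rG)+
  have \<phi>m: "\<phi> \<in> borel_measurable (Leb r)" for r unfolding \<phi>_def by measurable
  have \<phi>b: "\<bar>\<phi> s\<bar> \<le> (2 * B)\<^sup>2" if "s \<in> {0..T}" for s
    using power_mono[OF Wb[OF that], of 2] by (simp add: \<phi>_def)
  have "\<phi> t \<le> 0 * exp (LINT s|Leb t. c\<^sup>2 / (4 * \<nu>))"
  proof (rule gronwall[OF _ _ \<phi>m \<phi>b _ t])
    show "integrable (Leb T) (\<lambda>s. c\<^sup>2 / (4 * \<nu>))"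
      by (rule integrable_continuous_Icc) (intro continuous_intros)
    fix t assume t: "t \<in> {0..T}"
    have "\<phi> t \<le> (1 / (4 * \<nu>)) * (LINT s|Leb t. (norm (G s))\<^sup>2)"
      unfolding \<phi>_def
      by (rule heat_sol_estimate(1)[OF \<nu> heat_sol_diff[OF s, folded G_def] rW rG Wb Gb' t])
    also have "\<dots> \<le> (1 / (4 * \<nu>)) * (LINT s|Leb t. c\<^sup>2 * \<phi> s)"
    proof (intro mult_left_mono integral_mono)
      show "integrable (Leb t) (\<lambda>s. (norm (G s))\<^sup>2)"
        using t Gb' by (intro integrable_bounded_Icc[where B = "(c * (2 * B))\<^sup>2"]) (auto intro!: power_mono)
      have "integrable (Leb t) \<phi>"
        using t \<phi>b by (intro integrable_bounded_Icc[where B = "(2 * B)\<^sup>2"] \<phi>m) auto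
      then show "integrable (Leb t) (\<lambda>s. c\<^sup>2 * \<phi> s)" by simp
      fix s assume "s \<in> space (Leb t)"
      then have "s \<in> {0..T}" using t by auto
      from power_mono[OF Gb[OF this], of 2] show "(norm (G s))\<^sup>2 \<le> c\<^sup>2 * \<phi> s"
        by (simp add: \<phi>_def power_mult_distrib)
    qed (use \<nu> in auto)
    also have "\<dots> = 0 + (LINT s|Leb t. c\<^sup>2 / (4 * \<nu>) * \<phi> s)"
      by (simp flip: integral_mult_right_zero)
    finally show "\<phi> t \<le> 0 + (LINT s|Leb t. c\<^sup>2 / (4 * \<nu>) * \<phi> s)" .
  qed (use \<nu> in auto)
  then show ?thesis by (simp add: \<phi>_def)
qed

section \<open>A priori estimates\<close>

lemma Re_cnj_dk_mult:
  "2 * Re (cnj w * (of_real (- (\<nu> * (lam k)\<^sup>2)) * w + (- (1/2) * dk k) * (of_real \<theta> * q)))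
    = - 2 * \<nu> * (cmod (dk k * w))\<^sup>2 + \<theta> * Re (cnj (dk k * w) * q)"
proof -
  have "cnj w * (of_real (- (\<nu> * (lam k)\<^sup>2)) * w + (- (1/2) * dk k) * (of_real \<theta> * q))
      = of_real (- \<nu> * (cmod (dk k * w))\<^sup>2) * 1 + of_real (\<theta> / 2) * (cnj (dk k * w) * q)"
    using complex_norm_square[of w] by (simp add: norm_mult power_mult_distrib algebra_simps)
  from Re_linear_combination[OF this] show ?thesis by (simp only: one_complex.sel) argo
qed

text \<open>Young's inequality releases \<open>\<nu> * e\<close>, half of the L^2 dissipation, and
  leaves \<open>M\<^sup>2 * (2 * sqrt r + M)\<^sup>2 / (4 * \<nu>)\<close>. Splitting the square
  into \<open>8 * r + 2 * M\<^sup>2\<close> gives the two constants.\<close>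

lemma bound_flux:
  fixes \<nu> e r M :: real
  assumes "0 < \<nu>" "0 \<le> M" "0 \<le> e" "0 \<le> r"
  shows "sqrt e * (M * (2 * sqrt r + M)) \<le> \<nu> * e + (2 * M\<^sup>2 / \<nu> * r + M ^ 4 / (2 * \<nu>))"
proof -
  define a where "a = sqrt e"
  define b where "b = sqrt r"
  have ab: "e = a\<^sup>2" "r = b\<^sup>2" using assms by (auto simp: a_def b_def)
  have "0 \<le> (2 * \<nu> * a - M * (2 * b + M))\<^sup>2" by simp
  then have "4 * \<nu> * (a * (M * (2 * b + M))) \<le> 4 * \<nu> * (\<nu> * a\<^sup>2) + M\<^sup>2 * (2 * b + M)\<^sup>2"
    by (simp add: power2_eq_square algebra_simps)
  also have "M\<^sup>2 * (2 * b + M)\<^sup>2 \<le> M\<^sup>2 * (8 * b\<^sup>2 + 2 * M\<^sup>2)"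
  proof (rule mult_left_mono)
    have "0 \<le> (2 * b - M)\<^sup>2" by simp
    then show "(2 * b + M)\<^sup>2 \<le> 8 * b\<^sup>2 + 2 * M\<^sup>2" by (simp add: power2_eq_square algebra_simps)
  qed simp
  finally have "4 * \<nu> * (a * (M * (2 * b + M))) \<le> 4 * \<nu> * (\<nu> * a\<^sup>2) + M\<^sup>2 * (8 * b\<^sup>2 + 2 * M\<^sup>2)" by simp
  also have "\<dots> = 4 * \<nu> * (\<nu> * a\<^sup>2 + (2 * M\<^sup>2 / \<nu> * b\<^sup>2 + M ^ 4 / (2 * \<nu>)))"
    using assms(1) by (simp add: field_simps power2_eq_square power4_eq_xxxx)
  finally have "a * (M * (2 * b + M)) \<le> \<nu> * a\<^sup>2 + (2 * M\<^sup>2 / \<nu> * b\<^sup>2 + M ^ 4 / (2 * \<nu>))"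
    by (rule mult_left_le_imp_le) (use assms(1) in simp)
  then show ?thesis using assms by (simp add: a_def b_def)
qed

text \<open>The factor \<open>\<theta> \<in> [0, 1]\<close> accommodates the truncated equation; it equals 1 for the original one.\<close>

locale truncated_burgers =
  fixes n :: nat and \<nu> T M B :: real and W V :: "real \<Rightarrow> hseq" and \<theta> :: "real \<Rightarrow> real"
  assumes n: "1 \<le> n" and \<nu>: "0 < \<nu>" and T: "0 < T"
    and rW: "rcont W" and rV: "rcont V" and r\<theta>: "rcont \<theta>"
    and \<theta>: "\<And>s. 0 \<le> \<theta> s" "\<And>s. \<theta> s \<le> 1"
    and bW: "\<And>s. s \<in> {0..T} \<Longrightarrow> norm (W s) \<le> B" and bV: "\<And>s. s \<in> {0..T} \<Longrightarrow> norm (V s) \<le> M"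
    and sol: "heat_sol \<nu> T (\<lambda>s. \<theta> s *\<^sub>R Bx n (W s + V s) (W s + V s)) W"
begin

lemma M_nonneg: "0 \<le> M" and B_nonneg: "0 \<le> B"
  using bW[of 0] bV[of 0] T norm_ge_zero order_trans by (auto intro: order_trans[OF norm_ge_zero])

lemma E1_W_bound: "s \<in> {0..T} \<Longrightarrow> E1 n (W s) \<le> B\<^sup>2"
  using E1_le[OF n, of "W s"] power_mono[OF bW, of s 2] by simp

lemma nsq_W_bound: "s \<in> {0..T} \<Longrightarrow> nsq (uc n (W s)) \<le> B\<^sup>2"
  using nsq_uc_le[of n "W s"] power_mono[OF bW, of s 2] by simp

lemma integrable_E1_W: "t \<in> {0..T} \<Longrightarrow> integrable (Leb t) (\<lambda>s. E1 n (W s))"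
  using E1_W_bound by (intro integrable_bounded_Icc[where B = "B\<^sup>2"] borel_imp_lebesgue_on rcont_E1_measurable n rW) auto

lemma integrable_nsq_W: "t \<in> {0..T} \<Longrightarrow> integrable (Leb t) (\<lambda>s. nsq (uc n (W s)))"
  using nsq_W_bound by (intro integrable_bounded_Icc[where B = "B\<^sup>2"] borel_imp_lebesgue_on rcont_nsq_uc_measurable rW) auto

text \<open>Each mode has an energy identity with density \<open>D k\<close>. The partial sums of
  the densities converge to \<open>Dl\<close> and are bounded uniformly in time, so dominated
  convergence gives the identity for the whole L^2 norm; half of the dissipation in
  \<open>Dl\<close> then absorbs the flux.\<close>

lemma energy_L2:
  assumes t: "t \<in> {0..T}"
  shows "nsq (uc n (W t)) + \<nu> * (LINT s|Leb t. E1 n (W s))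
    \<le> (LINT s|Leb t. 2 * M\<^sup>2 / \<nu> * nsq (uc n (W s)) + M ^ 4 / (2 * \<nu>))"
proof -
  let ?M = "Leb t"
  define u where "u = (\<lambda>s. W s + V s)"
  define q where "q = (\<lambda>s. conv (uc n (u s)) (uc n (u s)))"
  define w where "w = (\<lambda>s. uc n (W s))"
  \<comment> \<open>The weight \<open>lam k ^ n\<close> is divided out of the equation, since the
    cancellation takes place in L^2 and not in H^n.\<close>
  define f where "f = (\<lambda>k s. of_real (- (\<nu> * (lam k)\<^sup>2)) * w s k + (- (1/2) * dk k) * (of_real (\<theta> s) * q s k))"
  have fG: "f k s = heat_mode \<nu> k (\<lambda>s. cf (W s) k) (\<lambda>s. cf (\<theta> s *\<^sub>R Bx n (u s) (u s)) k) s / of_real (lam k ^ n)" for k s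
  proof (cases "k = 0")
    case True
    then show ?thesis using n by (simp add: f_def)
  next
    case False
    then have l: "complex_of_real (lam k) ^ n \<noteq> 0" using lam_ge_1[of k] by auto
    have "cf (W s) k = of_real (lam k ^ n) * w s k" by (simp only: w_def lam_pow_uc)
    then have "heat_mode \<nu> k (\<lambda>s. cf (W s) k) (\<lambda>s. cf (\<theta> s *\<^sub>R Bx n (u s) (u s)) k) s = of_real (lam k ^ n) * f k s"
      by (simp add: heat_mode_def f_def cf_scaleR cf_Bx[OF n] q_def scaleR_conv_of_real algebra_simps)
    then show ?thesis using l by simp
  qed
  have fk: "integrable (Leb r) (f k)" "w r k = (LINT s|Leb r. f k s)" if "r \<in> {0..T}" for r k
  proof -
    define h where "h = heat_mode \<nu> k (\<lambda>s. cf (W s) k) (\<lambda>s. cf (\<theta> s *\<^sub>R Bx n (u s) (u s)) k)"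
    have h: "integrable (Leb r) h" "cf (W r) k = (LINT s|Leb r. h s)"
      using sol that unfolding heat_sol_def u_def h_def by blast+
    have "f k = (\<lambda>s. h s / of_real (lam k ^ n))" unfolding h_def by (rule ext) (rule fG)
    then show "integrable (Leb r) (f k)" "w r k = (LINT s|Leb r. f k s)"
      using h by (simp_all add: w_def uc_def)
  qed
  define D where "D = (\<lambda>k s. - 2 * \<nu> * (cmod (dk k * w s k))\<^sup>2 + \<theta> s * Re (cnj (dk k * w s k) * q s k))"
  have Deq: "2 * Re (cnj (w s k) * f k s) = D k s" for k s
    unfolding f_def D_def by (rule Re_cnj_dk_mult)
  have TT: "T \<in> {0..T}" using T by simp
  have iD: "integrable ?M (D k)" "(cmod (w t k))\<^sup>2 = (LINT s|?M. D k s)" for k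
    using norm_sq_indefinite_integral[of T "f k" "\<lambda>s. w s k", OF fk(1)[OF TT] fk(2) t] unfolding Deq by auto
  define Dl where "Dl = (\<lambda>s. - 2 * \<nu> * E1 n (W s) + \<theta> s * Re (\<Sum>\<^sub>\<infinity>k. cnj (dk k * w s k) * q s k))"
  have ef: "(\<lambda>k. cnj (dk k * w s k) * q s k) summable_on UNIV"
    "cmod (\<Sum>\<^sub>\<infinity>k. cnj (dk k * w s k) * q s k) \<le> sqrt (E1 n (W s)) * (norm (V s) * (2 * sqrt (nsq (uc n (W s))) + norm (V s)))" for s
    unfolding w_def q_def u_def by (rule energy_flux[OF n])+
  have hs: "((\<lambda>k. D k s) has_sum Dl s) UNIV" for s
    unfolding D_def Dl_def
  proof (intro has_sum_add has_sum_cmult_right has_sum_Re)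
    show "((\<lambda>k. (cmod (dk k * w s k))\<^sup>2) has_sum E1 n (W s)) UNIV"
      using sqs_dk_uc[OF n, of "W s"] unfolding E1_def w_def nsq_def sqs_def by (rule has_sum_infsum)
    show "((\<lambda>k. cnj (dk k * w s k) * q s k) has_sum (\<Sum>\<^sub>\<infinity>k. cnj (dk k * w s k) * q s k)) UNIV"
      using ef(1) by (rule has_sum_infsum)
  qed
  define S where "S = (\<lambda>N s. \<Sum>k\<in>isym N. D k s)"
  have iS: "integrable ?M (S N)" for N
    unfolding S_def by (intro Bochner_Integration.integrable_sum iD)
  have Slim: "(\<lambda>N. S N s) \<longlonglongrightarrow> Dl s" for s
    unfolding S_def by (rule has_sum_isym_tendsto[OF hs])
  \<comment> \<open>A dominating constant; its dependence on \<open>B\<close> does not reach the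
    conclusion.\<close>
  define C where "C = 2 * \<nu> * B\<^sup>2 + sqrt (B\<^sup>2) * sqrt (((B + M)\<^sup>2) * ((B + M)\<^sup>2))"
  have Sb: "norm (S N s) \<le> C" if s: "s \<in> {0..T}" for N s
  proof -
    have "norm (S N s) \<le> (\<Sum>k\<in>isym N. 2 * \<nu> * (cmod (dk k * w s k))\<^sup>2 + cmod (dk k * w s k) * cmod (q s k))"
      unfolding S_def
    proof (rule sum_norm_le)
      fix k
      have aux: "0 \<le> a \<Longrightarrow> \<bar>b\<bar> \<le> c \<Longrightarrow> \<bar>- a + b\<bar> \<le> a + c" for a b c :: real by linarith
      have "\<bar>\<theta> s * Re (cnj (dk k * w s k) * q s k)\<bar> \<le> 1 * \<bar>Re (cnj (dk k * w s k) * q s k)\<bar>"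
        unfolding abs_mult using \<theta> by (intro mult_right_mono) auto
      also have "\<dots> \<le> cmod (dk k * w s k) * cmod (q s k)"
        using abs_Re_le_cmod[of "cnj (dk k * w s k) * q s k"] by (simp only: norm_mult complex_mod_cnj mult_1)
      finally show "norm (D k s) \<le> 2 * \<nu> * (cmod (dk k * w s k))\<^sup>2 + cmod (dk k * w s k) * cmod (q s k)"
        using aux[of "2 * \<nu> * (cmod (dk k * w s k))\<^sup>2"] \<nu> unfolding D_def real_norm_def by simp
    qed
    also have "\<dots> = 2 * \<nu> * (\<Sum>k\<in>isym N. (cmod (dk k * w s k))\<^sup>2) + (\<Sum>k\<in>isym N. cmod (dk k * w s k) * cmod (q s k))"
      by (simp add: sum.distrib sum_distrib_left)
    also have "\<dots> \<le> C"
      unfolding C_def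
    proof (intro add_mono mult_left_mono)
      have sw: "sqs (\<lambda>k. dk k * w s k)" unfolding w_def by (rule sqs_dk_uc[OF n])
      have "(\<Sum>k\<in>isym N. (cmod (dk k * w s k))\<^sup>2) \<le> E1 n (W s)"
        unfolding E1_def using sqs_sum_le[OF sw, of "isym N"] by (simp add: w_def)
      then show "(\<Sum>k\<in>isym N. (cmod (dk k * w s k))\<^sup>2) \<le> B\<^sup>2" using E1_W_bound[OF s] by simp
      have sq: "sqs (q s)" "nsq (q s) \<le> (nl1 (uc n (u s)))\<^sup>2 * nsq (uc n (u s))"
        unfolding q_def by (intro young_conv l1_uc n sqs_uc)+
      have ub: "norm (u s) \<le> B + M"
        using norm_triangle_ineq[of "W s" "V s"] bW[OF s] bV[OF s] by (simp add: u_def)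
      have "(nl1 (uc n (u s)))\<^sup>2 \<le> E1 n (u s)"
        using power_mono[OF l1_uc(2)[OF n, of "u s"], of 2] by simp
      also have "\<dots> \<le> (norm (u s))\<^sup>2" by (rule E1_le[OF n])
      also have "\<dots> \<le> (B + M)\<^sup>2" using ub by (intro power_mono) auto
      finally have 1: "(nl1 (uc n (u s)))\<^sup>2 \<le> (B + M)\<^sup>2" .
      have 2: "nsq (uc n (u s)) \<le> (B + M)\<^sup>2"
        using nsq_uc_le[of n "u s"] power_mono[OF ub, of 2] by simp
      have "nsq (q s) \<le> (B + M)\<^sup>2 * (B + M)\<^sup>2"
        using sq(2) mult_mono[OF 1 2] by simp
      moreover have "(\<Sum>k\<in>isym N. cmod (dk k * w s k) * cmod (q s k)) \<le> sqrt (E1 n (W s)) * sqrt (nsq (q s))"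
        using sqs_cauchy_schwarz[OF sw sq(1)] unfolding E1_def w_def
        by (intro order_trans[OF finite_sum_le_infsum]) auto
      moreover have "sqrt (E1 n (W s)) * sqrt (nsq (q s)) \<le> sqrt (B\<^sup>2) * sqrt ((B + M)\<^sup>2 * (B + M)\<^sup>2)"
        using E1_W_bound[OF s] calculation(1) by (intro mult_mono real_sqrt_le_mono) auto
      ultimately show "(\<Sum>k\<in>isym N. cmod (dk k * w s k) * cmod (q s k)) \<le> sqrt (B\<^sup>2) * sqrt ((B + M)\<^sup>2 * (B + M)\<^sup>2)"
        by linarith
    qed (use \<nu> in auto)
    finally show ?thesis .
  qed
  have Sm: "S N \<in> borel_measurable ?M" for N using iS by (rule borel_measurable_integrable)
  have Dm: "Dl \<in> borel_measurable ?M"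
    using Slim by (intro borel_measurable_LIMSEQ_metric[OF Sm])
  have lim: "AE s in ?M. (\<lambda>N. S N s) \<longlonglongrightarrow> Dl s" using Slim by (intro AE_I2)
  have bd: "AE s in ?M. norm (S N s) \<le> C" for N using Sb t by (intro AE_I2) auto
  have iC: "integrable ?M (\<lambda>s. C)" by (rule integrable_continuous_Icc) (intro continuous_intros)
  have iDl: "integrable ?M Dl" by (rule integrable_dominated_convergence[OF Dm Sm iC lim bd])
  have "(\<lambda>N. LINT s|?M. S N s) \<longlonglongrightarrow> (LINT s|?M. Dl s)"
    by (rule integral_dominated_convergence[OF Dm Sm iC lim bd])
  moreover have "(LINT s|?M. S N s) = (\<Sum>k\<in>isym N. (cmod (w t k))\<^sup>2)" for N
    unfolding S_def iD(2) by (rule Bochner_Integration.integral_sum) (rule iD)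
  moreover have "(\<lambda>N. \<Sum>k\<in>isym N. (cmod (w t k))\<^sup>2) \<longlonglongrightarrow> nsq (uc n (W t))"
    unfolding w_def by (rule nsq_isym_tendsto[OF sqs_uc])
  ultimately have eq: "nsq (uc n (W t)) = (LINT s|?M. Dl s)" by (simp add: LIMSEQ_unique)
  have iN: "integrable ?M (\<lambda>s. 2 * M\<^sup>2 / \<nu> * nsq (uc n (W s)) + M ^ 4 / (2 * \<nu>))"
    using integrable_nsq_W[OF t] integrable_continuous_Icc[of 0 t "\<lambda>s. M ^ 4 / (2 * \<nu>)"]
    by (intro Bochner_Integration.integrable_add integrable_mult_right) auto
  have "(LINT s|?M. Dl s) \<le> (LINT s|?M. (2 * M\<^sup>2 / \<nu> * nsq (uc n (W s)) + M ^ 4 / (2 * \<nu>)) - \<nu> * E1 n (W s))"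
  proof (rule integral_mono[OF iDl])
    show "integrable ?M (\<lambda>s. (2 * M\<^sup>2 / \<nu> * nsq (uc n (W s)) + M ^ 4 / (2 * \<nu>)) - \<nu> * E1 n (W s))"
      using iN integrable_E1_W[OF t] by (intro Bochner_Integration.integrable_diff integrable_mult_right)
    fix s assume "s \<in> space ?M"
    then have s: "s \<in> {0..T}" using t by auto
    define I where "I = (\<Sum>\<^sub>\<infinity>k. cnj (dk k * w s k) * q s k)"
    have "\<theta> s * Re I \<le> 1 * cmod I"
    proof -
      have "\<theta> s * Re I \<le> \<theta> s * cmod I" using \<theta> by (intro mult_left_mono complex_Re_le_cmod)
      also have "\<dots> \<le> 1 * cmod I" using \<theta> by (intro mult_right_mono) auto
      finally show ?thesis .
    qed
    also have "1 * cmod I \<le> sqrt (E1 n (W s)) * (norm (V s) * (2 * sqrt (nsq (uc n (W s))) + norm (V s)))"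
      using ef(2)[of s] by (simp add: I_def w_def)
    also have "\<dots> \<le> sqrt (E1 n (W s)) * (M * (2 * sqrt (nsq (uc n (W s))) + M))"
      using bV[OF s] M_nonneg by (intro mult_left_mono mult_mono add_mono) auto
    also have "\<dots> \<le> \<nu> * E1 n (W s) + (2 * M\<^sup>2 / \<nu> * nsq (uc n (W s)) + M ^ 4 / (2 * \<nu>))"
      by (rule bound_flux[OF \<nu> M_nonneg]) auto
    finally show "Dl s \<le> (2 * M\<^sup>2 / \<nu> * nsq (uc n (W s)) + M ^ 4 / (2 * \<nu>)) - \<nu> * E1 n (W s)"
      unfolding Dl_def I_def by linarith
  qed
  also have "\<dots> = (LINT s|?M. 2 * M\<^sup>2 / \<nu> * nsq (uc n (W s)) + M ^ 4 / (2 * \<nu>)) - \<nu> * (LINT s|?M. E1 n (W s))"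
    using iN integrable_E1_W[OF t] by (subst Bochner_Integration.integral_diff) auto
  finally show ?thesis using eq by simp
qed

end

text \<open>Bounds, in this order, for the supremum of \<open>\<parallel>w\<parallel>\<^sup>2\<close>, the integral of \<open>\<parallel>w\<parallel>\<^sub>1\<^sup>2\<close>, the exponent in
  Gronwall's inequality for \<open>\<parallel>w\<parallel>\<^sub>n\<^sup>2\<close>, the supremum of \<open>\<parallel>w\<parallel>\<^sub>n\<^sup>2\<close>, and the integral of \<open>\<parallel>w\<parallel>\<^sub>n\<^sub>+\<^sub>1\<^sup>2\<close>,
  where \<open>M\<close> bounds \<open>\<parallel>v\<parallel>\<^sub>n\<close>.\<close>

definition apL2 :: "real \<Rightarrow> real \<Rightarrow> real \<Rightarrow> real" where
  "apL2 \<nu> T M = T * (M ^ 4 / (2 * \<nu>)) * exp (T * (2 * M\<^sup>2 / \<nu>))"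

definition apH1 :: "real \<Rightarrow> real \<Rightarrow> real \<Rightarrow> real" where
  "apH1 \<nu> T M = T * (2 * M\<^sup>2 / \<nu> * apL2 \<nu> T M + M ^ 4 / (2 * \<nu>)) / \<nu>"

definition apK :: "nat \<Rightarrow> real \<Rightarrow> real \<Rightarrow> real \<Rightarrow> real" where
  "apK n \<nu> T M = conv_bound n / (2 * \<nu>) * (2 * apH1 \<nu> T M + 2 * M\<^sup>2 * T)"

definition apSup :: "nat \<Rightarrow> real \<Rightarrow> real \<Rightarrow> real \<Rightarrow> real" where
  "apSup n \<nu> T M = M\<^sup>2 * apK n \<nu> T M * exp (apK n \<nu> T M)"

definition apInt :: "nat \<Rightarrow> real \<Rightarrow> real \<Rightarrow> real \<Rightarrow> real" where
  "apInt n \<nu> T M = apK n \<nu> T M * (apSup n \<nu> T M + M\<^sup>2) / \<nu>"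

context truncated_burgers
begin

lemma L2_bound:
  assumes t: "t \<in> {0..T}" shows "nsq (uc n (W t)) \<le> apL2 \<nu> T M"
proof -
  have "nsq (uc n (W t)) \<le> T * (M ^ 4 / (2 * \<nu>)) * exp (LINT s|Leb t. 2 * M\<^sup>2 / \<nu>)"
  proof (rule gronwall[OF _ _ _ _ _ t])
    show "integrable (Leb T) (\<lambda>s. 2 * M\<^sup>2 / \<nu>)"
      by (rule integrable_continuous_Icc) (intro continuous_intros)
    show "(\<lambda>t. nsq (uc n (W t))) \<in> borel_measurable (Leb T)"
      by (intro borel_imp_lebesgue_on rcont_nsq_uc_measurable rW)
    show "\<bar>nsq (uc n (W t))\<bar> \<le> B\<^sup>2" if "t \<in> {0..T}" for t using nsq_W_bound[OF that] by simp
    fix t assume t: "t \<in> {0..T}"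
    have "0 \<le> (LINT s|Leb t. E1 n (W s))" by (rule Bochner_Integration.integral_nonneg) simp
    then have "nsq (uc n (W t)) \<le> (LINT s|Leb t. 2 * M\<^sup>2 / \<nu> * nsq (uc n (W s)) + M ^ 4 / (2 * \<nu>))"
      using energy_L2[OF t] \<nu> mult_nonneg_nonneg[of \<nu> "LINT s|Leb t. E1 n (W s)"] by linarith
    also have "\<dots> = (LINT s|Leb t. 2 * M\<^sup>2 / \<nu> * nsq (uc n (W s))) + t * (M ^ 4 / (2 * \<nu>))"
      using integrable_nsq_W[OF t] integrable_continuous_Icc[of 0 t "\<lambda>s. M ^ 4 / (2 * \<nu>)"] t
      by (subst Bochner_Integration.integral_add) (auto simp: LINT_const_Icc simp del: lebesgue_integral_const)
    also have "t * (M ^ 4 / (2 * \<nu>)) \<le> T * (M ^ 4 / (2 * \<nu>))"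
      using t \<nu> by (intro mult_right_mono) auto
    finally show "nsq (uc n (W t)) \<le> T * (M ^ 4 / (2 * \<nu>)) + (LINT s|Leb t. 2 * M\<^sup>2 / \<nu> * nsq (uc n (W s)))"
      by simp
  qed (use \<nu> in auto)
  also have "(LINT s|Leb t. 2 * M\<^sup>2 / \<nu>) = t * (2 * M\<^sup>2 / \<nu>)"
    using t LINT_const_Icc[of 0 t "2 * M\<^sup>2 / \<nu>"] by simp
  also have "T * (M ^ 4 / (2 * \<nu>)) * exp (t * (2 * M\<^sup>2 / \<nu>)) \<le> T * (M ^ 4 / (2 * \<nu>)) * exp (T * (2 * M\<^sup>2 / \<nu>))"
    using t T \<nu> by (intro mult_left_mono) (auto intro!: mult_right_mono divide_right_mono)
  finally show ?thesis by (simp add: apL2_def)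
qed

text \<open>The L^2 bound was obtained by discarding the dissipation; inserted back into the energy
  inequality, it now bounds that dissipation.\<close>

lemma H1_bound: "(LINT s|Leb T. E1 n (W s)) \<le> apH1 \<nu> T M"
proof -
  have T0: "T \<in> {0..T}" using T by simp
  have "\<nu> * (LINT s|Leb T. E1 n (W s))
      \<le> (LINT s|Leb T. 2 * M\<^sup>2 / \<nu> * nsq (uc n (W s)) + M ^ 4 / (2 * \<nu>))"
    using energy_L2[OF T0] nsq_nonneg[of "uc n (W T)"] by linarith
  also have "\<dots> \<le> (LINT s|Leb T. 2 * M\<^sup>2 / \<nu> * apL2 \<nu> T M + M ^ 4 / (2 * \<nu>))"
  proof (rule integral_mono)
    show "integrable (Leb T) (\<lambda>s. 2 * M\<^sup>2 / \<nu> * nsq (uc n (W s)) + M ^ 4 / (2 * \<nu>))"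
      using integrable_nsq_W[OF T0] integrable_continuous_Icc[of 0 T "\<lambda>s. M ^ 4 / (2 * \<nu>)"]
      by (intro Bochner_Integration.integrable_add integrable_mult_right) auto
    show "integrable (Leb T) (\<lambda>s. 2 * M\<^sup>2 / \<nu> * apL2 \<nu> T M + M ^ 4 / (2 * \<nu>))"
      by (rule integrable_continuous_Icc) (intro continuous_intros)
    show "2 * M\<^sup>2 / \<nu> * nsq (uc n (W s)) + M ^ 4 / (2 * \<nu>) \<le> 2 * M\<^sup>2 / \<nu> * apL2 \<nu> T M + M ^ 4 / (2 * \<nu>)"
      if "s \<in> space (Leb T)" for s
      using that \<nu> L2_bound[of s] by (intro add_right_mono mult_left_mono) auto
  qed
  also have "\<dots> = T * (2 * M\<^sup>2 / \<nu> * apL2 \<nu> T M + M ^ 4 / (2 * \<nu>))"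
    using T LINT_const_Icc[of 0 T "2 * M\<^sup>2 / \<nu> * apL2 \<nu> T M + M ^ 4 / (2 * \<nu>)"] by simp
  finally show ?thesis using \<nu> by (simp add: apH1_def field_simps)
qed

text \<open>The Gronwall coefficient for the squared H^n norm: \<open>1 / (4 * \<nu>)\<close> comes
  from the heat estimate, \<open>conv_bound n\<close> from the product estimate, and a factor 2 from
  splitting the square of \<open>norm (W s + V s)\<close>. Pointwise it is bounded only in terms of
  \<open>B\<close>, but its integral is bounded by \<open>apK\<close>, which does not contain
  \<open>B\<close>.\<close>

definition \<kappa> :: "real \<Rightarrow> real" where "\<kappa> s = conv_bound n / (2 * \<nu>) * E1 n (W s + V s)"

lemma \<kappa>_nonneg: "0 \<le> \<kappa> s" using \<nu> by (simp add: \<kappa>_def conv_bound_def)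

lemma integrable_\<kappa>: "t \<in> {0..T} \<Longrightarrow> integrable (Leb t) \<kappa>"
proof -
  assume t: "t \<in> {0..T}"
  have "integrable (Leb t) (\<lambda>s. E1 n (W s + V s))"
  proof (rule integrable_bounded_Icc)
    show "(\<lambda>s. E1 n (W s + V s)) \<in> borel_measurable (Leb t)"
      by (intro borel_imp_lebesgue_on rcont_E1_measurable n rcont_add rW rV)
    fix s assume "s \<in> {0..t}"
    then have s: "s \<in> {0..T}" using t by auto
    have "norm (W s + V s) \<le> B + M" using norm_triangle_ineq[of "W s" "V s"] bW[OF s] bV[OF s] by simp
    from power_mono[OF this, of 2] show "norm (E1 n (W s + V s)) \<le> (B + M)\<^sup>2"
      using E1_le[OF n, of "W s + V s"] by simp
  qed
  then show ?thesis unfolding \<kappa>_def by simp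
qed

lemma LINT_\<kappa>: "(LINT s|Leb T. \<kappa> s) \<le> apK n \<nu> T M"
proof -
  have T0: "T \<in> {0..T}" using T by simp
  have i: "integrable (Leb T) (\<lambda>s. 2 * E1 n (W s) + 2 * M\<^sup>2)"
    using integrable_E1_W[OF T0] integrable_continuous_Icc[of 0 T "\<lambda>s. 2 * M\<^sup>2"] by simp
  have "(LINT s|Leb T. \<kappa> s) \<le> (LINT s|Leb T. conv_bound n / (2 * \<nu>) * (2 * E1 n (W s) + 2 * M\<^sup>2))"
  proof (rule integral_mono[OF integrable_\<kappa>[OF T0]])
    show "integrable (Leb T) (\<lambda>s. conv_bound n / (2 * \<nu>) * (2 * E1 n (W s) + 2 * M\<^sup>2))" using i by simp
    fix s assume "s \<in> space (Leb T)"
    then have s: "s \<in> {0..T}" by simp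
    have "E1 n (V s) \<le> M\<^sup>2" using E1_le[OF n, of "V s"] power_mono[OF bV[OF s], of 2] by simp
    then have "E1 n (W s + V s) \<le> 2 * E1 n (W s) + 2 * M\<^sup>2" using E1_add[OF n, of "W s" "V s"] by linarith
    then show "\<kappa> s \<le> conv_bound n / (2 * \<nu>) * (2 * E1 n (W s) + 2 * M\<^sup>2)"
      unfolding \<kappa>_def using \<nu> by (intro mult_left_mono) (auto simp: conv_bound_def)
  qed
  also have "\<dots> = conv_bound n / (2 * \<nu>) * (2 * (LINT s|Leb T. E1 n (W s)) + T * (2 * M\<^sup>2))"
    unfolding integral_mult_right_zero using integrable_E1_W[OF T0] integrable_continuous_Icc[of 0 T "\<lambda>s. 2 * M\<^sup>2"] T
    by (subst Bochner_Integration.integral_add) (auto simp: LINT_const_Icc simp del: lebesgue_integral_const)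
  also have "\<dots> \<le> conv_bound n / (2 * \<nu>) * (2 * apH1 \<nu> T M + T * (2 * M\<^sup>2))"
    using H1_bound \<nu> by (intro mult_left_mono) (auto simp: conv_bound_def)
  finally show ?thesis by (simp add: apK_def mult_ac)
qed

lemma LINT_\<kappa>_le: assumes t: "t \<in> {0..T}" shows "(LINT s|Leb t. \<kappa> s) \<le> apK n \<nu> T M"
proof -
  have T0: "T \<in> {0..T}" using T by simp
  have "(LINT s|Leb t. \<kappa> s) = (LINT s|Leb T. (if s \<le> t then \<kappa> s else 0))"
    using LINT_lebesgue_on_if[of t T 0 \<kappa>] t by simp
  also have "\<dots> \<le> (LINT s|Leb T. \<kappa> s)"
    using integrable_\<kappa>[OF T0] \<kappa>_nonneg by (intro integral_mono') auto
  finally show ?thesis using LINT_\<kappa> by simp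
qed

lemma flux_bound:
  assumes s: "s \<in> {0..T}"
  shows "(1 / (4 * \<nu>)) * (norm (\<theta> s *\<^sub>R Bx n (W s + V s) (W s + V s)))\<^sup>2 \<le> \<kappa> s * ((norm (W s))\<^sup>2 + M\<^sup>2)"
proof -
  have "(norm (\<theta> s *\<^sub>R Bx n (W s + V s) (W s + V s)))\<^sup>2 \<le> (1 * norm (Bx n (W s + V s) (W s + V s)))\<^sup>2"
    unfolding norm_scaleR using \<theta> by (intro power_mono mult_right_mono) auto
  also have "\<dots> \<le> conv_bound n * E1 n (W s + V s) * (norm (W s + V s))\<^sup>2"
    using norm_Bx_diag_sq[OF n, of "W s + V s"] by simp
  also have "\<dots> \<le> conv_bound n * E1 n (W s + V s) * (2 * (norm (W s))\<^sup>2 + 2 * M\<^sup>2)"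
  proof (rule mult_left_mono)
    have "(norm (W s + V s))\<^sup>2 \<le> (norm (W s) + M)\<^sup>2"
      using norm_triangle_ineq[of "W s" "V s"] bV[OF s] by (intro power_mono) auto
    also have "\<dots> \<le> 2 * (norm (W s))\<^sup>2 + 2 * M\<^sup>2"
      using sum_squares_bound[of "norm (W s)" M] by (simp add: power2_sum)
    finally show "(norm (W s + V s))\<^sup>2 \<le> 2 * (norm (W s))\<^sup>2 + 2 * M\<^sup>2" .
  qed (simp add: conv_bound_def)
  finally have "(1 / (4 * \<nu>)) * (norm (\<theta> s *\<^sub>R Bx n (W s + V s) (W s + V s)))\<^sup>2
      \<le> (1 / (4 * \<nu>)) * (conv_bound n * E1 n (W s + V s) * (2 * (norm (W s))\<^sup>2 + 2 * M\<^sup>2))"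
    using \<nu> by (intro mult_left_mono) auto
  also have "\<dots> = \<kappa> s * ((norm (W s))\<^sup>2 + M\<^sup>2)" using \<nu> by (simp add: \<kappa>_def field_simps)
  finally show ?thesis .
qed

lemma rcont_flux: "rcont (\<lambda>s. \<theta> s *\<^sub>R Bx n (W s + V s) (W s + V s))"
  by (intro rcont_scaleR r\<theta> rcont_compose[of _ "\<lambda>x. Bx n x x"] rcont_add rW rV isCont_Bx_diag[OF n])

lemma norm_flux_le:
  assumes s: "s \<in> {0..T}"
  shows "norm (\<theta> s *\<^sub>R Bx n (W s + V s) (W s + V s)) \<le> sqrt (conv_bound n) * (B + M) * (B + M)"
proof -
  have u: "norm (W s + V s) \<le> B + M" using norm_triangle_ineq[of "W s" "V s"] bW[OF s] bV[OF s] by simp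
  have "norm (\<theta> s *\<^sub>R Bx n (W s + V s) (W s + V s)) \<le> 1 * norm (Bx n (W s + V s) (W s + V s))"
    unfolding norm_scaleR using \<theta> by (intro mult_right_mono) auto
  also have "\<dots> \<le> sqrt (conv_bound n) * norm (W s + V s) * norm (W s + V s)"
    using norm_Bx_le[OF n] by simp
  also have "\<dots> \<le> sqrt (conv_bound n) * (B + M) * (B + M)"
    using u B_nonneg M_nonneg by (intro mult_mono) (auto simp: conv_bound_def)
  finally show ?thesis .
qed

lemma integrable_\<kappa>_mult:
  assumes t: "t \<in> {0..T}" shows "integrable (Leb t) (\<lambda>s. \<kappa> s * (norm (W s))\<^sup>2)"
proof (rule Bochner_Integration.integrable_bound)
  show "integrable (Leb t) (\<lambda>s. B\<^sup>2 * \<kappa> s)" using integrable_\<kappa>[OF t] by simp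
  have [measurable]: "(\<lambda>s. norm (W s)) \<in> borel_measurable (Leb t)"
    by (intro borel_imp_lebesgue_on rcont_norm_measurable rW)
  have [measurable]: "\<kappa> \<in> borel_measurable (Leb t)" using integrable_\<kappa>[OF t] by simp
  show "(\<lambda>s. \<kappa> s * (norm (W s))\<^sup>2) \<in> borel_measurable (Leb t)" by measurable
  show "AE s in Leb t. norm (\<kappa> s * (norm (W s))\<^sup>2) \<le> norm (B\<^sup>2 * \<kappa> s)"
  proof (rule AE_I2)
    fix s assume "s \<in> space (Leb t)"
    then have "s \<in> {0..T}" using t by auto
    from mult_right_mono[OF power_mono[OF bW[OF this] norm_ge_zero, of 2] \<kappa>_nonneg[of s]]
    show "norm (\<kappa> s * (norm (W s))\<^sup>2) \<le> norm (B\<^sup>2 * \<kappa> s)"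
      using \<kappa>_nonneg[of s] by (simp add: abs_mult mult.commute)
  qed
qed

text \<open>Separates the part proportional to the squared norm of \<open>W\<close>, destined for
  Gronwall's inequality, from the part \<open>M\<^sup>2 * \<kappa>\<close>, whose integral is
  already controlled. Both a priori bounds start from it.\<close>

lemma flux_integral_bound:
  assumes t: "t \<in> {0..T}"
  shows "(1 / (4 * \<nu>)) * (LINT s|Leb t. (norm (\<theta> s *\<^sub>R Bx n (W s + V s) (W s + V s)))\<^sup>2)
    \<le> M\<^sup>2 * apK n \<nu> T M + (LINT s|Leb t. \<kappa> s * (norm (W s))\<^sup>2)"
proof -
  let ?M = "Leb t"
  have "(1 / (4 * \<nu>)) * (LINT s|?M. (norm (\<theta> s *\<^sub>R Bx n (W s + V s) (W s + V s)))\<^sup>2)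
      = (LINT s|?M. (1 / (4 * \<nu>)) * (norm (\<theta> s *\<^sub>R Bx n (W s + V s) (W s + V s)))\<^sup>2)" by simp
  also have "\<dots> \<le> (LINT s|?M. \<kappa> s * (norm (W s))\<^sup>2 + M\<^sup>2 * \<kappa> s)"
  proof (rule integral_mono)
    have [measurable]: "(\<lambda>s. norm (\<theta> s *\<^sub>R Bx n (W s + V s) (W s + V s))) \<in> borel_measurable ?M"
      by (intro borel_imp_lebesgue_on rcont_norm_measurable rcont_flux)
    have "integrable ?M (\<lambda>s. (norm (\<theta> s *\<^sub>R Bx n (W s + V s) (W s + V s)))\<^sup>2)"
    proof (rule integrable_bounded_Icc)
      fix s assume "s \<in> {0..t}"
      then have "s \<in> {0..T}" using t by auto
      from power_mono[OF norm_flux_le[OF this], of 2]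
      show "norm ((norm (\<theta> s *\<^sub>R Bx n (W s + V s) (W s + V s)))\<^sup>2) \<le> (sqrt (conv_bound n) * (B + M) * (B + M))\<^sup>2" by simp
    qed measurable
    then show "integrable ?M (\<lambda>s. (1 / (4 * \<nu>)) * (norm (\<theta> s *\<^sub>R Bx n (W s + V s) (W s + V s)))\<^sup>2)" by simp
    show "integrable ?M (\<lambda>s. \<kappa> s * (norm (W s))\<^sup>2 + M\<^sup>2 * \<kappa> s)"
      using integrable_\<kappa>_mult[OF t] integrable_\<kappa>[OF t] by simp
    show "(1 / (4 * \<nu>)) * (norm (\<theta> s *\<^sub>R Bx n (W s + V s) (W s + V s)))\<^sup>2 \<le> \<kappa> s * (norm (W s))\<^sup>2 + M\<^sup>2 * \<kappa> s"
      if "s \<in> space ?M" for s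
      using that t flux_bound[of s] by (auto simp: distrib_left mult.commute)
  qed
  also have "\<dots> = (LINT s|?M. \<kappa> s * (norm (W s))\<^sup>2) + M\<^sup>2 * (LINT s|?M. \<kappa> s)"
    using integrable_\<kappa>_mult[OF t] integrable_\<kappa>[OF t] by (subst Bochner_Integration.integral_add) auto
  also have "M\<^sup>2 * (LINT s|?M. \<kappa> s) \<le> M\<^sup>2 * apK n \<nu> T M"
    using LINT_\<kappa>_le[OF t] by (intro mult_left_mono) auto
  finally show ?thesis by simp
qed

lemma apK_nonneg: "0 \<le> apK n \<nu> T M"
proof -
  have "0 \<le> (LINT s|Leb T. \<kappa> s)" by (rule Bochner_Integration.integral_nonneg) (rule \<kappa>_nonneg)
  then show ?thesis using LINT_\<kappa> by linarith
qed

lemma apriori_sup: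
  assumes t: "t \<in> {0..T}" shows "(norm (W t))\<^sup>2 \<le> apSup n \<nu> T M"
proof -
  have "(norm (W t))\<^sup>2 \<le> M\<^sup>2 * apK n \<nu> T M * exp (LINT s|Leb t. \<kappa> s)"
  proof (rule gronwall[OF _ \<kappa>_nonneg _ _ _ t])
    show "integrable (Leb T) \<kappa>" using integrable_\<kappa>[of T] T by simp
    have [measurable]: "(\<lambda>s. norm (W s)) \<in> borel_measurable (Leb T)"
      by (intro borel_imp_lebesgue_on rcont_norm_measurable rW)
    show "(\<lambda>t. (norm (W t))\<^sup>2) \<in> borel_measurable (Leb T)" by measurable
    show "\<bar>(norm (W t))\<^sup>2\<bar> \<le> B\<^sup>2" if "t \<in> {0..T}" for t
      using power_mono[OF bW[OF that], of 2] by simp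
    fix t assume t: "t \<in> {0..T}"
    show "(norm (W t))\<^sup>2 \<le> M\<^sup>2 * apK n \<nu> T M + (LINT s|Leb t. \<kappa> s * (norm (W s))\<^sup>2)"
      using heat_sol_estimate(1)[OF \<nu> sol rW rcont_flux bW norm_flux_le t] flux_integral_bound[OF t] by linarith
  qed
  also have "\<dots> \<le> apSup n \<nu> T M"
    unfolding apSup_def using LINT_\<kappa>_le[OF t] apK_nonneg by (intro mult_left_mono) auto
  finally show ?thesis .
qed

lemma apriori_int:
  assumes "finite K"
  shows "(LINT s|Leb T. (\<Sum>k\<in>K. (lam k)\<^sup>2 * (cmod (cf (W s) k))\<^sup>2)) \<le> apInt n \<nu> T M"
proof -
  have t: "T \<in> {0..T}" using T by simp
  have "\<nu> * (LINT s|Leb T. (\<Sum>k\<in>K. (lam k)\<^sup>2 * (cmod (cf (W s) k))\<^sup>2))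
      \<le> M\<^sup>2 * apK n \<nu> T M + (LINT s|Leb T. \<kappa> s * (norm (W s))\<^sup>2)"
    using heat_sol_estimate(2)[OF \<nu> sol rW rcont_flux bW norm_flux_le t assms] flux_integral_bound[OF t] by linarith
  also have "(LINT s|Leb T. \<kappa> s * (norm (W s))\<^sup>2) \<le> (LINT s|Leb T. apSup n \<nu> T M * \<kappa> s)"
  proof (rule integral_mono[OF integrable_\<kappa>_mult[OF t]])
    show "integrable (Leb T) (\<lambda>s. apSup n \<nu> T M * \<kappa> s)" using integrable_\<kappa>[OF t] by simp
    fix s assume "s \<in> space (Leb T)"
    then show "\<kappa> s * (norm (W s))\<^sup>2 \<le> apSup n \<nu> T M * \<kappa> s"
      using mult_right_mono[OF apriori_sup[of s] \<kappa>_nonneg[of s]] by (simp add: mult.commute)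
  qed
  also have "\<dots> \<le> apSup n \<nu> T M * apK n \<nu> T M"
    using LINT_\<kappa> apK_nonneg by (auto intro!: mult_left_mono simp: apSup_def)
  finally have "\<nu> * (LINT s|Leb T. (\<Sum>k\<in>K. (lam k)\<^sup>2 * (cmod (cf (W s) k))\<^sup>2))
      \<le> apK n \<nu> T M * (apSup n \<nu> T M + M\<^sup>2)" by (simp add: algebra_simps)
  then show ?thesis using \<nu> by (simp add: apInt_def field_simps)
qed

end

section \<open>Existence of solutions in Fourier coefficients\<close>

lemma borel_measurable_if_le:
  fixes f :: "real \<Rightarrow> 'a::euclidean_space"
  assumes [measurable]: "(\<lambda>x. x) \<in> borel_measurable M" "f \<in> borel_measurable M"
  shows "(\<lambda>r. if r \<le> s then f r else 0) \<in> borel_measurable M"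
  by measurable

lemma continuous_on_indefinite_integral:
  fixes f :: "real \<Rightarrow> 'a::euclidean_space"
  assumes m: "f \<in> borel_measurable (Leb T)" and b: "\<And>s. s \<in> {0..T} \<Longrightarrow> norm (f s) \<le> B"
  shows "continuous_on {0..T} (\<lambda>t. LINT s|Leb t. f s)"
proof -
  let ?F = "\<lambda>t. LINT s|Leb t. f s"
  have lip: "dist (?F t) (?F s) \<le> \<bar>B\<bar> * dist t s" if "s \<in> {0..T}" "t \<in> {0..T}" "s \<le> t" for s t
  proof -
    have if_t: "integrable (Leb t) f"
      using that by (intro integrable_bounded_Icc[OF measurable_lebesgue_on_mono[OF m] b]) auto
    have fm: "f \<in> borel_measurable (Leb t)" using if_t by simp
    have idm: "(\<lambda>x. x) \<in> borel_measurable (Leb t)" by (rule borel_imp_lebesgue_on) simp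
    have i1: "integrable (Leb t) (\<lambda>r. if r \<le> s then f r else 0)"
      by (rule Bochner_Integration.integrable_bound[OF if_t borel_measurable_if_le[OF idm fm]]) auto
    have i2: "integrable (Leb t) (\<lambda>r. if r \<le> s then \<bar>B\<bar> else 0)"
      by (rule integrable_bounded_Icc[OF borel_measurable_if_le[OF idm], where B = "\<bar>B\<bar>"]) auto
    have i3: "integrable (Leb t) (\<lambda>r. \<bar>B\<bar>)"
      by (rule integrable_continuous_Icc) (intro continuous_intros)
    have eq: "?F t - ?F s = (LINT r|Leb t. f r - (if r \<le> s then f r else 0))"
      using if_t i1 LINT_lebesgue_on_if[of s t 0 f] that by (subst Bochner_Integration.integral_diff) auto
    have "norm (?F t - ?F s) \<le> (LINT r|Leb t. norm (f r - (if r \<le> s then f r else 0)))"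
      unfolding eq by (rule integral_norm_bound)
    also have "\<dots> \<le> (LINT r|Leb t. \<bar>B\<bar> - (if r \<le> s then \<bar>B\<bar> else 0))"
    proof (rule integral_mono)
      show "integrable (Leb t) (\<lambda>r. norm (f r - (if r \<le> s then f r else 0)))" using if_t i1 by auto
      show "integrable (Leb t) (\<lambda>r. \<bar>B\<bar> - (if r \<le> s then \<bar>B\<bar> else 0))" using i2 i3 by auto
      fix r assume "r \<in> space (Leb t)"
      then have "norm (f r) \<le> \<bar>B\<bar>" using b[of r] that by auto
      then show "norm (f r - (if r \<le> s then f r else 0)) \<le> \<bar>B\<bar> - (if r \<le> s then \<bar>B\<bar> else 0)" by auto
    qed
    also have "\<dots> = \<bar>B\<bar> * (t - s)"
    proof -
      have "(LINT r|Leb t. \<bar>B\<bar> - (if r \<le> s then \<bar>B\<bar> else 0))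
          = (LINT r|Leb t. \<bar>B\<bar>) - (LINT r|Leb t. (if r \<le> s then \<bar>B\<bar> else 0))"
        by (rule Bochner_Integration.integral_diff[OF i3 i2])
      also have "\<dots> = t * \<bar>B\<bar> - s * \<bar>B\<bar>"
        using that LINT_lebesgue_on_if[of s t 0 "\<lambda>r. \<bar>B\<bar>"] LINT_const_Icc[of 0 t "\<bar>B\<bar>"] LINT_const_Icc[of 0 s "\<bar>B\<bar>"]
        by (simp del: lebesgue_integral_const)
      finally show ?thesis by (simp add: algebra_simps)
    qed
    finally show ?thesis using that by (simp add: dist_norm)
  qed
  have "dist (?F t) (?F s) \<le> \<bar>B\<bar> * dist t s" if "s \<in> {0..T}" "t \<in> {0..T}" for s t
    using lip[OF that] lip[OF that(2,1)] by (cases "s \<le> t") (auto simp: dist_commute)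
  then have "\<bar>B\<bar>-lipschitz_on {0..T} ?F" by (intro lipschitz_onI) auto
  then show ?thesis by (rule lipschitz_on_continuous_on)
qed

text \<open>Duhamel's formula for one mode with zero initial value. The exponential of
  \<open>t\<close> is kept outside, so that the integrand does not depend on \<open>t\<close> and
  the integral is an indefinite one.\<close>

definition hc :: "real \<Rightarrow> (real \<Rightarrow> hseq) \<Rightarrow> int \<Rightarrow> real \<Rightarrow> complex" where
  "hc \<nu> G k t = exp (- (\<nu> * (lam k)\<^sup>2) * t) * (LINT s|Leb t. exp (\<nu> * (lam k)\<^sup>2 * s) * ((- (1/2) * dk k) * cf (G s) k))"

definition heatX :: "real \<Rightarrow> (real \<Rightarrow> hseq) \<Rightarrow> real \<Rightarrow> hseq" where
  "heatX \<nu> G t = Hseq (\<lambda>k. hc \<nu> G k t)"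

text \<open>Composition with this clamp extends a path on \<open>[0, T]\<close> by constants to the
  whole line.\<close>

definition cl :: "real \<Rightarrow> real \<Rightarrow> real" where "cl T t = max 0 (min T t)"

lemma cl_in [simp]: "0 < T \<Longrightarrow> cl T t \<in> {0..T}" by (auto simp: cl_def)

lemma cl_id [simp]: "t \<in> {0..T} \<Longrightarrow> cl T t = t" by (auto simp: cl_def)

lemma continuous_cl: "continuous_on S (cl T)" unfolding cl_def by (intro continuous_intros)

lemma continuous_imp_rcont: "continuous_on UNIV f \<Longrightarrow> rcont f"
  unfolding rcont_def continuous_on_def by (meson UNIV_I at_le subset_UNIV tendsto_mono)

locale forced_heat =
  fixes \<nu> T B :: real and G :: "real \<Rightarrow> hseq"
  assumes \<nu>: "0 < \<nu>" and T: "0 < T" and rG: "rcont G" and bG: "\<And>s. s \<in> {0..T} \<Longrightarrow> norm (G s) \<le> B"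
begin

lemma cf_G_measurable: "(\<lambda>s. cf (G s) k) \<in> borel_measurable (Leb t)"
  by (intro borel_imp_lebesgue_on rcont_cf_measurable rG)

lemma cf_G_bound: "s \<in> {0..T} \<Longrightarrow> cmod (cf (G s) k) \<le> B"
  using bG[of s] norm_cf_le[of "G s" k] by simp

lemma hc_mode:
  assumes t: "t \<in> {0..T}"
  shows "integrable (Leb t) (heat_mode \<nu> k (hc \<nu> G k) (\<lambda>s. cf (G s) k))"
    "hc \<nu> G k t = (LINT s|Leb t. heat_mode \<nu> k (hc \<nu> G k) (\<lambda>s. cf (G s) k) s)"
proof -
  have i: "integrable (Leb T) (\<lambda>s. (- (1/2) * dk k) * cf (G s) k)"
    by (intro integrable_mult_right integrable_bounded_Icc[OF cf_G_measurable cf_G_bound])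
  have eq: "heat_mode \<nu> k (hc \<nu> G k) (\<lambda>s. cf (G s) k)
      = (\<lambda>s. - complex_of_real (\<nu> * (lam k)\<^sup>2) * hc \<nu> G k s + (- (1/2) * dk k) * cf (G s) k)"
    by (auto simp: heat_mode_def)
  note d = duhamel_mode[OF i, of "hc \<nu> G k" "\<nu> * (lam k)\<^sup>2", OF _ t]
  show "integrable (Leb t) (heat_mode \<nu> k (hc \<nu> G k) (\<lambda>s. cf (G s) k))"
    "hc \<nu> G k t = (LINT s|Leb t. heat_mode \<nu> k (hc \<nu> G k) (\<lambda>s. cf (G s) k) s)"
    unfolding eq using d by (simp_all add: hc_def)
qed

lemma continuous_hc: "continuous_on {0..T} (hc \<nu> G k)"
proof -
  have "continuous_on {0..T} (\<lambda>t. LINT s|Leb t. exp (\<nu> * (lam k)\<^sup>2 * s) * ((- (1/2) * dk k) * cf (G s) k))"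
  proof (rule continuous_on_indefinite_integral)
    have [measurable]: "(\<lambda>s. cf (G s) k) \<in> borel_measurable (Leb T)" by (rule cf_G_measurable)
    have [measurable]: "(\<lambda>x. x) \<in> borel_measurable (Leb T)" by (rule borel_imp_lebesgue_on) simp
    show "(\<lambda>s. exp (\<nu> * (lam k)\<^sup>2 * s) * ((- (1/2) * dk k) * cf (G s) k)) \<in> borel_measurable (Leb T)"
      by measurable
    fix s assume s: "s \<in> {0..T}"
    have "exp (\<nu> * (lam k)\<^sup>2 * s) \<le> exp (\<nu> * (lam k)\<^sup>2 * T)" using s \<nu> by (auto intro: mult_left_mono)
    then have "exp (\<nu> * (lam k)\<^sup>2 * s) * (cmod (- (1/2) * dk k) * cmod (cf (G s) k))
        \<le> exp (\<nu> * (lam k)\<^sup>2 * T) * (cmod (- (1/2) * dk k) * B)"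
      using cf_G_bound[OF s] by (intro mult_mono) auto
    then show "cmod (exp (\<nu> * (lam k)\<^sup>2 * s) * ((- (1/2) * dk k) * cf (G s) k))
        \<le> exp (\<nu> * (lam k)\<^sup>2 * T) * (cmod (- (1/2) * dk k) * B)"
      by (simp only: norm_mult norm_of_real abs_exp_cancel)
  qed
  then show ?thesis unfolding hc_def[abs_def] by (intro continuous_intros)
qed

text \<open>Only the modes in \<open>K\<close> occur on the right. This localisation is what makes
  the tails small in \<open>continuous_heatX\<close>.\<close>

lemma hc_sum_estimate:
  assumes t: "t \<in> {0..T}" and K: "finite K"
  shows "(\<Sum>k\<in>K. (cmod (hc \<nu> G k t))\<^sup>2) \<le> (1 / (4 * \<nu>)) * (LINT s|Leb t. (\<Sum>k\<in>K. (cmod (cf (G s) k))\<^sup>2))"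
proof -
  have iG: "integrable (Leb t) (\<lambda>s. (cmod (cf (G s) k))\<^sup>2)" for k
    by (rule integrable_norm_sq_bounded[OF cf_G_measurable cf_G_bound]) (use t in simp)
  have TT: "T \<in> {0..T}" using T by simp
  have "(cmod (hc \<nu> G k t))\<^sup>2 \<le> (1 / (4 * \<nu>)) * (LINT s|Leb t. (cmod (cf (G s) k))\<^sup>2)" for k
  proof -
    obtain C where C: "\<forall>y\<in>hc \<nu> G k ` {0..T}. cmod y \<le> C"
      using compact_imp_bounded[OF compact_continuous_image[OF continuous_hc compact_Icc]] unfolding bounded_iff by blast
    have "(cmod (hc \<nu> G k t))\<^sup>2 + \<nu> * (LINT s|Leb t. (lam k)\<^sup>2 * (cmod (hc \<nu> G k s))\<^sup>2)
        \<le> (1 / (4 * \<nu>)) * (LINT s|Leb t. (cmod (cf (G s) k))\<^sup>2)"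
    proof (rule mode_estimate[OF \<nu> t hc_mode(1)[OF TT] hc_mode(2) _ cf_G_measurable _ cf_G_bound])
      show "hc \<nu> G k \<in> borel_measurable (Leb T)"
        by (rule continuous_imp_measurable_lebesgue_on[OF continuous_hc]) simp
      show "cmod (hc \<nu> G k s) \<le> C" if "s \<in> {0..T}" for s using C that by blast
    qed
    moreover have "0 \<le> \<nu> * (LINT s|Leb t. (lam k)\<^sup>2 * (cmod (hc \<nu> G k s))\<^sup>2)"
      using \<nu> by (intro mult_nonneg_nonneg Bochner_Integration.integral_nonneg) auto
    ultimately show ?thesis by linarith
  qed
  then have "(\<Sum>k\<in>K. (cmod (hc \<nu> G k t))\<^sup>2) \<le> (\<Sum>k\<in>K. (1 / (4 * \<nu>)) * (LINT s|Leb t. (cmod (cf (G s) k))\<^sup>2))"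
    by (intro sum_mono)
  also have "\<dots> = (1 / (4 * \<nu>)) * (LINT s|Leb t. (\<Sum>k\<in>K. (cmod (cf (G s) k))\<^sup>2))"
    using iG by (simp add: Bochner_Integration.integral_sum sum_distrib_left)
  finally show ?thesis .
qed

lemma integrable_norm_G: assumes t: "t \<in> {0..T}" shows "integrable (Leb t) (\<lambda>s. (norm (G s))\<^sup>2)"
proof (rule integrable_bounded_Icc)
  have [measurable]: "(\<lambda>s. norm (G s)) \<in> borel_measurable (Leb t)"
    by (intro borel_imp_lebesgue_on rcont_norm_measurable rG)
  show "(\<lambda>s. (norm (G s))\<^sup>2) \<in> borel_measurable (Leb t)" by measurable
  show "norm ((norm (G s))\<^sup>2) \<le> B\<^sup>2" if "s \<in> {0..t}" for s
    using power_mono[OF bG, of s 2] that t by simp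
qed

lemma integrable_cf_G: "t \<in> {0..T} \<Longrightarrow> integrable (Leb t) (\<lambda>s. (cmod (cf (G s) k))\<^sup>2)"
  by (rule integrable_norm_sq_bounded[OF cf_G_measurable cf_G_bound]) simp

lemma hc_sum_estimate_norm:
  assumes t: "t \<in> {0..T}" and K: "finite K"
  shows "(\<Sum>k\<in>K. (cmod (hc \<nu> G k t))\<^sup>2) \<le> (1 / (4 * \<nu>)) * (LINT s|Leb t. (norm (G s))\<^sup>2)"
proof -
  have "(LINT s|Leb t. (\<Sum>k\<in>K. (cmod (cf (G s) k))\<^sup>2)) \<le> (LINT s|Leb t. (norm (G s))\<^sup>2)"
    using integrable_cf_G[OF t] integrable_norm_G[OF t] K
    by (intro integral_mono Bochner_Integration.integrable_sum) (auto simp: norm_hseq_sq sqs_sum_le)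
  then have "(1 / (4 * \<nu>)) * (LINT s|Leb t. (\<Sum>k\<in>K. (cmod (cf (G s) k))\<^sup>2))
      \<le> (1 / (4 * \<nu>)) * (LINT s|Leb t. (norm (G s))\<^sup>2)"
    using \<nu> by (intro mult_left_mono) auto
  then show ?thesis using hc_sum_estimate[OF t K] by linarith
qed

lemma hc_minus: "hc \<nu> G (- k) t = cnj (hc \<nu> G k t)"
proof -
  have eq: "(\<lambda>s. exp (\<nu> * (lam (- k))\<^sup>2 * s) * ((- (1/2) * dk (- k)) * cf (G s) (- k)))
      = (\<lambda>s. cnj (exp (\<nu> * (lam k)\<^sup>2 * s) * ((- (1/2) * dk k) * cf (G s) k)))"
    by (simp add: dk_minus exp_cnj fun_eq_iff)
  show ?thesis unfolding hc_def eq Bochner_Integration.integral_cnj by simp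
qed

lemma cf_heatX:
  assumes t: "t \<in> {0..T}" shows "cf (heatX \<nu> G t) k = hc \<nu> G k t"
proof -
  have "hc \<nu> G 0 t = 0" by (simp add: hc_def)
  moreover have "sqs (\<lambda>k. hc \<nu> G k t)"
    by (rule sqsI(1)) (rule hc_sum_estimate_norm[OF t])
  ultimately have "cf (heatX \<nu> G t) = (\<lambda>k. hc \<nu> G k t)"
    unfolding heatX_def by (intro cf_Hseq) (auto simp: hc_minus)
  then show ?thesis by simp
qed

lemma norm_heatX_sq_le:
  assumes t: "t \<in> {0..T}"
  shows "(norm (heatX \<nu> G t))\<^sup>2 \<le> (1 / (4 * \<nu>)) * (LINT s|Leb t. (norm (G s))\<^sup>2)"
  unfolding norm_hseq_sq[of "heatX \<nu> G t"]
  by (rule sqsI(2)) (simp only: cf_heatX[OF t] hc_sum_estimate_norm[OF t])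

lemma norm_heatX_le:
  assumes t: "t \<in> {0..T}" shows "norm (heatX \<nu> G t) \<le> sqrt (T * B\<^sup>2 / (4 * \<nu>))"
proof -
  have "(LINT s|Leb t. (norm (G s))\<^sup>2) \<le> (LINT s|Leb t. B\<^sup>2)"
  proof (rule integral_mono[OF integrable_norm_G[OF t]])
    show "integrable (Leb t) (\<lambda>s. B\<^sup>2)" by (rule integrable_continuous_Icc) (intro continuous_intros)
    show "(norm (G s))\<^sup>2 \<le> B\<^sup>2" if "s \<in> space (Leb t)" for s
      using that t by (intro power_mono bG) auto
  qed
  also have "\<dots> = t * B\<^sup>2" using t LINT_const_Icc[of 0 t "B\<^sup>2"] by simp
  also have "\<dots> \<le> T * B\<^sup>2" using t by (intro mult_right_mono) auto
  finally have "(1 / (4 * \<nu>)) * (LINT s|Leb t. (norm (G s))\<^sup>2) \<le> (1 / (4 * \<nu>)) * (T * B\<^sup>2)"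
    using \<nu> by (intro mult_left_mono) auto
  then have "(norm (heatX \<nu> G t))\<^sup>2 \<le> T * B\<^sup>2 / (4 * \<nu>)" using norm_heatX_sq_le[OF t] by simp
  then show ?thesis by (rule real_le_rsqrt)
qed

lemma heat_sol_heatX: "heat_sol \<nu> T G (heatX \<nu> G)"
  unfolding heat_sol_def
proof (intro allI ballI)
  fix k t assume t: "t \<in> {0..T}"
  define h where "h = heat_mode \<nu> k (\<lambda>s. cf (heatX \<nu> G s) k) (\<lambda>s. cf (G s) k)"
  define h' where "h' = heat_mode \<nu> k (hc \<nu> G k) (\<lambda>s. cf (G s) k)"
  have eq: "h s = h' s" if "s \<in> space (Leb t)" for s
    using that t cf_heatX[of s k] by (simp add: h_def h'_def heat_mode_def)
  have "integrable (Leb t) h = integrable (Leb t) h'"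
    by (rule Bochner_Integration.integrable_cong[OF refl eq])
  moreover have "(LINT s|Leb t. h s) = (LINT s|Leb t. h' s)"
    by (rule Bochner_Integration.integral_cong[OF refl eq])
  ultimately show "integrable (Leb t) (heat_mode \<nu> k (\<lambda>s. cf (heatX \<nu> G s) k) (\<lambda>s. cf (G s) k))
     \<and> cf (heatX \<nu> G t) k = (LINT s|Leb t. heat_mode \<nu> k (\<lambda>s. cf (heatX \<nu> G s) k) (\<lambda>s. cf (G s) k) s)"
    using hc_mode[OF t, of k] cf_heatX[OF t, of k] by (simp add: h_def h'_def)
qed

text \<open>The tails of \<open>heatX\<close> are small uniformly in time, so continuity is inherited from the modes.\<close>

lemma continuous_heatX: "continuous_on {0..T} (heatX \<nu> G)"
proof -
  \<comment> \<open>Integrating up to \<open>T\<close> makes \<open>tail N\<close> bound the modes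
    outside \<open>isym N\<close> at all times at once. It tends to 0 because the coefficients of
    each \<open>G s\<close> are square-summable, with \<open>(norm (G s))\<^sup>2\<close> as
    dominating function.\<close>
  define tail where "tail = (\<lambda>N. (1 / (4 * \<nu>)) * (LINT s|Leb T. (norm (G s))\<^sup>2 - (\<Sum>k\<in>isym N. (cmod (cf (G s) k))\<^sup>2)))"
  have TT: "T \<in> {0..T}" using T by simp
  have nn: "0 \<le> (norm (G s))\<^sup>2 - (\<Sum>k\<in>isym N. (cmod (cf (G s) k))\<^sup>2)" for s N
    using sqs_sum_le[OF sqs_cf, of "isym N" "G s"] by (simp add: norm_hseq_sq)
  have itail: "integrable (Leb t) (\<lambda>s. (norm (G s))\<^sup>2 - (\<Sum>k\<in>isym N. (cmod (cf (G s) k))\<^sup>2))" if "t \<in> {0..T}" for N t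
    using integrable_norm_G[OF that] integrable_cf_G[OF that] by (intro Bochner_Integration.integrable_diff Bochner_Integration.integrable_sum)
  have "tail \<longlonglongrightarrow> (1 / (4 * \<nu>)) * (LINT s|Leb T. 0)"
    unfolding tail_def
  proof (intro tendsto_mult tendsto_const, rule integral_dominated_convergence)
    show "AE s in Leb T. (\<lambda>N. (norm (G s))\<^sup>2 - (\<Sum>k\<in>isym N. (cmod (cf (G s) k))\<^sup>2)) \<longlonglongrightarrow> 0"
    proof (rule AE_I2)
      fix s
      have "(\<lambda>N. (norm (G s))\<^sup>2 - (\<Sum>k\<in>isym N. (cmod (cf (G s) k))\<^sup>2)) \<longlonglongrightarrow> (norm (G s))\<^sup>2 - nsq (cf (G s))"
        by (intro tendsto_intros nsq_isym_tendsto sqs_cf)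
      then show "(\<lambda>N. (norm (G s))\<^sup>2 - (\<Sum>k\<in>isym N. (cmod (cf (G s) k))\<^sup>2)) \<longlonglongrightarrow> 0"
        by (simp add: norm_hseq_sq)
    qed
    show "AE s in Leb T. norm ((norm (G s))\<^sup>2 - (\<Sum>k\<in>isym N. (cmod (cf (G s) k))\<^sup>2)) \<le> (norm (G s))\<^sup>2" for N
      using nn[of _ N] by (intro AE_I2) (auto simp: sum_nonneg)
    show "integrable (Leb T) (\<lambda>s. (norm (G s))\<^sup>2)" by (rule integrable_norm_G[OF TT])
    show "(\<lambda>s. (norm (G s))\<^sup>2 - (\<Sum>k\<in>isym N. (cmod (cf (G s) k))\<^sup>2)) \<in> borel_measurable (Leb T)" for N
      using itail[OF TT] by (rule borel_measurable_integrable)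
  qed simp
  then have tail0: "tail \<longlonglongrightarrow> 0" by simp
  have tl: "(\<Sum>k\<in>K. (cmod (hc \<nu> G k t))\<^sup>2) \<le> tail N" if t: "t \<in> {0..T}" and K: "finite K" "K \<inter> isym N = {}" for t K N
  proof -
    have "(LINT s|Leb t. (\<Sum>k\<in>K. (cmod (cf (G s) k))\<^sup>2))
        \<le> (LINT s|Leb t. (norm (G s))\<^sup>2 - (\<Sum>k\<in>isym N. (cmod (cf (G s) k))\<^sup>2))"
    proof (rule integral_mono[OF _ itail[OF t]])
      show "integrable (Leb t) (\<lambda>s. \<Sum>k\<in>K. (cmod (cf (G s) k))\<^sup>2)"
        by (intro Bochner_Integration.integrable_sum integrable_cf_G t)
      fix s
      have "(\<Sum>k\<in>K. (cmod (cf (G s) k))\<^sup>2) + (\<Sum>k\<in>isym N. (cmod (cf (G s) k))\<^sup>2) = (\<Sum>k\<in>K \<union> isym N. (cmod (cf (G s) k))\<^sup>2)"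
        using K by (simp add: sum.union_disjoint)
      also have "\<dots> \<le> (norm (G s))\<^sup>2" unfolding norm_hseq_sq by (rule sqs_sum_le) (use K in auto)
      finally show "(\<Sum>k\<in>K. (cmod (cf (G s) k))\<^sup>2) \<le> (norm (G s))\<^sup>2 - (\<Sum>k\<in>isym N. (cmod (cf (G s) k))\<^sup>2)" by simp
    qed
    also have "\<dots> = (LINT s|Leb T. (if s \<le> t then (norm (G s))\<^sup>2 - (\<Sum>k\<in>isym N. (cmod (cf (G s) k))\<^sup>2) else 0))"
      using LINT_lebesgue_on_if[of t T 0 "\<lambda>s. (norm (G s))\<^sup>2 - (\<Sum>k\<in>isym N. (cmod (cf (G s) k))\<^sup>2)"] t by simp
    also have "\<dots> \<le> (LINT s|Leb T. (norm (G s))\<^sup>2 - (\<Sum>k\<in>isym N. (cmod (cf (G s) k))\<^sup>2))"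
      using itail[OF TT] nn by (intro integral_mono') auto
    finally have "(1 / (4 * \<nu>)) * (LINT s|Leb t. (\<Sum>k\<in>K. (cmod (cf (G s) k))\<^sup>2)) \<le> tail N"
      unfolding tail_def using \<nu> by (intro mult_left_mono) auto
    then show ?thesis using hc_sum_estimate[OF t K(1)] by linarith
  qed
  have dsq: "(cmod (a - b))\<^sup>2 \<le> 2 * (cmod a)\<^sup>2 + 2 * (cmod b)\<^sup>2" for a b
    using cmod_add_sq_le[of a "- b"] by simp
  have est: "nsq (\<lambda>k. hc \<nu> G k t - hc \<nu> G k s) \<le> (\<Sum>k\<in>isym N. (cmod (hc \<nu> G k t - hc \<nu> G k s))\<^sup>2) + 4 * tail N"
    if "s \<in> {0..T}" "t \<in> {0..T}" for s t N
  proof (rule sqsI(2))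
    fix F :: "int set" assume F: "finite F"
    have "(\<Sum>k\<in>F. (cmod (hc \<nu> G k t - hc \<nu> G k s))\<^sup>2)
        = (\<Sum>k\<in>F \<inter> isym N. (cmod (hc \<nu> G k t - hc \<nu> G k s))\<^sup>2) + (\<Sum>k\<in>F - isym N. (cmod (hc \<nu> G k t - hc \<nu> G k s))\<^sup>2)"
      by (rule sum.Int_Diff[OF F])
    also have "\<dots> \<le> (\<Sum>k\<in>isym N. (cmod (hc \<nu> G k t - hc \<nu> G k s))\<^sup>2)
        + (\<Sum>k\<in>F - isym N. 2 * (cmod (hc \<nu> G k t))\<^sup>2 + 2 * (cmod (hc \<nu> G k s))\<^sup>2)"
      by (intro add_mono sum_mono2 sum_mono dsq) auto
    also have "\<dots> \<le> (\<Sum>k\<in>isym N. (cmod (hc \<nu> G k t - hc \<nu> G k s))\<^sup>2) + (2 * tail N + 2 * tail N)"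
      unfolding sum.distrib sum_distrib_left[symmetric]
      using F that by (intro add_mono order_refl mult_left_mono tl) auto
    finally show "(\<Sum>k\<in>F. (cmod (hc \<nu> G k t - hc \<nu> G k s))\<^sup>2)
        \<le> (\<Sum>k\<in>isym N. (cmod (hc \<nu> G k t - hc \<nu> G k s))\<^sup>2) + 4 * tail N" by simp
  qed
  show ?thesis
    unfolding continuous_on_def
  proof
    fix s assume s: "s \<in> {0..T}"
    show "(heatX \<nu> G \<longlongrightarrow> heatX \<nu> G s) (at s within {0..T})"
    proof (rule tendstoI)
      fix e :: real assume e: "0 < e"
      \<comment> \<open>Four tails contribute less than \<open>e\<^sup>2 / 2\<close>; the finitely
        many low modes get the other half.\<close>
      have "\<forall>\<^sub>F N in sequentially. tail N < e\<^sup>2 / 8" by (rule order_tendstoD[OF tail0]) (use e in simp)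
      then obtain N where N: "tail N < e\<^sup>2 / 8" by (auto simp: eventually_sequentially)
      have "((\<lambda>t. \<Sum>k\<in>isym N. (cmod (hc \<nu> G k t - hc \<nu> G k s))\<^sup>2) \<longlongrightarrow> (\<Sum>k\<in>isym N. (cmod (hc \<nu> G k s - hc \<nu> G k s))\<^sup>2)) (at s within {0..T})"
        using continuous_hc s unfolding continuous_on_def by (intro tendsto_intros) blast
      then have "((\<lambda>t. \<Sum>k\<in>isym N. (cmod (hc \<nu> G k t - hc \<nu> G k s))\<^sup>2) \<longlongrightarrow> 0) (at s within {0..T})" by simp
      then have "\<forall>\<^sub>F t in at s within {0..T}. (\<Sum>k\<in>isym N. (cmod (hc \<nu> G k t - hc \<nu> G k s))\<^sup>2) < e\<^sup>2 / 2"
        by (rule order_tendstoD) (use e in simp)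
      moreover have "\<forall>\<^sub>F t in at s within {0..T}. t \<in> {0..T}" by (simp add: eventually_at_filter)
      ultimately show "\<forall>\<^sub>F t in at s within {0..T}. dist (heatX \<nu> G t) (heatX \<nu> G s) < e"
      proof eventually_elim
        case (elim t)
        have "cf (heatX \<nu> G t - heatX \<nu> G s) = (\<lambda>k. hc \<nu> G k t - hc \<nu> G k s)"
          using cf_heatX[OF s] cf_heatX[OF elim(2)] by (auto simp: cf_diff)
        then have "(norm (heatX \<nu> G t - heatX \<nu> G s))\<^sup>2 < e\<^sup>2"
          using est[OF s elim(2), of N] elim(1) N by (simp add: norm_hseq_sq)
        then show ?case using e by (simp add: dist_norm power_less_imp_less_base)
      qed
    qed
  qed
qed

lemma continuous_heatX_cl: "continuous_on UNIV (\<lambda>t. heatX \<nu> G (cl T t))"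
  by (rule continuous_on_compose2[OF continuous_heatX continuous_cl]) (use cl_in[OF T] in blast)

end

lemma heatX_diff_estimate:
  assumes "forced_heat \<nu> T B G" "forced_heat \<nu> T B G'" and t: "t \<in> {0..T}"
  shows "(norm (heatX \<nu> G t - heatX \<nu> G' t))\<^sup>2 \<le> (1 / (4 * \<nu>)) * (LINT s|Leb t. (norm (G s - G' s))\<^sup>2)"
proof -
  interpret G: forced_heat \<nu> T B G by fact
  interpret G': forced_heat \<nu> T B G' by fact
  \<comment> \<open>The clamp is inserted because \<open>rcont\<close> speaks about the whole
    line.\<close>
  define W where "W = (\<lambda>s. heatX \<nu> G (cl T s) - heatX \<nu> G' (cl T s))"
  have "heat_sol \<nu> T (\<lambda>s. G s - G' s) W"
    by (rule heat_sol_cong[OF heat_sol_diff[OF G.heat_sol_heatX G'.heat_sol_heatX]]) (auto simp: W_def)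
  moreover have "rcont W"
    unfolding W_def by (intro rcont_diff continuous_imp_rcont G.continuous_heatX_cl G'.continuous_heatX_cl)
  moreover have "rcont (\<lambda>s. G s - G' s)" by (intro rcont_diff G.rG G'.rG)
  moreover have "norm (W s) \<le> 2 * sqrt (T * B\<^sup>2 / (4 * \<nu>))" if "s \<in> {0..T}" for s
    using norm_triangle_ineq4[of "heatX \<nu> G s" "heatX \<nu> G' s"] G.norm_heatX_le[OF that] G'.norm_heatX_le[OF that] that
    by (simp add: W_def)
  moreover have "norm (G s - G' s) \<le> 2 * B" if "s \<in> {0..T}" for s
    using norm_triangle_ineq4[of "G s" "G' s"] G.bG[OF that] G'.bG[OF that] by simp
  ultimately have "(norm (W t))\<^sup>2 \<le> (1 / (4 * \<nu>)) * (LINT s|Leb t. (norm (G s - G' s))\<^sup>2)"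
    by (rule heat_sol_estimate(1)[OF G.\<nu> _ _ _ _ _ t])
  then show ?thesis using t by (simp add: W_def)
qed

text \<open>\<open>trunc R x *\<^sub>R x\<close> is the radial retraction onto the ball of radius
  \<open>R\<close>; the form with \<open>max\<close> makes continuity of the factor
  immediate.\<close>

definition trunc :: "real \<Rightarrow> hseq \<Rightarrow> real" where "trunc R x = R / max R (norm x)"

lemma trunc_bounds:
  assumes R: "0 < R"
  shows "0 \<le> trunc R x" "trunc R x \<le> 1" "trunc R x * norm x \<le> R"
proof -
  have m: "0 < max R (norm x)" using R by auto
  show "0 \<le> trunc R x" using R m by (simp add: trunc_def)
  show "trunc R x \<le> 1" unfolding trunc_def using m by (simp add: divide_le_eq)
  have "R * norm x \<le> R * max R (norm x)" using R by (intro mult_left_mono) auto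
  then show "trunc R x * norm x \<le> R" unfolding trunc_def using m by (simp add: divide_le_eq)
qed

lemma isCont_trunc: "0 < R \<Longrightarrow> isCont (trunc R) x"
  unfolding trunc_def by (intro continuous_intros) auto

text \<open>\<open>max R (norm x)\<close> is 1-Lipschitz, so the change of the factor, multiplied by
  \<open>norm y\<close>, is at most the distance of the arguments. The change of the argument under
  a fixed factor contributes the same amount again.\<close>

lemma trunc_lipschitz:
  assumes R: "0 < R" shows "norm (trunc R x *\<^sub>R x - trunc R y *\<^sub>R y) \<le> 2 * norm (x - y)"
proof -
  define a where "a = max R (norm x)"
  define b where "b = max R (norm y)"
  have ab: "0 < a" "0 < b" "R \<le> a" "norm y \<le> b" using R by (auto simp: a_def b_def)
  have "\<bar>a - b\<bar> \<le> \<bar>norm x - norm y\<bar>" by (auto simp: a_def b_def)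
  also have "\<dots> \<le> norm (x - y)" by (rule norm_triangle_ineq3)
  finally have abd: "\<bar>a - b\<bar> \<le> norm (x - y)" .
  have "trunc R x - trunc R y = (R / a) * ((b - a) / b)"
    using ab by (simp add: trunc_def a_def[symmetric] b_def[symmetric] field_simps)
  then have "\<bar>trunc R x - trunc R y\<bar> * norm y = (R / a) * (\<bar>a - b\<bar> * (norm y / b))"
    using ab R by (simp add: abs_mult abs_minus_commute)
  also have "\<dots> \<le> 1 * (norm (x - y) * 1)"
    using ab abd R by (intro mult_mono) auto
  finally have 1: "\<bar>trunc R x - trunc R y\<bar> * norm y \<le> norm (x - y)" by simp
  have "trunc R x *\<^sub>R x - trunc R y *\<^sub>R y = trunc R x *\<^sub>R (x - y) + (trunc R x - trunc R y) *\<^sub>R y"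
    by (simp add: algebra_simps)
  then have "norm (trunc R x *\<^sub>R x - trunc R y *\<^sub>R y) \<le> \<bar>trunc R x\<bar> * norm (x - y) + \<bar>trunc R x - trunc R y\<bar> * norm y"
    using norm_triangle_ineq[of "trunc R x *\<^sub>R (x - y)" "(trunc R x - trunc R y) *\<^sub>R y"] by simp
  also have "\<bar>trunc R x\<bar> * norm (x - y) \<le> 1 * norm (x - y)"
    using trunc_bounds[OF R, of x] by (intro mult_right_mono) auto
  finally show ?thesis using 1 by simp
qed

text \<open>The factor is squared because the product is quadratic. Seen as the square of the
  retracted argument, the flux is globally bounded and Lipschitz; seen as a number in
  \<open>[0, 1]\<close> times \<open>Bx n x x\<close>, it fits
  \<open>truncated_burgers\<close>.\<close>

definition tflux :: "nat \<Rightarrow> real \<Rightarrow> hseq \<Rightarrow> hseq" where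
  "tflux n R x = (trunc R x)\<^sup>2 *\<^sub>R Bx n x x"

lemma tflux_eq: "1 \<le> n \<Longrightarrow> tflux n R x = Bx n (trunc R x *\<^sub>R x) (trunc R x *\<^sub>R x)"
  by (simp add: tflux_def Bx_scaleR_diag)

lemma isCont_tflux: "1 \<le> n \<Longrightarrow> 0 < R \<Longrightarrow> isCont (tflux n R) x"
  unfolding tflux_def by (intro continuous_intros isCont_trunc isCont_Bx_diag)

lemma norm_trunc_le: "0 < R \<Longrightarrow> norm (trunc R x *\<^sub>R x) \<le> R"
  using trunc_bounds(1,3)[of R x] by simp

lemma norm_tflux_le:
  assumes n: "1 \<le> n" and R: "0 < R" shows "norm (tflux n R x) \<le> sqrt (conv_bound n) * R * R"
proof -
  have "norm (tflux n R x) \<le> sqrt (conv_bound n) * norm (trunc R x *\<^sub>R x) * norm (trunc R x *\<^sub>R x)"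
    unfolding tflux_eq[OF n] by (rule norm_Bx_le[OF n])
  also have "\<dots> \<le> sqrt (conv_bound n) * R * R"
    using norm_trunc_le[OF R, of x] R by (intro mult_mono) (auto simp: conv_bound_def)
  finally show ?thesis .
qed

lemma tflux_lipschitz:
  assumes n: "1 \<le> n" and R: "0 < R"
  shows "norm (tflux n R x - tflux n R y) \<le> 4 * R * sqrt (conv_bound n) * norm (x - y)"
proof -
  let ?x = "trunc R x *\<^sub>R x" and ?y = "trunc R y *\<^sub>R y"
  have "norm (tflux n R x - tflux n R y) \<le> sqrt (conv_bound n) * norm (?x - ?y) * norm (?x + ?y)"
    unfolding tflux_eq[OF n] Bx_diff_squares[OF n] by (rule norm_Bx_le[OF n])
  also have "\<dots> \<le> sqrt (conv_bound n) * (2 * norm (x - y)) * (2 * R)"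
    using trunc_lipschitz[OF R, of x y] norm_trunc_le[OF R, of x] norm_trunc_le[OF R, of y] norm_triangle_ineq[of ?x ?y]
    by (intro mult_mono) (auto simp: conv_bound_def)
  finally show ?thesis by (simp add: mult_ac)
qed

lemma LINT_exp_le:
  fixes c :: real assumes "0 < c" "0 \<le> t"
  shows "(LINT s|Leb t. exp (c * s)) \<le> exp (c * t) / c"
proof -
  have "(LINT s|Leb t. exp (c * s)) = exp (c * t) / c - exp (c * 0) / c"
    using assms by (intro LINT_vector_derivative)
      (auto intro!: derivative_eq_intros continuous_intros simp flip: has_real_derivative_iff_has_vector_derivative)
  then show ?thesis using assms by simp
qed

text \<open>The exponential weight makes the Duhamel map of the truncated equation a contraction on
  arbitrarily long time intervals.\<close>

lemma truncated_burgers_exists: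
  assumes n: "1 \<le> n" and \<nu>: "0 < \<nu>" and T: "0 < T" and R: "0 < R" and rV: "rcont V"
  shows "\<exists>W. continuous_on UNIV W \<and> heat_sol \<nu> T (\<lambda>s. tflux n R (W s + V s)) W
     \<and> (\<exists>B. \<forall>s\<in>{0..T}. norm (W s) \<le> B)"
proof -
  define L where "L = 4 * R * sqrt (conv_bound n)"
  \<comment> \<open>Once \<open>\<mu>\<close> is at least \<open>L\<^sup>2 / (2 * \<nu>)\<close>,
    squared distances shrink by the factor 1/4; the summand 1 makes \<open>\<mu>\<close>
    positive.\<close>
  define \<mu> where "\<mu> = L\<^sup>2 / (2 * \<nu>) + 1"
  have \<mu>: "0 < \<mu>" using \<nu> by (simp add: \<mu>_def add_nonneg_pos)
  define B where "B = sqrt (conv_bound n) * R * R"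
  \<comment> \<open>The unknown \<open>y\<close> stands for the path damped by
    \<open>exp (- \<mu> * s)\<close>, so the plain supremum norm of \<open>y\<close> is the weighted
    norm of the path. The damping is undone before the flux is evaluated.\<close>
  define G where "G = (\<lambda>(y :: real \<Rightarrow>\<^sub>C hseq) s. tflux n R (exp (\<mu> * cl T s) *\<^sub>R apply_bcontfun y s + V s))"
  have ce: "continuous_on UNIV (\<lambda>s. exp (c * cl T s))" for c
    by (intro continuous_intros continuous_cl)
  have FH: "forced_heat \<nu> T B (G y)" for y
  proof
    show "rcont (G y)"
      unfolding G_def
      by (intro rcont_compose[of _ "tflux n R"] rcont_add rcont_scaleR rV continuous_imp_rcont ce isCont_tflux[OF n R])
        auto
    show "norm (G y s) \<le> B" for s unfolding G_def B_def by (rule norm_tflux_le[OF n R])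
  qed (use \<nu> T in auto)
  define h where "h = (\<lambda>y t. exp (- \<mu> * cl T t) *\<^sub>R heatX \<nu> (G y) (cl T t))"
  have e1: "exp (- \<mu> * cl T t) \<le> 1" for t
    using \<mu> by (simp add: cl_def)
  have hb: "h y \<in> bcontfun" for y
  proof (rule bcontfun_normI)
    show "continuous_on UNIV (h y)"
      unfolding h_def by (intro continuous_on_scaleR ce forced_heat.continuous_heatX_cl[OF FH])
    fix t
    have "norm (h y t) \<le> 1 * norm (heatX \<nu> (G y) (cl T t))"
      unfolding h_def norm_scaleR using e1[of t] by (intro mult_right_mono) auto
    also have "\<dots> \<le> sqrt (T * B\<^sup>2 / (4 * \<nu>))"
      using forced_heat.norm_heatX_le[OF FH cl_in[OF T], of y t] by simp
    finally show "norm (h y t) \<le> sqrt (T * B\<^sup>2 / (4 * \<nu>))" .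
  qed
  have contr: "dist (Bcontfun (h y)) (Bcontfun (h z)) \<le> (1/2) * dist y z" for y z
  proof (rule dist_bound)
    fix t
    define \<tau> where "\<tau> = cl T t"
    have \<tau>: "\<tau> \<in> {0..T}" unfolding \<tau>_def by (rule cl_in[OF T])
    define d where "d = dist y z"
    have Gd: "(norm (G y s - G z s))\<^sup>2 \<le> (L\<^sup>2 * d\<^sup>2) * exp (2 * \<mu> * s)" if s: "s \<in> {0..\<tau>}" for s
    proof -
      have sT: "cl T s = s" using s \<tau> by simp
      have "norm (G y s - G z s) \<le> L * norm (exp (\<mu> * s) *\<^sub>R apply_bcontfun y s + V s - (exp (\<mu> * s) *\<^sub>R apply_bcontfun z s + V s))"
        unfolding G_def L_def sT by (rule tflux_lipschitz[OF n R])
      also have "\<dots> = L * (exp (\<mu> * s) * dist (apply_bcontfun y s) (apply_bcontfun z s))"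
        by (simp add: dist_norm flip: scaleR_diff_right)
      also have "\<dots> \<le> L * (exp (\<mu> * s) * d)"
        using R dist_bounded[of y s z] by (intro mult_left_mono) (auto simp: L_def d_def conv_bound_def)
      finally have "(norm (G y s - G z s))\<^sup>2 \<le> (L * (exp (\<mu> * s) * d))\<^sup>2" by (intro power_mono) auto
      also have "\<dots> = (L\<^sup>2 * d\<^sup>2) * exp (2 * \<mu> * s)"
        by (simp add: power_mult_distrib exp_double[symmetric] mult_ac)
      finally show ?thesis .
    qed
    have "(norm (heatX \<nu> (G y) \<tau> - heatX \<nu> (G z) \<tau>))\<^sup>2 \<le> (1 / (4 * \<nu>)) * (LINT s|Leb \<tau>. (norm (G y s - G z s))\<^sup>2)"
      by (rule heatX_diff_estimate[OF FH FH \<tau>])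
    also have "\<dots> \<le> (1 / (4 * \<nu>)) * (LINT s|Leb \<tau>. (L\<^sup>2 * d\<^sup>2) * exp (2 * \<mu> * s))"
    proof (intro mult_left_mono integral_mono')
      show "integrable (Leb \<tau>) (\<lambda>s. (L\<^sup>2 * d\<^sup>2) * exp (2 * \<mu> * s))"
        by (rule integrable_continuous_Icc) (intro continuous_intros)
    qed (use Gd \<nu> in auto)
    also have "\<dots> \<le> (1 / (4 * \<nu>)) * ((L\<^sup>2 * d\<^sup>2) * (exp (2 * \<mu> * \<tau>) / (2 * \<mu>)))"
      unfolding integral_mult_right_zero using LINT_exp_le[of "2 * \<mu>" \<tau>] \<mu> \<nu> \<tau> by (intro mult_left_mono) auto
    also have "\<dots> = (L\<^sup>2 / (2 * \<nu>)) / \<mu> * (1/4) * (exp (\<mu> * \<tau>) * d)\<^sup>2"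
      using \<mu> \<nu> by (simp add: power_mult_distrib exp_double[symmetric] field_simps)
    also have "\<dots> \<le> 1 * (1/4) * (exp (\<mu> * \<tau>) * d)\<^sup>2"
    proof (intro mult_right_mono)
      have "L\<^sup>2 / (2 * \<nu>) \<le> \<mu>" by (simp add: \<mu>_def)
      then show "L\<^sup>2 / (2 * \<nu>) / \<mu> \<le> 1" using \<mu> by (subst divide_le_eq_1_pos)
    qed auto
    also have "\<dots> = (exp (\<mu> * \<tau>) * ((1/2) * d))\<^sup>2" by (simp add: power_mult_distrib power2_eq_square)
    finally have le: "norm (heatX \<nu> (G y) \<tau> - heatX \<nu> (G z) \<tau>) \<le> exp (\<mu> * \<tau>) * ((1/2) * d)"
      by (rule power2_le_imp_le) (simp add: d_def)
    have "dist (apply_bcontfun (Bcontfun (h y)) t) (apply_bcontfun (Bcontfun (h z)) t)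
        = exp (- \<mu> * \<tau>) * norm (heatX \<nu> (G y) \<tau> - heatX \<nu> (G z) \<tau>)"
      unfolding Bcontfun_inverse[OF hb] by (simp add: h_def dist_norm \<tau>_def flip: scaleR_diff_right)
    also have "\<dots> \<le> exp (- \<mu> * \<tau>) * (exp (\<mu> * \<tau>) * ((1/2) * d))" using le by (intro mult_left_mono) auto
    also have "\<dots> = (1/2) * d" by (simp add: mult_exp_exp flip: mult.assoc)
    finally show "dist (apply_bcontfun (Bcontfun (h y)) t) (apply_bcontfun (Bcontfun (h z)) t) \<le> (1/2) * dist y z"
      by (simp add: d_def)
  qed
  then obtain y where y: "Bcontfun (h y) = y"
    using banach_fix_type[of "1/2" "\<lambda>y. Bcontfun (h y)"] by auto
  define W where "W = (\<lambda>t. heatX \<nu> (G y) (cl T t))"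
  have yt: "apply_bcontfun y t = exp (- \<mu> * cl T t) *\<^sub>R W t" for t
    using Bcontfun_inverse[OF hb, of y] y by (simp add: h_def W_def)
  have GW: "G y s = tflux n R (W s + V s)" for s
  proof -
    have "exp (\<mu> * cl T s) *\<^sub>R apply_bcontfun y s = W s"
      unfolding yt by (simp add: mult_exp_exp)
    then show ?thesis by (simp add: G_def)
  qed
  have "heat_sol \<nu> T (\<lambda>s. tflux n R (W s + V s)) W"
    by (rule heat_sol_cong[OF forced_heat.heat_sol_heatX[OF FH[of y]]]) (auto simp: GW W_def)
  moreover have "continuous_on UNIV W"
    unfolding W_def by (rule forced_heat.continuous_heatX_cl[OF FH])
  moreover have "\<forall>s\<in>{0..T}. norm (W s) \<le> sqrt (T * B\<^sup>2 / (4 * \<nu>))"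
    using forced_heat.norm_heatX_le[OF FH] by (simp add: W_def)
  ultimately show ?thesis by blast
qed

lemma burgers_exists:
  assumes n: "1 \<le> n" and \<nu>: "0 < \<nu>" and T: "0 < T" and rV: "rcont V"
    and bV: "\<And>s. s \<in> {0..T} \<Longrightarrow> norm (V s) \<le> M"
  shows "\<exists>W. continuous_on UNIV W \<and> heat_sol \<nu> T (\<lambda>s. Bx n (W s + V s) (W s + V s)) W"
proof -
  have M: "0 \<le> M" using order_trans[OF norm_ge_zero bV[of 0]] T by simp
  \<comment> \<open>\<open>apSup\<close> contains neither the radius nor \<open>B\<close>, so
    choosing the radius from it in advance is not circular. The term \<open>M\<close> is there
    because the truncation acts on \<open>W + V\<close>.\<close>
  define R where "R = M + sqrt (apSup n \<nu> T M) + 1"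
  \<comment> \<open>That \<open>apSup\<close> is nonnegative follows only once a solution is at
    hand; the maximum secures a positive radius before that.\<close>
  define R' where "R' = max 1 R"
  have R': "0 < R'" by (simp add: R'_def)
  obtain W B where W: "continuous_on UNIV W" "heat_sol \<nu> T (\<lambda>s. tflux n R' (W s + V s)) W"
    and B: "\<And>s. s \<in> {0..T} \<Longrightarrow> norm (W s) \<le> B"
    using truncated_burgers_exists[OF n \<nu> T R' rV] by blast
  have rW: "rcont W" by (rule continuous_imp_rcont[OF W(1)])
  interpret truncated_burgers n \<nu> T M B W V "\<lambda>s. (trunc R' (W s + V s))\<^sup>2"
  proof
    show "rcont (\<lambda>s. (trunc R' (W s + V s))\<^sup>2)"
      by (intro rcont_compose[of _ "\<lambda>x. (trunc R' x)\<^sup>2"] rcont_add rW rV) (intro continuous_intros isCont_trunc R')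
    show "(trunc R' (W s + V s))\<^sup>2 \<le> 1" for s
      using trunc_bounds[OF R', of "W s + V s"] by (simp add: power_le_one)
    show "heat_sol \<nu> T (\<lambda>s. (trunc R' (W s + V s))\<^sup>2 *\<^sub>R Bx n (W s + V s) (W s + V s)) W"
      using W(2) by (simp add: tflux_def)
  qed (use n \<nu> T rV rW B bV in auto)
  have "tflux n R' (W s + V s) = Bx n (W s + V s) (W s + V s)" if s: "s \<in> {0..T}" for s
  proof -
    have "norm (W s) \<le> sqrt (apSup n \<nu> T M)" by (rule real_le_rsqrt[OF apriori_sup[OF s]])
    then have "norm (W s + V s) \<le> R'"
      using norm_triangle_ineq[of "W s" "V s"] bV[OF s] by (simp add: R'_def R_def)
    then have "trunc R' (W s + V s) = 1" using R' by (simp add: trunc_def max_def)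
    then show ?thesis by (simp add: tflux_def)
  qed
  then have "heat_sol \<nu> T (\<lambda>s. Bx n (W s + V s) (W s + V s)) W"
    by (rule heat_sol_cong[OF W(2)]) auto
  then show ?thesis using W(1) by blast
qed

section \<open>Well-posedness of the perturbed Burgers equation\<close>

text \<open>The path is extended by constants outside \<open>[0, T]\<close>, which makes it right-continuous everywhere.\<close>

definition hpath :: "nat \<Rightarrow> real \<Rightarrow> (real \<Rightarrow> real \<Rightarrow> real) \<Rightarrow> real \<Rightarrow> hseq" where
  "hpath n T v t = toX n (v (cl T t))"

section \<open>Cadlag paths in \<open>hseq\<close>\<close>

lemma rcont_hpath:
  assumes v: "cadlag n T v" and T: "0 < T" shows "rcont (hpath n T v)"
  unfolding rcont_def
proof
  fix t
  have H: "v s \<in> Hs n" if "s \<in> {0..T}" for s using v that by (auto simp: cadlag_def)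
  consider "t < 0" | "0 \<le> t" "t < T" | "T \<le> t" by linarith
  then show "(hpath n T v \<longlongrightarrow> hpath n T v t) (at_right t)"
  proof cases
    case 1
    have "\<forall>\<^sub>F s in at_right t. hpath n T v s = hpath n T v t"
      unfolding eventually_at_right_field using 1 T by (intro exI[of _ 0]) (auto simp: hpath_def cl_def)
    then show ?thesis by (rule tendsto_eventually)
  next
    case 2
    then have "((\<lambda>s. Hnorm n (v s - v t)) \<longlongrightarrow> 0) (at_right t)" using v by (auto simp: cadlag_def)
    moreover have "\<forall>\<^sub>F s in at_right t. Hnorm n (v s - v t) = norm (hpath n T v s - hpath n T v t)"
      unfolding eventually_at_right_field using 2 H
      by (intro exI[of _ T]) (auto simp: hpath_def Hnorm_diff)
    ultimately have "((\<lambda>s. norm (hpath n T v s - hpath n T v t)) \<longlongrightarrow> 0) (at_right t)"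
      by (blast intro: Lim_transform_eventually)
    then show ?thesis using LIM_zero_cancel tendsto_norm_zero_iff by blast
  next
    case 3
    have "\<forall>\<^sub>F s in at_right t. hpath n T v s = hpath n T v t"
      unfolding eventually_at_right_field using 3 T by (intro exI[of _ "t + 1"]) (auto simp: hpath_def cl_def)
    then show ?thesis by (rule tendsto_eventually)
  qed
qed

lemma hpath_left_limit:
  assumes v: "cadlag n T v" and T: "0 < T" and t: "t \<in> {0..T}"
  shows "\<exists>l. (hpath n T v \<longlongrightarrow> l) (at_left t)"
proof (cases "t = 0")
  case True
  have "\<forall>\<^sub>F s in at_left t. hpath n T v s = hpath n T v 0"
    unfolding eventually_at_left_field using True T by (intro exI[of _ "- 1"]) (auto simp: hpath_def cl_def)
  then show ?thesis by (intro exI) (rule tendsto_eventually)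
next
  case False
  have H: "v s \<in> Hs n" if "s \<in> {0..T}" for s using v that by (auto simp: cadlag_def)
  obtain l where l: "l \<in> Hs n" "((\<lambda>s. Hnorm n (v s - l)) \<longlongrightarrow> 0) (at_left t)"
    using v[unfolded cadlag_def, THEN conjunct2, THEN conjunct2, rule_format, of t] t False by auto
  have "\<forall>\<^sub>F s in at_left t. Hnorm n (v s - l) = norm (hpath n T v s - toX n l)"
    unfolding eventually_at_left_field using t False H l(1)
    by (intro exI[of _ 0]) (auto simp: hpath_def Hnorm_diff)
  then have "((\<lambda>s. norm (hpath n T v s - toX n l)) \<longlongrightarrow> 0) (at_left t)"
    using l(2) by (blast intro: Lim_transform_eventually)
  then show ?thesis using LIM_zero_cancel tendsto_norm_zero_iff by blast
qed

text \<open>The two one-sided limits and the value at the point itself bound \<open>f\<close> near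
  every point; compactness selects finitely many neighbourhoods.\<close>

lemma one_sided_limits_bounded:
  fixes f :: "real \<Rightarrow> 'a::real_normed_vector"
  assumes "\<And>t. t \<in> {a..b} \<Longrightarrow> \<exists>l. (f \<longlongrightarrow> l) (at_left t)"
    and "\<And>t. t \<in> {a..b} \<Longrightarrow> \<exists>l. (f \<longlongrightarrow> l) (at_right t)"
  shows "\<exists>B. \<forall>t\<in>{a..b}. norm (f t) \<le> B"
proof -
  have "\<exists>c d B. c < t \<and> t < d \<and> (\<forall>s\<in>{c<..<d}. norm (f s) \<le> B)" if t: "t \<in> {a..b}" for t
  proof -
    obtain l r where l: "(f \<longlongrightarrow> l) (at_left t)" and r: "(f \<longlongrightarrow> r) (at_right t)"
      using assms t by blast
    have "\<forall>\<^sub>F s in at_left t. norm (f s) < norm l + 1"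
      by (rule order_tendstoD[OF tendsto_norm[OF l]]) simp
    then obtain c where c: "c < t" "\<And>s. c < s \<Longrightarrow> s < t \<Longrightarrow> norm (f s) < norm l + 1"
      unfolding eventually_at_left_field by blast
    have "\<forall>\<^sub>F s in at_right t. norm (f s) < norm r + 1"
      by (rule order_tendstoD[OF tendsto_norm[OF r]]) simp
    then obtain d where d: "t < d" "\<And>s. t < s \<Longrightarrow> s < d \<Longrightarrow> norm (f s) < norm r + 1"
      unfolding eventually_at_right_field by blast
    have "norm (f s) \<le> max (norm (f t)) (max (norm l + 1) (norm r + 1))" if "s \<in> {c<..<d}" for s
    proof -
      consider "s < t" | "s = t" | "t < s" by linarith
      then show ?thesis using c(2)[of s] d(2)[of s] that by cases auto
    qed
    then show ?thesis using c(1) d(1) by blast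
  qed
  then obtain c d B where cd: "\<And>t. t \<in> {a..b} \<Longrightarrow> c t < t \<and> t < d t \<and> (\<forall>s\<in>{c t<..<d t}. norm (f s) \<le> B t)"
    by metis
  have "{a..b} \<subseteq> (\<Union>t\<in>{a..b}. {c t<..<d t})" using cd by force
  then obtain F where F: "F \<subseteq> {a..b}" "finite F" "{a..b} \<subseteq> (\<Union>t\<in>F. {c t<..<d t})"
    using compactE_image[of "{a..b}" "{a..b}" "\<lambda>t. {c t<..<d t}"] by auto
  have "norm (f s) \<le> (\<Sum>t\<in>F. \<bar>B t\<bar>)" if "s \<in> {a..b}" for s
  proof -
    have "s \<in> (\<Union>t\<in>F. {c t<..<d t})" using F(3) that by (rule subsetD)
    then obtain t where t: "t \<in> F" "s \<in> {c t<..<d t}" by (rule UN_E)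
    then have "norm (f s) \<le> \<bar>B t\<bar>" using cd[of t] F(1) by fastforce
    also have "\<dots> \<le> (\<Sum>t\<in>F. \<bar>B t\<bar>)" using F(2) t(1) by (intro member_le_sum) auto
    finally show ?thesis .
  qed
  then show ?thesis by blast
qed

lemma hpath_bounded:
  assumes v: "cadlag n T v" and T: "0 < T"
  shows "\<exists>B. \<forall>t\<in>{0..T}. norm (hpath n T v t) \<le> B"
  using hpath_left_limit[OF v T] rcont_hpath[OF v T]
  by (intro one_sided_limits_bounded) (auto simp: rcont_def)

lemma norm_hpath:
  assumes "cadlag n T v" "t \<in> {0..T}" shows "norm (hpath n T v t) = Hnorm n (v t)"
  using assms by (simp add: hpath_def norm_toX cadlag_def)

text \<open>The supremum in \<open>Dnorm\<close> is meaningful only for a bounded family; the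
  one-sided limits of the path provide this.\<close>

lemma norm_hpath_le_Dnorm:
  assumes v: "cadlag n T v" and T: "0 < T" and t: "t \<in> {0..T}"
  shows "norm (hpath n T v t) \<le> Dnorm n T v"
proof -
  obtain B where "\<forall>t\<in>{0..T}. norm (hpath n T v t) \<le> B" using hpath_bounded[OF v T] by blast
  then have "bdd_above ((\<lambda>t. Hnorm n (v t)) ` {0..T})"
    using norm_hpath[OF v] by (auto intro!: bdd_aboveI2)
  then show ?thesis unfolding Dnorm_def norm_hpath[OF v t] by (rule cSUP_upper[OF t])
qed

section \<open>Translation between solutions and Fourier modes\<close>

lemma Hs_imp_in_L2: "u \<in> Hs n \<Longrightarrow> in_L2 u" by (simp add: Hs_iff)

lemma rc_eq_uc: "u \<in> Hs n \<Longrightarrow> rc u k = uc n (toX n u) k"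
  by (simp add: rc_of_toX uc_def)

lemma rc_square_eq_conv:
  assumes "w \<in> Hs n" "v \<in> Hs n"
  shows "rc (\<lambda>x. (w x + v x)\<^sup>2) k = conv (uc n (toX n w + toX n v)) (uc n (toX n w + toX n v)) k"
proof -
  have L: "in_L2 w" "in_L2 v" using assms by (auto intro: Hs_imp_in_L2)
  have "rc (\<lambda>x. w x + v x) j = uc n (toX n w + toX n v) j" for j
    using rc_add[OF L, of j] rc_eq_uc[OF assms(1)] rc_eq_uc[OF assms(2)] by (simp only: uc_add)
  then have "rc (\<lambda>x. w x + v x) = uc n (toX n w + toX n v)" by blast
  then show ?thesis using rc_square[OF in_L2_add[OF L], of k] by (simp only:)
qed

text \<open>All symbols act mode by mode, so the weighting multiplies the \<open>k\<close>-th
  equation by the constant \<open>lam k ^ n\<close>. Nothing is lost where this vanishes: at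
  \<open>k = 0\<close> the right-hand side \<open>mode_rhs\<close> is zero as well.\<close>

lemma heat_mode_eq_mode_rhs:
  assumes n: "1 \<le> n" and wv: "w \<in> Hs n" "v \<in> Hs n"
  shows "of_real (- (\<nu> * (lam k)\<^sup>2)) * cf (toX n w) k + (- (1/2) * dk k) * cf (Bx n (toX n w + toX n v) (toX n w + toX n v)) k
     = of_real (lam k ^ n) * mode_rhs \<nu> w v k"
proof -
  define P where "P = conv (uc n (toX n w + toX n v)) (uc n (toX n w + toX n v)) k"
  show ?thesis
    unfolding mode_rhs_def rc_square_eq_conv[OF wv] cf_Bx[OF n] cf_toX[OF wv(1)] dk_square P_def[symmetric]
    by (simp add: algebra_simps)
qed

lemma heat_sol_of_solves:
  assumes n: "1 \<le> n" and v: "cadlag n T v" and w: "cadlag n T w" and s: "solves \<nu> T v w"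
  shows "heat_sol \<nu> T (\<lambda>s. Bx n (hpath n T w s + hpath n T v s) (hpath n T w s + hpath n T v s)) (hpath n T w)"
  unfolding heat_sol_def
proof (intro allI ballI)
  fix k t assume t: "t \<in> {0..T}"
  have H: "v s \<in> Hs n" "w s \<in> Hs n" if "s \<in> {0..T}" for s using v w that by (auto simp: cadlag_def)
  have L: "in_L2 (w t) \<and> in_L2 (v t)" if "t \<in> {0..T}" for t using H[OF that] Hs_imp_in_L2 by blast
  define h where "h = heat_mode \<nu> k (\<lambda>s. cf (hpath n T w s) k) (\<lambda>s. cf (Bx n (hpath n T w s + hpath n T v s) (hpath n T w s + hpath n T v s)) k)"
  have eq: "h s = of_real (lam k ^ n) * mode_rhs \<nu> (w s) (v s) k" if "s \<in> space (Leb t)" for s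
  proof -
    have "s \<in> {0..T}" using that t by auto
    from heat_mode_eq_mode_rhs[OF n H(2,1)[OF this], of \<nu> k] this show ?thesis
      by (simp only: h_def heat_mode_def hpath_def cl_id)
  qed
  note m = solves_imp_modes[OF s L t, of k]
  have "integrable (Leb t) h = integrable (Leb t) (\<lambda>s. of_real (lam k ^ n) * mode_rhs \<nu> (w s) (v s) k)"
    by (rule Bochner_Integration.integrable_cong[OF refl eq])
  moreover have "(LINT s|Leb t. h s) = (LINT s|Leb t. of_real (lam k ^ n) * mode_rhs \<nu> (w s) (v s) k)"
    by (rule Bochner_Integration.integral_cong[OF refl eq])
  moreover have "cf (hpath n T w t) k = of_real (lam k ^ n) * rc (w t) k"
    using cf_toX[OF H(2)[OF t]] t by (simp add: hpath_def)
  ultimately show "integrable (Leb t) (heat_mode \<nu> k (\<lambda>s. cf (hpath n T w s) k) (\<lambda>s. cf (Bx n (hpath n T w s + hpath n T v s) (hpath n T w s + hpath n T v s)) k))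
     \<and> cf (hpath n T w t) k = (LINT s|Leb t. heat_mode \<nu> k (\<lambda>s. cf (hpath n T w s) k) (\<lambda>s. cf (Bx n (hpath n T w s + hpath n T v s) (hpath n T w s + hpath n T v s)) k) s)"
    using m unfolding h_def[symmetric] by simp
qed

text \<open>Summable coefficients bound \<open>u\<close> almost everywhere by a constant
  \<open>A\<close>, so the square of \<open>(u x)\<^sup>2\<close> is dominated by
  \<open>A\<^sup>2 * (u x)\<^sup>2\<close>. This lets \<open>modes_imp_solves\<close> apply
  Parseval's identity to the flux.\<close>

lemma in_L2_square:
  assumes n: "1 \<le> n" and u: "in_L2 u" and r: "rc u = uc n x"
  shows "in_L2 (\<lambda>x. (u x)\<^sup>2)"
proof -
  have L: "L2c (\<lambda>x. complex_of_real (u x))" by (rule in_L2_L2c[OF u])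
  have um [measurable]: "u \<in> borel_measurable M01" using u by (simp add: in_L2_def)
  have "(\<lambda>k. cmod (rc u k)) summable_on UNIV" using l1_uc(1)[OF n, of x] r by (simp add: l1_def)
  from AE_norm_le_of_summable[OF L this]
  obtain A where A: "AE x in M01. \<bar>u x\<bar> \<le> A" by auto
  have "integrable M01 (\<lambda>x. ((u x)\<^sup>2)\<^sup>2)"
  proof (rule Bochner_Integration.integrable_bound)
    show "integrable M01 (\<lambda>x. A\<^sup>2 * (u x)\<^sup>2)" using u by (simp add: in_L2_def)
    show "AE x in M01. norm (((u x)\<^sup>2)\<^sup>2) \<le> norm (A\<^sup>2 * (u x)\<^sup>2)"
      using A
    proof eventually_elim
      case (elim x)
      then have "(u x)\<^sup>2 \<le> A\<^sup>2" using power_mono[OF elim, of 2] by simp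
      then show ?case using mult_right_mono[of "(u x)\<^sup>2" "A\<^sup>2" "(u x)\<^sup>2"]
        by (simp add: power2_eq_square[of "(u x)\<^sup>2"] abs_mult del: mult_right_mono)
    qed
  qed measurable
  then show ?thesis using u by (auto simp: in_L2_def periodic1_def)
qed

lemma solves_of_heat_sol:
  assumes n: "1 \<le> n" and T: "0 < T" and v: "cadlag n T v" and w: "\<And>t. w t \<in> Hs n"
    and s: "heat_sol \<nu> T (\<lambda>s. Bx n (toX n (w s) + hpath n T v s) (toX n (w s) + hpath n T v s)) (\<lambda>t. toX n (w t))"
    and bw: "\<And>t. t \<in> {0..T} \<Longrightarrow> norm (toX n (w t)) \<le> B" and bv: "\<And>t. t \<in> {0..T} \<Longrightarrow> norm (hpath n T v t) \<le> B"
  shows "solves \<nu> T v w"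
proof -
  have H: "v s \<in> Hs n" if "s \<in> {0..T}" for s using v that by (auto simp: cadlag_def)
  have ru: "rc (\<lambda>x. w t x + v t x) = uc n (toX n (w t) + toX n (v t))" if "t \<in> {0..T}" for t
  proof
    fix j
    show "rc (\<lambda>x. w t x + v t x) j = uc n (toX n (w t) + toX n (v t)) j"
      using rc_add[OF Hs_imp_in_L2[OF w] Hs_imp_in_L2[OF H[OF that]], of t j] rc_eq_uc[OF w] rc_eq_uc[OF H[OF that]]
      by (simp only: uc_add)
  qed
  \<comment> \<open>The first entry bounds the coefficients of \<open>w\<close>; the second, through
    Young's inequality and the bound \<open>2 * B\<close> for the sum, those of the square of
    \<open>w + v\<close>.\<close>
  define C where "C = max (B\<^sup>2) ((2 * B)\<^sup>2 * (2 * B)\<^sup>2)"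
  show ?thesis
  proof (rule modes_imp_solves[where B = C])
    fix t assume t: "t \<in> {0..T}"
    show wL: "in_L2 (w t)" by (rule Hs_imp_in_L2[OF w])
    show "in_L2 (\<lambda>x. (w t x + v t x)\<^sup>2)"
      by (rule in_L2_square[OF n in_L2_add[OF wL Hs_imp_in_L2[OF H[OF t]]] ru[OF t]])
    have "rc (w t) = uc n (toX n (w t))" using rc_eq_uc[OF w] by blast
    then have "nsq (rc (w t)) \<le> B\<^sup>2"
      using nsq_uc_le[of n "toX n (w t)"] power_mono[OF bw[OF t], of 2] by simp
    then show "nsq (rc (w t)) \<le> C" by (simp add: C_def)
    define U where "U = toX n (w t) + toX n (v t)"
    have Ub: "(norm U)\<^sup>2 \<le> (2 * B)\<^sup>2"
      using norm_triangle_ineq[of "toX n (w t)" "toX n (v t)"] bw[OF t] bv[OF t] t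
      by (intro power_mono) (auto simp: U_def hpath_def)
    have rr: "rc (\<lambda>x. (w t x + v t x)\<^sup>2) = conv (uc n U) (uc n U)"
      unfolding U_def by (rule ext) (rule rc_square_eq_conv[OF w H[OF t]])
    have "(nl1 (uc n U))\<^sup>2 \<le> (2 * B)\<^sup>2"
      using power_mono[OF l1_uc(2)[OF n, of U], of 2] E1_le[OF n, of U] Ub by simp
    moreover have "nsq (uc n U) \<le> (2 * B)\<^sup>2" using nsq_uc_le[of n U] Ub by simp
    ultimately have "(nl1 (uc n U))\<^sup>2 * nsq (uc n U) \<le> (2 * B)\<^sup>2 * (2 * B)\<^sup>2" by (intro mult_mono) auto
    then show "nsq (rc (\<lambda>x. (w t x + v t x)\<^sup>2)) \<le> C"
      unfolding rr C_def using young_conv(2)[OF l1_uc(1)[OF n, of U] sqs_uc sqs_uc, of n U] by linarith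
    fix k
    define h where "h = heat_mode \<nu> k (\<lambda>s. cf (toX n (w s)) k) (\<lambda>s. cf (Bx n (toX n (w s) + hpath n T v s) (toX n (w s) + hpath n T v s)) k)"
    have h: "integrable (Leb t) h" "cf (toX n (w t)) k = (LINT s|Leb t. h s)"
      using s t unfolding heat_sol_def h_def by blast+
    have eq: "mode_rhs \<nu> (w s) (v s) k = h s / of_real (lam k ^ n)" if "s \<in> space (Leb t)" for s
    proof (cases "k = 0")
      case True
      then show ?thesis using n by (simp add: mode_rhs_def)
    next
      case False
      have "s \<in> {0..T}" using that t by auto
      from heat_mode_eq_mode_rhs[OF n w H[OF this], of \<nu> k s] this
      have "h s = of_real (lam k ^ n) * mode_rhs \<nu> (w s) (v s) k"
        by (simp only: h_def heat_mode_def hpath_def cl_id)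
      moreover have "complex_of_real (lam k ^ n) \<noteq> 0" using lam_ge_1[OF False] by auto
      ultimately show ?thesis by simp
    qed
    have "integrable (Leb t) (\<lambda>s. mode_rhs \<nu> (w s) (v s) k) = integrable (Leb t) (\<lambda>s. h s / of_real (lam k ^ n))"
      by (rule Bochner_Integration.integrable_cong[OF refl eq])
    then show "integrable (Leb t) (\<lambda>s. mode_rhs \<nu> (w s) (v s) k)" using h by simp
    have "(LINT s|Leb t. mode_rhs \<nu> (w s) (v s) k) = (LINT s|Leb t. h s / of_real (lam k ^ n))"
      by (rule Bochner_Integration.integral_cong[OF refl eq])
    also have "\<dots> = cf (toX n (w t)) k / of_real (lam k ^ n)" using h(2) by simp
    also have "\<dots> = rc (w t) k" by (rule rc_of_toX[OF w, symmetric])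
    finally show "rc (w t) k = (LINT s|Leb t. mode_rhs \<nu> (w s) (v s) k)" by simp
  qed
qed

lemma burgers_existence:
  assumes n: "1 \<le> n" and \<nu>: "0 < \<nu>" and T: "0 < T" and v: "cadlag n T v"
  shows "\<exists>w. cadlag n T w \<and> solves \<nu> T v w"
proof -
  obtain M where M: "\<And>t. t \<in> {0..T} \<Longrightarrow> norm (hpath n T v t) \<le> M" using hpath_bounded[OF v T] by blast
  obtain W where W: "continuous_on UNIV W" "heat_sol \<nu> T (\<lambda>s. Bx n (W s + hpath n T v s) (W s + hpath n T v s)) W"
    using burgers_exists[OF n \<nu> T rcont_hpath[OF v T] M] by blast
  \<comment> \<open>Representatives are chosen independently at each time. This is legitimate
    because \<open>cadlag\<close> and \<open>solves\<close> see a time slice only through norms and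
    integrals over \<open>x\<close>.\<close>
  have "\<forall>t. \<exists>u. u \<in> Hs n \<and> toX n u = W t" using ex_toX by blast
  then obtain w where w: "\<And>t. w t \<in> Hs n" "\<And>t. toX n (w t) = W t" by metis
  \<comment> \<open>Formulated for every filter below \<open>at t\<close>, to cover right-continuity
    and left limits together; the left limit is \<open>w t\<close> itself, as the solution is
    continuous in time even where \<open>v\<close> jumps.\<close>
  have cont: "((\<lambda>s. Hnorm n (w s - w t)) \<longlongrightarrow> 0) F" if "F \<le> at t" for t F
  proof -
    have "(W \<longlongrightarrow> W t) (at t)" using W(1) by (simp add: continuous_on_def)
    then have "(W \<longlongrightarrow> W t) F" by (rule tendsto_mono[OF that])
    then have "((\<lambda>s. norm (W s - W t)) \<longlongrightarrow> 0) F" using LIM_zero tendsto_norm_zero by blast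
    then show ?thesis by (simp add: Hnorm_diff w)
  qed
  have "cadlag n T w"
    unfolding cadlag_def using w(1) cont at_le[OF subset_UNIV] by blast
  moreover have "solves \<nu> T v w"
  proof -
    obtain B where B: "\<forall>y\<in>W ` {0..T}. norm y \<le> B"
      using compact_imp_bounded[OF compact_continuous_image[OF continuous_on_subset[OF W(1) subset_UNIV] compact_Icc]]
      unfolding bounded_iff by blast
    show ?thesis
    proof (rule solves_of_heat_sol[OF n T v w(1), where B = "max B M"])
      show "heat_sol \<nu> T (\<lambda>s. Bx n (toX n (w s) + hpath n T v s) (toX n (w s) + hpath n T v s)) (\<lambda>t. toX n (w t))"
        using W(2) by (simp add: w(2))
      show "norm (toX n (w t)) \<le> max B M" if "t \<in> {0..T}" for t
        using B that by (simp add: w(2) le_max_iff_disj)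
      show "norm (hpath n T v t) \<le> max B M" if "t \<in> {0..T}" for t using M[OF that] by simp
    qed
  qed
  ultimately show ?thesis by blast
qed

lemma burgers_uniqueness:
  assumes n: "1 \<le> n" and \<nu>: "0 < \<nu>" and T: "0 < T" and v: "cadlag n T v"
    and w1: "cadlag n T w1" "solves \<nu> T v w1" and w2: "cadlag n T w2" "solves \<nu> T v w2" and t: "t \<in> {0..T}"
  shows "AE x in M01. w1 t x = w2 t x"
proof -
  obtain B1 B2 B3 where B: "\<And>t. t \<in> {0..T} \<Longrightarrow> norm (hpath n T w1 t) \<le> B1"
    "\<And>t. t \<in> {0..T} \<Longrightarrow> norm (hpath n T w2 t) \<le> B2" "\<And>t. t \<in> {0..T} \<Longrightarrow> norm (hpath n T v t) \<le> B3"
    using hpath_bounded[OF v T] hpath_bounded[OF w1(1) T] hpath_bounded[OF w2(1) T] by metis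
  have "hpath n T w1 t = hpath n T w2 t"
    by (rule heat_sol_unique[OF n \<nu> heat_sol_of_solves[OF n v w1] heat_sol_of_solves[OF n v w2]
          rcont_hpath[OF w1(1) T] rcont_hpath[OF w2(1) T] rcont_hpath[OF v T], where B = "max B1 (max B2 B3)"])
      (use B t in \<open>auto simp: le_max_iff_disj\<close>)
  then show ?thesis
    using t w1(1) w2(1) by (intro toX_eq_imp_AE[of _ n]) (auto simp: hpath_def cadlag_def)
qed

section \<open>Gain of one derivative and the final bound\<close>

lemma Hs_Suc:
  assumes w: "w \<in> Hs n" and s: "sqs (\<lambda>k. of_real (lam k) * cf (toX n w) k)"
  shows "w \<in> Hs (Suc n)" "(Hnorm (Suc n) w)\<^sup>2 = nsq (\<lambda>k. of_real (lam k) * cf (toX n w) k)"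
proof -
  have eq: "cmod (dk k ^ Suc n * rc w k) = cmod (of_real (lam k) * cf (toX n w) k)" for k
    by (simp add: cf_toX[OF w] norm_mult norm_power)
  then show H: "w \<in> Hs (Suc n)"
    using w s by (simp add: Hs_iff sqs_def)
  show "(Hnorm (Suc n) w)\<^sup>2 = nsq (\<lambda>k. of_real (lam k) * cf (toX n w) k)"
    unfolding Hnorm_eq[OF H] nsq_def eq by (simp add: infsum_nonneg)
qed

text \<open>At the exceptional times \<open>Hnorm\<close> is a junk value, so its measurability in time comes from
  the completeness of Lebesgue measure.\<close>

lemma smoothing:
  assumes w: "\<And>t. t \<in> {0..T} \<Longrightarrow> w t \<in> Hs n" and r: "rcont (hpath n T w)"
    and bw: "\<And>t. t \<in> {0..T} \<Longrightarrow> norm (hpath n T w t) \<le> B"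
    and D: "\<And>K. finite K \<Longrightarrow> (LINT s|Leb T. (\<Sum>k\<in>K. (lam k)\<^sup>2 * (cmod (cf (hpath n T w s) k))\<^sup>2)) \<le> D"
  shows "AE t in Leb T. w t \<in> Hs (Suc n)"
    "integrable (Leb T) (\<lambda>t. (Hnorm (Suc n) (w t))\<^sup>2)"
    "(LINT t|Leb T. (Hnorm (Suc n) (w t))\<^sup>2) \<le> D"
proof -
  let ?M = "Leb T"
  define h where "h = (\<lambda>t. (Hnorm (Suc n) (w t))\<^sup>2)"
  define S where "S = (\<lambda>N s. \<Sum>k\<in>isym N. (lam k)\<^sup>2 * (cmod (cf (hpath n T w s) k))\<^sup>2)"
  define a where "a = (\<lambda>s k. complex_of_real (lam k) * cf (hpath n T w s) k)"
  have Sa: "S N s = (\<Sum>k\<in>isym N. (cmod (a s k))\<^sup>2)" for N s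
    by (simp add: S_def a_def norm_mult power_mult_distrib)
  have [measurable]: "(\<lambda>s. cf (hpath n T w s) k) \<in> borel_measurable ?M" for k
    by (intro borel_imp_lebesgue_on rcont_cf_measurable r)
  have Sm [measurable]: "S N \<in> borel_measurable ?M" for N unfolding S_def by measurable
  have S0: "0 \<le> S N s" for N s unfolding S_def by (intro sum_nonneg) auto
  have Smono: "S N s \<le> S N' s" if "N \<le> N'" for N N' s
    unfolding Sa using isym_mono[OF that] by (intro sum_mono2) auto
  have iS: "integrable ?M (S N)" for N
    unfolding S_def
    by (intro Bochner_Integration.integrable_sum integrable_mult_right integrable_norm_sq_bounded[where B = B])
      (measurable, use bw norm_cf_le order_trans in blast)
  \<comment> \<open>Monotone convergence in the extended reals: the supremum may be infinite at some
    times, and finiteness of its integral excludes this almost everywhere. Wherever it is finite,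
    \<open>w s\<close> lies in \<open>Hs (Suc n)\<close>.\<close>
  have "(\<integral>\<^sup>+s. (SUP N. ennreal (S N s)) \<partial>?M) = (SUP N. \<integral>\<^sup>+s. ennreal (S N s) \<partial>?M)"
    by (rule nn_integral_monotone_convergence_SUP)
      (auto simp: incseq_def le_fun_def intro!: ennreal_leI Smono)
  also have "\<dots> \<le> ennreal D"
  proof (rule SUP_least)
    fix N
    have "(\<integral>\<^sup>+s. ennreal (S N s) \<partial>?M) = ennreal (LINT s|?M. S N s)"
      by (rule nn_integral_eq_integral[OF iS]) (simp add: S0)
    also have "\<dots> \<le> ennreal D" using D[of "isym N"] by (intro ennreal_leI) (simp add: S_def)
    finally show "(\<integral>\<^sup>+s. ennreal (S N s) \<partial>?M) \<le> ennreal D" .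
  qed
  finally have nn: "(\<integral>\<^sup>+s. (SUP N. ennreal (S N s)) \<partial>?M) \<le> ennreal D" .
  then have fin: "AE s in ?M. (SUP N. ennreal (S N s)) \<noteq> \<infinity>"
    by (intro nn_integral_PInf_AE) (auto simp: top_unique)
  have good: "AE s in ?M. w s \<in> Hs (Suc n) \<and> (\<lambda>N. S N s) \<longlonglongrightarrow> h s"
    using fin AE_space
  proof eventually_elim
    case (elim s)
    then have s: "s \<in> {0..T}" by simp
    have hp: "hpath n T w s = toX n (w s)" using s by (simp add: hpath_def)
    obtain c where c: "0 \<le> c" "(SUP N. ennreal (S N s)) = ennreal c"
      using elim(1) by (cases "SUP N. ennreal (S N s)" rule: ennreal_cases) auto
    have "S N s \<le> c" for N
    proof -
      have "ennreal (S N s) \<le> ennreal c" unfolding c(2)[symmetric] by (rule SUP_upper) simp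
      then show ?thesis using c(1) by simp
    qed
    then have sq: "sqs (a s)" unfolding Sa by (rule sqsI_isym(1))
    then have "w s \<in> Hs (Suc n)" "h s = nsq (a s)"
      using Hs_Suc[OF w[OF s]] by (simp_all add: h_def a_def hp)
    then show ?case using nsq_isym_tendsto[OF sq] by (simp add: Sa)
  qed
  then show "AE t in ?M. w t \<in> Hs (Suc n)" by eventually_elim simp
  define L where "L = (\<lambda>s. lim (\<lambda>N. S N s))"
  have Lm: "L \<in> borel_measurable ?M" unfolding L_def by measurable
  have Lh: "AE s in ?M. L s = h s"
    using good by eventually_elim (simp add: L_def limI)
  have hm: "h \<in> borel_measurable ?M"
  proof -
    \<comment> \<open>Extension by 0 moves the argument to \<open>lebesgue\<close>, where a function
      equal almost everywhere to a measurable one is measurable.\<close>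
    have "(\<lambda>s. if s \<in> {0..T} then L s else 0) \<in> borel_measurable lebesgue"
      using Lm by (subst borel_measurable_if) auto
    moreover have "AE s in lebesgue. (if s \<in> {0..T} then L s else 0) = (if s \<in> {0..T} then h s else 0)"
      using Lh by (subst (asm) AE_restrict_space_iff) (auto elim: eventually_mono)
    ultimately have "(\<lambda>s. if s \<in> {0..T} then h s else 0) \<in> borel_measurable lebesgue"
      by (rule borel_measurable_AE)
    then show ?thesis by (subst (asm) borel_measurable_if) auto
  qed
  have hnn: "(\<integral>\<^sup>+s. ennreal (h s) \<partial>?M) \<le> ennreal D"
  proof -
    have "(\<integral>\<^sup>+s. ennreal (h s) \<partial>?M) = (\<integral>\<^sup>+s. (SUP N. ennreal (S N s)) \<partial>?M)"
    proof (rule nn_integral_cong_AE)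
      show "AE s in ?M. ennreal (h s) = (SUP N. ennreal (S N s))"
        using good
      proof eventually_elim
        case (elim s)
        then have "(\<lambda>N. ennreal (S N s)) \<longlonglongrightarrow> ennreal (h s)" by (intro tendsto_ennrealI) auto
        moreover have "(\<lambda>N. ennreal (S N s)) \<longlonglongrightarrow> (SUP N. ennreal (S N s))"
          by (rule LIMSEQ_SUP) (auto simp: incseq_def intro!: ennreal_leI Smono)
        ultimately show ?case by (rule LIMSEQ_unique)
      qed
    qed
    then show ?thesis using nn by simp
  qed
  have h0: "0 \<le> h s" for s by (simp add: h_def)
  show ih: "integrable ?M (\<lambda>t. (Hnorm (Suc n) (w t))\<^sup>2)"
    unfolding h_def[symmetric]
  proof (rule integrableI_bounded[OF hm])
    have "(\<integral>\<^sup>+s. ennreal (norm (h s)) \<partial>?M) \<le> ennreal D" using hnn h0 by simp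
    also have "\<dots> < \<infinity>" by simp
    finally show "(\<integral>\<^sup>+s. ennreal (norm (h s)) \<partial>?M) < \<infinity>" .
  qed
  \<comment> \<open>The empty set of modes shows that \<open>D\<close> is nonnegative, so the
    inequality between extended reals can be read as one between reals.\<close>
  have "0 \<le> D" using D[of "{}"] by simp
  moreover have "ennreal (LINT s|?M. h s) \<le> ennreal D"
    using hnn nn_integral_eq_integral[OF ih[folded h_def]] h0 by simp
  ultimately show "(LINT t|?M. (Hnorm (Suc n) (w t))\<^sup>2) \<le> D"
    by (simp add: h_def)
qed

text \<open>Every cadlag solution, however obtained, is an instance of the truncated setting with
  constant factor 1. Taking \<open>Dnorm n T v\<close> for \<open>M\<close> makes the constant
  depend on \<open>v\<close> through this norm alone.\<close>

lemma burgers_apriori: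
  assumes n: "1 \<le> n" and \<nu>: "0 < \<nu>" and T: "0 < T"
    and v: "cadlag n T v" and w: "cadlag n T w" and s: "solves \<nu> T v w"
  shows "AE t in Leb T. w t \<in> Hs (Suc n)"
    "integrable (Leb T) (\<lambda>t. (Hnorm (Suc n) (w t))\<^sup>2)"
    "(Dnorm n T w)\<^sup>2 + (LINT t|Leb T. (Hnorm (Suc n) (w t))\<^sup>2)
       \<le> apSup n \<nu> T (Dnorm n T v) + apInt n \<nu> T (Dnorm n T v)"
proof -
  obtain B where B: "\<And>t. t \<in> {0..T} \<Longrightarrow> norm (hpath n T w t) \<le> B" using hpath_bounded[OF w T] by blast
  interpret truncated_burgers n \<nu> T "Dnorm n T v" B "hpath n T w" "hpath n T v" "\<lambda>s. 1"
  proof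
    show "rcont (\<lambda>s. 1 :: real)" by (intro continuous_imp_rcont continuous_intros)
    show "heat_sol \<nu> T (\<lambda>s. 1 *\<^sub>R Bx n (hpath n T w s + hpath n T v s) (hpath n T w s + hpath n T v s)) (hpath n T w)"
      using heat_sol_of_solves[OF n v w s] by simp
  qed (use n \<nu> T rcont_hpath[OF w T] rcont_hpath[OF v T] B norm_hpath_le_Dnorm[OF v T] in auto)
  have H: "w t \<in> Hs n" if "t \<in> {0..T}" for t using w that by (simp add: cadlag_def)
  note sm = smoothing[OF H rcont_hpath[OF w T] B apriori_int]
  show "AE t in Leb T. w t \<in> Hs (Suc n)" by (rule sm(1))
  show "integrable (Leb T) (\<lambda>t. (Hnorm (Suc n) (w t))\<^sup>2)" by (rule sm(2))
  have le: "Hnorm n (w t) \<le> sqrt (apSup n \<nu> T (Dnorm n T v))" if "t \<in> {0..T}" for t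
    using real_le_rsqrt[OF apriori_sup[OF that]] norm_hpath[OF w that] by simp
  have T0: "0 \<in> {0..T}" using T by simp
  have "Dnorm n T w \<le> sqrt (apSup n \<nu> T (Dnorm n T v))"
    unfolding Dnorm_def[of n T w] using T0 le by (intro cSUP_least) auto
  moreover have "0 \<le> Dnorm n T w"
    using norm_hpath_le_Dnorm[OF w T T0] norm_ge_zero order_trans by blast
  moreover have "0 \<le> apSup n \<nu> T (Dnorm n T v)"
    using apriori_sup[OF T0] zero_le_power2 order_trans by blast
  ultimately have "(Dnorm n T w)\<^sup>2 \<le> apSup n \<nu> T (Dnorm n T v)"
    using power_mono[of "Dnorm n T w" "sqrt (apSup n \<nu> T (Dnorm n T v))" 2] by simp
  then show "(Dnorm n T w)\<^sup>2 + (LINT t|Leb T. (Hnorm (Suc n) (w t))\<^sup>2)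
       \<le> apSup n \<nu> T (Dnorm n T v) + apInt n \<nu> T (Dnorm n T v)"
    using sm(3) by linarith
qed

theorem theorem3p1:
  fixes \<nu> T :: real and n :: nat
  assumes "0 < \<nu>" and "\<nu> \<le> 1" and "1 \<le> n" and "0 < T"
  shows "(\<forall>v. cadlag n T v \<longrightarrow>
            (\<exists>w. cadlag n T w \<and> solves \<nu> T v w)
          \<and> (\<forall>w1 w2. cadlag n T w1 \<and> solves \<nu> T v w1 \<and> cadlag n T w2 \<and> solves \<nu> T v w2
               \<longrightarrow> (\<forall>t\<in>{0..T}. AE x in lebesgue_on {0..1}. w1 t x = w2 t x)))
       \<and> (\<exists>C :: real \<Rightarrow> real. (\<forall>r. 0 < C r) \<and>
            (\<forall>v w. cadlag n T v \<and> cadlag n T w \<and> solves \<nu> T v w \<longrightarrow>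
               (AE t in lebesgue_on {0..T}. w t \<in> Hs (Suc n))
             \<and> integrable (lebesgue_on {0..T}) (\<lambda>t. (Hnorm (Suc n) (w t))\<^sup>2)
             \<and> (Dnorm n T w)\<^sup>2 + (LINT t|lebesgue_on {0..T}. (Hnorm (Suc n) (w t))\<^sup>2)
                 \<le> C (Dnorm n T v)))"
proof (rule conjI)
  note a = assms(3,1,4)
  show "\<forall>v. cadlag n T v \<longrightarrow>
            (\<exists>w. cadlag n T w \<and> solves \<nu> T v w)
          \<and> (\<forall>w1 w2. cadlag n T w1 \<and> solves \<nu> T v w1 \<and> cadlag n T w2 \<and> solves \<nu> T v w2
               \<longrightarrow> (\<forall>t\<in>{0..T}. AE x in lebesgue_on {0..1}. w1 t x = w2 t x))"
    using burgers_existence[OF a] burgers_uniqueness[OF a] by blast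
  \<comment> \<open>Positivity is demanded at every real argument, also at negative ones, which are
    not norms; the absolute value and the summand 1 provide it.\<close>
  define C where "C = (\<lambda>r. 1 + \<bar>apSup n \<nu> T r + apInt n \<nu> T r\<bar>)"
  have "0 < C r" for r by (simp add: C_def add_pos_nonneg)
  moreover have "(Dnorm n T w)\<^sup>2 + (LINT t|lebesgue_on {0..T}. (Hnorm (Suc n) (w t))\<^sup>2) \<le> C (Dnorm n T v)"
    if "cadlag n T v" "cadlag n T w" "solves \<nu> T v w" for v w
    using burgers_apriori(3)[OF a that] by (simp add: C_def)
  ultimately show "\<exists>C :: real \<Rightarrow> real. (\<forall>r. 0 < C r) \<and>
            (\<forall>v w. cadlag n T v \<and> cadlag n T w \<and> solves \<nu> T v w \<longrightarrow>
               (AE t in lebesgue_on {0..T}. w t \<in> Hs (Suc n))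
             \<and> integrable (lebesgue_on {0..T}) (\<lambda>t. (Hnorm (Suc n) (w t))\<^sup>2)
             \<and> (Dnorm n T w)\<^sup>2 + (LINT t|lebesgue_on {0..T}. (Hnorm (Suc n) (w t))\<^sup>2)
                 \<le> C (Dnorm n T v))"
    using burgers_apriori(1,2)[OF a] by blast
qed

end
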